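(* Let $R$ be a ring, let $P$ be a finitely generated projective right $R$-module, and let $I\subseteq J(R)$ be a two-sided ideal of $R$. Assume that there is a split exact sequence of right $R/I$-modules $$0\to X\to P/PI\to X'\to 0.$$ Then the following statements are equivalent: (i) There exists a (countably generated) projective right $R$-module $Q$ such that $Q/QI\cong X$. (ii) There exists a (countably generated) projective left $R$-module $Q'$ such that $Q'/IQ'\cong\mathrm{Hom}_{R/I}(X',R/I)$. When the equivalent statements (i) and (ii) hold, $Q$ is isomorphic to a pure submodule of $P$, and $Q'$ is isomorphic to a pure submodule of $\mathrm{Hom}_R(P,R)$. Moreover, $Q$ is finitely generated if and only if $Q'$ is finitely generated, if and only if there exists a projective right $R$-module $P'$ such that $P'/P'I\cong X'$.
   Context: All rings are associative with $1$. $J(R)$ denotes the Jacobson radical of $R$. For a right $R$-module $P$, $\mathrm{Hom}_R(P,R)$ is regarded as a left $R$-module, and for a right $R/I$-module $X'$, $\mathrm{Hom}_{R/I}(X',R/I)$ is regarded as a left $R/I$-module. *)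

theory Defs
  imports "HOL-Library.Countable_Set" "HOL-Algebra.QuotRing" "HOL-Algebra.Module"
begin

section \<open>One-sided modules over a not necessarily commutative ring\<close>

text \<open>
  The locale \<^locale>\<open>module\<close> of HOL-Algebra requires a commutative ring, so only its
  record type is reused. For a left module, \<open>a \<odot>\<^bsub>M\<^esub> x\<close> stands for $ax$; for a right
  module it stands for $xa$. The fields \<open>mult\<close> and \<open>one\<close> of the record play no role.
  The notions of submodule, homomorphism, span and quotient below do not depend on the side.
\<close>

locale left_module = R?: ring R + M?: abelian_group M
  for R :: "('a, 'r) ring_scheme" (structure) and M :: "('a, 'm, 'd) module_scheme" (structure) +
  assumes smult_closed:
      "\<lbrakk>a \<in> carrier R; x \<in> carrier M\<rbrakk> \<Longrightarrow> a \<odot>\<^bsub>M\<^esub> x \<in> carrier M"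
    and smult_l_distr:
      "\<lbrakk>a \<in> carrier R; b \<in> carrier R; x \<in> carrier M\<rbrakk>
        \<Longrightarrow> (a \<oplus>\<^bsub>R\<^esub> b) \<odot>\<^bsub>M\<^esub> x = a \<odot>\<^bsub>M\<^esub> x \<oplus>\<^bsub>M\<^esub> b \<odot>\<^bsub>M\<^esub> x"
    and smult_r_distr:
      "\<lbrakk>a \<in> carrier R; x \<in> carrier M; y \<in> carrier M\<rbrakk>
        \<Longrightarrow> a \<odot>\<^bsub>M\<^esub> (x \<oplus>\<^bsub>M\<^esub> y) = a \<odot>\<^bsub>M\<^esub> x \<oplus>\<^bsub>M\<^esub> a \<odot>\<^bsub>M\<^esub> y"
    and smult_assoc:
      "\<lbrakk>a \<in> carrier R; b \<in> carrier R; x \<in> carrier M\<rbrakk>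
        \<Longrightarrow> (a \<otimes>\<^bsub>R\<^esub> b) \<odot>\<^bsub>M\<^esub> x = a \<odot>\<^bsub>M\<^esub> (b \<odot>\<^bsub>M\<^esub> x)"
    and smult_one:
      "x \<in> carrier M \<Longrightarrow> \<one>\<^bsub>R\<^esub> \<odot>\<^bsub>M\<^esub> x = x"

locale right_module = R?: ring R + M?: abelian_group M
  for R :: "('a, 'r) ring_scheme" (structure) and M :: "('a, 'm, 'd) module_scheme" (structure) +
  assumes smult_closed:
      "\<lbrakk>a \<in> carrier R; x \<in> carrier M\<rbrakk> \<Longrightarrow> a \<odot>\<^bsub>M\<^esub> x \<in> carrier M"
    and smult_l_distr:
      "\<lbrakk>a \<in> carrier R; b \<in> carrier R; x \<in> carrier M\<rbrakk>
        \<Longrightarrow> (a \<oplus>\<^bsub>R\<^esub> b) \<odot>\<^bsub>M\<^esub> x = a \<odot>\<^bsub>M\<^esub> x \<oplus>\<^bsub>M\<^esub> b \<odot>\<^bsub>M\<^esub> x"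
    and smult_r_distr:
      "\<lbrakk>a \<in> carrier R; x \<in> carrier M; y \<in> carrier M\<rbrakk>
        \<Longrightarrow> a \<odot>\<^bsub>M\<^esub> (x \<oplus>\<^bsub>M\<^esub> y) = a \<odot>\<^bsub>M\<^esub> x \<oplus>\<^bsub>M\<^esub> a \<odot>\<^bsub>M\<^esub> y"
    and smult_assoc:
      "\<lbrakk>a \<in> carrier R; b \<in> carrier R; x \<in> carrier M\<rbrakk>
        \<Longrightarrow> (a \<otimes>\<^bsub>R\<^esub> b) \<odot>\<^bsub>M\<^esub> x = b \<odot>\<^bsub>M\<^esub> (a \<odot>\<^bsub>M\<^esub> x)"
    and smult_one:
      "x \<in> carrier M \<Longrightarrow> \<one>\<^bsub>R\<^esub> \<odot>\<^bsub>M\<^esub> x = x"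

definition mod_hom ::
  "('a, 'r) ring_scheme \<Rightarrow> ('a, 'm, 'd) module_scheme \<Rightarrow> ('a, 'n, 'e) module_scheme \<Rightarrow> ('m \<Rightarrow> 'n) set"
  where "mod_hom R M N = {h \<in> carrier M \<rightarrow> carrier N.
    (\<forall>x\<in>carrier M. \<forall>y\<in>carrier M. h (x \<oplus>\<^bsub>M\<^esub> y) = h x \<oplus>\<^bsub>N\<^esub> h y) \<and>
    (\<forall>a\<in>carrier R. \<forall>x\<in>carrier M. h (a \<odot>\<^bsub>M\<^esub> x) = a \<odot>\<^bsub>N\<^esub> h x)}"

definition mod_iso ::
  "('a, 'r) ring_scheme \<Rightarrow> ('a, 'm, 'd) module_scheme \<Rightarrow> ('a, 'n, 'e) module_scheme \<Rightarrow> bool"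
  where "mod_iso R M N \<longleftrightarrow> (\<exists>h \<in> mod_hom R M N. bij_betw h (carrier M) (carrier N))"

definition mod_span ::
  "('a, 'r) ring_scheme \<Rightarrow> ('a, 'm, 'd) module_scheme \<Rightarrow> 'm set \<Rightarrow> 'm set"
  where "mod_span R M S = \<Inter>{N. submodule N R M \<and> S \<subseteq> N}"

definition fin_gen :: "('a, 'r) ring_scheme \<Rightarrow> ('a, 'm, 'd) module_scheme \<Rightarrow> bool"
  where "fin_gen R M \<longleftrightarrow> (\<exists>S \<subseteq> carrier M. finite S \<and> mod_span R M S = carrier M)"

definition countably_gen :: "('a, 'r) ring_scheme \<Rightarrow> ('a, 'm, 'd) module_scheme \<Rightarrow> bool"
  where "countably_gen R M \<longleftrightarrow> (\<exists>S \<subseteq> carrier M. countable S \<and> mod_span R M S = carrier M)"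

definition direct_summand ::
  "('a, 'r) ring_scheme \<Rightarrow> ('a, 'm, 'd) module_scheme \<Rightarrow> 'm set \<Rightarrow> bool"
  where "direct_summand R M U \<longleftrightarrow> submodule U R M \<and>
    (\<exists>V. submodule V R M \<and> U \<inter> V = {\<zero>\<^bsub>M\<^esub>} \<and> U <+>\<^bsub>M\<^esub> V = carrier M)"

text \<open>Finite systems of linear equations with coefficients in the ring and constants in \<open>N\<close>
  that are solvable in \<open>M\<close> are solvable in \<open>N\<close>.\<close>

definition pure_submodule ::
  "('a, 'r) ring_scheme \<Rightarrow> ('a, 'm, 'd) module_scheme \<Rightarrow> 'm set \<Rightarrow> bool"
  where "pure_submodule R M N \<longleftrightarrow> submodule N R M \<and>
    (\<forall>(k::nat) (n::nat) A c.
       (\<forall>i<k. \<forall>j<n. A i j \<in> carrier R) \<longrightarrow> (\<forall>i<k. c i \<in> N) \<longrightarrow>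
       (\<exists>x. (\<forall>j<n. x j \<in> carrier M) \<and> (\<forall>i<k. (\<Oplus>\<^bsub>M\<^esub>j\<in>{..<n}. A i j \<odot>\<^bsub>M\<^esub> x j) = c i)) \<longrightarrow>
       (\<exists>y. (\<forall>j<n. y j \<in> N) \<and> (\<forall>i<k. (\<Oplus>\<^bsub>M\<^esub>j\<in>{..<n}. A i j \<odot>\<^bsub>M\<^esub> y j) = c i)))"


section \<open>Regular, free and projective modules\<close>

definition left_regular :: "('a, 'r) ring_scheme \<Rightarrow> ('a, 'a) module"
  where "left_regular R = \<lparr>carrier = carrier R, mult = mult R, one = one R, zero = zero R,
    add = add R, smult = (\<lambda>a x. a \<otimes>\<^bsub>R\<^esub> x)\<rparr>"

definition right_regular :: "('a, 'r) ring_scheme \<Rightarrow> ('a, 'a) module"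
  where "right_regular R = \<lparr>carrier = carrier R, mult = mult R, one = one R, zero = zero R,
    add = add R, smult = (\<lambda>a x. x \<otimes>\<^bsub>R\<^esub> a)\<rparr>"

text \<open>The direct sum $M^{(B)}$ of copies of $M$: finitely supported families.\<close>

definition copower :: "('a, 'm, 'd) module_scheme \<Rightarrow> 'b set \<Rightarrow> ('a, 'b \<Rightarrow> 'm) module"
  where "copower M B = \<lparr>
    carrier = {h \<in> B \<rightarrow>\<^sub>E carrier M. finite {b \<in> B. h b \<noteq> \<zero>\<^bsub>M\<^esub>}},
    mult = undefined, one = undefined,
    zero = (\<lambda>b\<in>B. \<zero>\<^bsub>M\<^esub>),
    add = (\<lambda>h k. \<lambda>b\<in>B. h b \<oplus>\<^bsub>M\<^esub> k b),
    smult = (\<lambda>a h. \<lambda>b\<in>B. a \<odot>\<^bsub>M\<^esub> h b)\<rparr>"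

text \<open>
  Projective means isomorphic to a direct summand of a free module. It suffices to consider
  bases inside the type of elements of \<open>M\<close>: \<open>M\<close> is a quotient of the free module with basis
  \<open>carrier M\<close>, and the quotient map splits if \<open>M\<close> is a summand of any free module whatsoever.
\<close>

definition projective_left :: "('a, 'r) ring_scheme \<Rightarrow> ('a, 'm, 'd) module_scheme \<Rightarrow> bool"
  where "projective_left R M \<longleftrightarrow> left_module R M \<and>
    (\<exists>(B :: 'm set) U. direct_summand R (copower (left_regular R) B) U \<and>
       mod_iso R M ((copower (left_regular R) B)\<lparr>carrier := U\<rparr>))"

definition projective_right :: "('a, 'r) ring_scheme \<Rightarrow> ('a, 'm, 'd) module_scheme \<Rightarrow> bool"
  where "projective_right R M \<longleftrightarrow> right_module R M \<and>
    (\<exists>(B :: 'm set) U. direct_summand R (copower (right_regular R) B) U \<and>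
       mod_iso R M ((copower (right_regular R) B)\<lparr>carrier := U\<rparr>))"


section \<open>Jacobson radical, reduction modulo an ideal, duals, split exact sequences\<close>

definition maximal_right_ideal :: "('a, 'r) ring_scheme \<Rightarrow> 'a set \<Rightarrow> bool"
  where "maximal_right_ideal R K \<longleftrightarrow> submodule K R (right_regular R) \<and> K \<noteq> carrier R \<and>
    (\<forall>L. submodule L R (right_regular R) \<longrightarrow> K \<subseteq> L \<longrightarrow> L = K \<or> L = carrier R)"

text \<open>Intersecting with the carrier matters only for the zero ring, which is its own radical.\<close>

definition jacobson_radical :: "('a, 'r) ring_scheme \<Rightarrow> 'a set"
  where "jacobson_radical R = carrier R \<inter> \<Inter>{K. maximal_right_ideal R K}"

text \<open>$MI$ for a right module, $IM$ for a left module.\<close>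

definition ideal_mult ::
  "('a, 'r) ring_scheme \<Rightarrow> 'a set \<Rightarrow> ('a, 'm, 'd) module_scheme \<Rightarrow> 'm set"
  where "ideal_mult R I M = mod_span R M {a \<odot>\<^bsub>M\<^esub> x |a x. a \<in> I \<and> x \<in> carrier M}"

text \<open>The module $M/MI$ (respectively $M/IM$) over $R/I$; the union in the scalar multiplication
  is that of \<^const>\<open>rcoset_mult\<close> and makes $(a + I)(x + IM) = ax + IM$.\<close>

definition mod_reduction ::
  "('a, 'r) ring_scheme \<Rightarrow> 'a set \<Rightarrow> ('a, 'm, 'd) module_scheme \<Rightarrow> ('a set, 'm set) module"
  where "mod_reduction R I M = \<lparr>
    carrier = a_rcosets\<^bsub>M\<^esub> (ideal_mult R I M),
    mult = undefined, one = undefined,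
    zero = ideal_mult R I M,
    add = set_add M,
    smult = (\<lambda>A C. \<Union>a\<in>A. \<Union>x\<in>C. ideal_mult R I M +>\<^bsub>M\<^esub> (a \<odot>\<^bsub>M\<^esub> x))\<rparr>"

text \<open>For a right module \<open>M\<close>, the left module $\mathrm{Hom}_R(M,R)$ with $(ah)(x) = a\,h(x)$.
  Functions are taken to be \<^const>\<open>undefined\<close> outside \<open>carrier M\<close>, so that distinct elements are
  distinct homomorphisms.\<close>

definition right_dual ::
  "('a, 'r) ring_scheme \<Rightarrow> ('a, 'm, 'd) module_scheme \<Rightarrow> ('a, 'm \<Rightarrow> 'a) module"
  where "right_dual R M = \<lparr>
    carrier = mod_hom R M (right_regular R) \<inter> extensional (carrier M),
    mult = undefined, one = undefined,
    zero = (\<lambda>x\<in>carrier M. \<zero>\<^bsub>R\<^esub>),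
    add = (\<lambda>h k. \<lambda>x\<in>carrier M. h x \<oplus>\<^bsub>R\<^esub> k x),
    smult = (\<lambda>a h. \<lambda>x\<in>carrier M. a \<otimes>\<^bsub>R\<^esub> h x)\<rparr>"

text \<open>$0 \to X \to Y \to Z \to 0$ with maps \<open>f\<close>, \<open>g\<close> is exact and \<open>g\<close> has a section.\<close>

definition split_exact ::
  "('a, 'r) ring_scheme \<Rightarrow> ('a, 'x, 'd) module_scheme \<Rightarrow> ('x \<Rightarrow> 'y) \<Rightarrow>
   ('a, 'y, 'e) module_scheme \<Rightarrow> ('y \<Rightarrow> 'z) \<Rightarrow> ('a, 'z, 'f) module_scheme \<Rightarrow> bool"
  where "split_exact R X f Y g Z \<longleftrightarrow>
    f \<in> mod_hom R X Y \<and> g \<in> mod_hom R Y Z \<and>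
    inj_on f (carrier X) \<and>
    f ` carrier X = {y \<in> carrier Y. g y = \<zero>\<^bsub>Z\<^esub>} \<and>
    g ` carrier Y = carrier Z \<and>
    (\<exists>s \<in> mod_hom R Z Y. \<forall>z\<in>carrier Z. g (s z) = z)"

definition right_lift ::
  "('a, 'r) ring_scheme \<Rightarrow> 'a set \<Rightarrow> ('a set, 'x, 'd) module_scheme \<Rightarrow> ('a, 'm, 'e) module_scheme \<Rightarrow> bool"
  where "right_lift R I X Q \<longleftrightarrow>
    projective_right R Q \<and> mod_iso (R Quot I) (mod_reduction R I Q) X"

definition left_lift ::
  "('a, 'r) ring_scheme \<Rightarrow> 'a set \<Rightarrow> ('a set, 'x, 'd) module_scheme \<Rightarrow> ('a, 'm, 'e) module_scheme \<Rightarrow> bool"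
  where "left_lift R I X Q \<longleftrightarrow>
    projective_left R Q \<and> mod_iso (R Quot I) (mod_reduction R I Q) X"

text \<open>
  In HOL an existential statement over modules has to fix the type of their elements.
  Every countably generated projective module embeds into the free module on \<open>UNIV :: nat set\<close>,
  hence is isomorphic to one with elements in \<^typ>\<open>nat \<Rightarrow> 'a\<close>; this is the type used whenever
  the existence of a module is asserted.
\<close>

end

theory Submission
  imports Defs
begin

text \<open>
  Write $X$ as the image of an endomorphism \<open>e\<close> of \<open>P\<close> that is idempotent modulo \<open>I\<close>. Lifting
  $X \rightarrow P/PI \rightarrow X$ gives maps \<open>f : Q \<rightarrow> P\<close> and \<open>g : P \<rightarrow> Q\<close> with
  $gf \equiv 1$ and $fg \equiv e$. By Nakayama's lemma $gf$ has a left inverse on every finite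
  subset of $Q$, so \<open>f\<close> is pure, and for \<open>a = fg\<close> there is $b \equiv e$ with $ba = a$. Hence
  $c = 1 - b$ satisfies $ca = 0$, $a \equiv e$ and $c \equiv 1 - e$; conversely such a pair
  $(a, c)$ allows one to construct $Q$. Passing to $\mathrm{Hom}_R(P,R)$, whose endomorphism ring is
  opposite to that of $P$, turns the condition on $(a, c)$ for $e$ into the condition on
  $(c^*, a^*)$ for $(1 - e)^*$, which is the symmetry between (i) and (ii). Left modules are treated
  as right modules over the opposite ring. Finite generation of \<open>Q\<close> amounts to the existence of an
  idempotent endomorphism congruent to \<open>e\<close>, a condition invariant under $e \mapsto 1 - e$ and under
  duality.
\<close>

section \<open>Modules, submodules and homomorphisms\<close>

text \<open>The obstacle is that a lift Q need not be finitely generated. An endomorphism of Q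
  congruent to the identity is then injective but possibly not onto, so gf cannot be inverted and fg
  cannot be corrected to an idempotent. What survives is a left inverse on a prescribed finite set.
  Since P is finitely generated, the finite set of the g(p_i) already controls all of fg, which is
  why a single endomorphism b suffices. The resulting condition speaks of endomorphisms of P only.
  It mentions neither Q nor its side nor the type of its elements, so existence statements about
  different kinds of modules can be compared through it. In the converse direction, ca = 0 gives aa
  = (a + c)a = ua with u a unit. So a fails to be idempotent only by a unit, and the conjugates of
  (u inverse)a by the powers of u form an ascending chain that replaces one idempotent. Dual bases
  carry the whole argument: they survive retracts, they read off membership in PI from coordinates,
  and a finite one is dualised by exchanging vectors and functionals.\<close>

lemma (in abelian_group) minus_eq_zero_iff:
  "\<lbrakk>x \<in> carrier G; y \<in> carrier G\<rbrakk> \<Longrightarrow> x \<ominus> y = \<zero> \<longleftrightarrow> x = y"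
  by (metis a_minus_def add.inv_closed add.r_inv minus_equality minus_minus)

lemma (in abelian_group) minus_add_cancel:
  "\<lbrakk>x \<in> carrier G; y \<in> carrier G\<rbrakk> \<Longrightarrow> (x \<ominus> y) \<oplus> y = x"
  by (simp add: a_minus_def a_assoc l_neg)

lemma (in abelian_group) add_minus_cancel:
  "\<lbrakk>x \<in> carrier G; y \<in> carrier G\<rbrakk> \<Longrightarrow> y \<oplus> (x \<ominus> y) = x"
  by (metis a_comm minus_add_cancel minus_closed)

lemma (in abelian_group) minus_minus_cancel:
  "\<lbrakk>x \<in> carrier G; y \<in> carrier G\<rbrakk> \<Longrightarrow> x \<ominus> (x \<ominus> y) = y"
  by (simp add: a_minus_def minus_add r_neg2)

lemma (in abelian_group) uminus_zero: "\<ominus> \<zero> = \<zero>"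
  by (metis l_zero minus_equality zero_closed)

lemma (in abelian_group) a_lcomm_cancel:
  assumes "x \<in> carrier G" "y \<in> carrier G" "z \<in> carrier G"
  shows "x \<oplus> (y \<oplus> (\<ominus> x \<oplus> z)) = y \<oplus> z"
  using assms a_lcomm[of y "\<ominus> x" z] by (simp add: r_neg2)

lemma (in abelian_group) add_eq_add_imp_minus_eq:
  assumes "a \<oplus> b = c \<oplus> d" "a \<in> carrier G" "b \<in> carrier G" "c \<in> carrier G" "d \<in> carrier G"
  shows "a \<ominus> c = d \<ominus> b"
proof -
  have "a \<ominus> c = (a \<oplus> b) \<oplus> (\<ominus> b \<oplus> \<ominus> c)"
    using assms(2-) by (simp add: a_minus_def a_assoc r_neg2)
  also have "\<dots> = (c \<oplus> d) \<oplus> (\<ominus> c \<oplus> \<ominus> b)" using assms by (simp add: a_comm)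
  also have "\<dots> = d \<ominus> b" using assms(2-) by (simp add: a_minus_def a_assoc a_lcomm_cancel)
  finally show ?thesis .
qed

context right_module
begin

lemma smult_zero_right: "a \<in> carrier R \<Longrightarrow> a \<odot>\<^bsub>M\<^esub> \<zero>\<^bsub>M\<^esub> = \<zero>\<^bsub>M\<^esub>"
  using smult_r_distr[of a "\<zero>\<^bsub>M\<^esub>" "\<zero>\<^bsub>M\<^esub>"] smult_closed[of a "\<zero>\<^bsub>M\<^esub>"]
  by (simp add: M.add.r_cancel_one' flip: M.add.l_cancel_one')

lemma smult_zero_left: "x \<in> carrier M \<Longrightarrow> \<zero> \<odot>\<^bsub>M\<^esub> x = \<zero>\<^bsub>M\<^esub>"
  using smult_l_distr[of "\<zero>" "\<zero>" x] smult_closed[of "\<zero>" x]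
  by (simp add: M.add.r_cancel_one' flip: M.add.l_cancel_one')

lemma smult_uminus_left:
  assumes "a \<in> carrier R" "x \<in> carrier M" shows "(\<ominus> a) \<odot>\<^bsub>M\<^esub> x = \<ominus>\<^bsub>M\<^esub> (a \<odot>\<^bsub>M\<^esub> x)"
proof -
  have "(\<ominus> a) \<odot>\<^bsub>M\<^esub> x \<oplus>\<^bsub>M\<^esub> a \<odot>\<^bsub>M\<^esub> x = \<zero>\<^bsub>M\<^esub>"
    using assms smult_l_distr[of "\<ominus> a" a x] by (simp add: R.l_neg smult_zero_left)
  then show ?thesis using assms smult_closed M.minus_equality by (simp add: M.minus_equality)
qed

lemma smult_uminus_right:
  assumes "a \<in> carrier R" "x \<in> carrier M" shows "a \<odot>\<^bsub>M\<^esub> (\<ominus>\<^bsub>M\<^esub> x) = \<ominus>\<^bsub>M\<^esub> (a \<odot>\<^bsub>M\<^esub> x)"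
proof -
  have "a \<odot>\<^bsub>M\<^esub> (\<ominus>\<^bsub>M\<^esub> x) \<oplus>\<^bsub>M\<^esub> a \<odot>\<^bsub>M\<^esub> x = \<zero>\<^bsub>M\<^esub>"
    using assms smult_r_distr[of a "\<ominus>\<^bsub>M\<^esub> x" x] by (simp add: M.l_neg smult_zero_right)
  then show ?thesis using assms smult_closed by (simp add: M.minus_equality)
qed

lemma uminus_eq_smult: "x \<in> carrier M \<Longrightarrow> \<ominus>\<^bsub>M\<^esub> x = (\<ominus> \<one>) \<odot>\<^bsub>M\<^esub> x"
  by (simp add: smult_uminus_left smult_one)

text \<open>Closure under negation comes from the scalar -1.\<close>

lemma submodule_intro:
  assumes "N \<subseteq> carrier M" "\<zero>\<^bsub>M\<^esub> \<in> N"
    and "\<And>x y. x \<in> N \<Longrightarrow> y \<in> N \<Longrightarrow> x \<oplus>\<^bsub>M\<^esub> y \<in> N"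
    and "\<And>a x. a \<in> carrier R \<Longrightarrow> x \<in> N \<Longrightarrow> a \<odot>\<^bsub>M\<^esub> x \<in> N"
  shows "submodule N R M"
proof -
  have "\<ominus>\<^bsub>M\<^esub> x \<in> N" if "x \<in> N" for x
    using assms(4)[of "\<ominus> \<one>" x] that assms(1) uminus_eq_smult[of x] by auto
  then have "inv\<^bsub>add_monoid M\<^esub> x \<in> N" if "x \<in> N" for x
    using that by (simp add: a_inv_def)
  then show ?thesis
    by (intro submodule.intro subgroup.intro submodule_axioms.intro) (use assms in auto)
qed

lemma submoduleD:
  assumes "submodule N R M"
  shows "N \<subseteq> carrier M" "\<zero>\<^bsub>M\<^esub> \<in> N"
    "\<And>x y. x \<in> N \<Longrightarrow> y \<in> N \<Longrightarrow> x \<oplus>\<^bsub>M\<^esub> y \<in> N"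
    "\<And>x. x \<in> N \<Longrightarrow> \<ominus>\<^bsub>M\<^esub> x \<in> N"
    "\<And>x y. x \<in> N \<Longrightarrow> y \<in> N \<Longrightarrow> x \<ominus>\<^bsub>M\<^esub> y \<in> N"
    "\<And>a x. a \<in> carrier R \<Longrightarrow> x \<in> N \<Longrightarrow> a \<odot>\<^bsub>M\<^esub> x \<in> N"
proof -
  interpret N: submodule N R M by fact
  show *: "N \<subseteq> carrier M" "\<zero>\<^bsub>M\<^esub> \<in> N"
    "\<And>x y. x \<in> N \<Longrightarrow> y \<in> N \<Longrightarrow> x \<oplus>\<^bsub>M\<^esub> y \<in> N"
    "\<And>a x. a \<in> carrier R \<Longrightarrow> x \<in> N \<Longrightarrow> a \<odot>\<^bsub>M\<^esub> x \<in> N"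
    using N.subset N.one_closed N.m_closed by auto
  show u: "\<ominus>\<^bsub>M\<^esub> x \<in> N" if "x \<in> N" for x
    using N.m_inv_closed[OF that] by (simp add: a_inv_def)
  show "x \<ominus>\<^bsub>M\<^esub> y \<in> N" if "x \<in> N" "y \<in> N" for x y
    using * u that by (simp add: a_minus_def)
qed

lemma submodule_finsum:
  assumes "submodule N R M" "\<And>t. t \<in> T \<Longrightarrow> y t \<in> N"
  shows "finsum M y T \<in> N"
  using assms(2)
proof (induction T rule: infinite_finite_induct)
  case (insert t T)
  then show ?case using submoduleD[OF assms(1)] by (subst M.finsum_insert) auto
qed (use submoduleD[OF assms(1)] in auto)

lemma carrier_submodule: "submodule (carrier M) R M"
  by (rule submodule_intro) (auto simp: smult_closed)

lemma abelian_group_submodule: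
  assumes "submodule N R M" shows "abelian_group (M\<lparr>carrier := N\<rparr>)"
proof (rule abelian_groupI)
  note D = submoduleD[OF assms]
  show "\<exists>y\<in>carrier (M\<lparr>carrier := N\<rparr>). y \<oplus>\<^bsub>M\<lparr>carrier := N\<rparr>\<^esub> x = \<zero>\<^bsub>M\<lparr>carrier := N\<rparr>\<^esub>"
    if "x \<in> carrier (M\<lparr>carrier := N\<rparr>)" for x
    using that D by (intro bexI[of _ "\<ominus>\<^bsub>M\<^esub> x"]) (auto intro!: M.l_neg)
qed (use submoduleD[OF assms] in \<open>auto simp: subset_eq intro: M.a_assoc M.a_comm\<close>)

lemma right_module_submodule:
  assumes "submodule N R M" shows "right_module R (M\<lparr>carrier := N\<rparr>)"
proof -
  note D = submoduleD[OF assms]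
  show ?thesis
    by (intro right_module.intro right_module_axioms.intro R.ring_axioms
        abelian_group_submodule[OF assms])
      (use D in \<open>auto simp: subset_eq smult_l_distr smult_r_distr smult_assoc smult_one\<close>)
qed

lemma finsum_smult_right:
  assumes "a \<in> carrier R" "\<And>t. t \<in> T \<Longrightarrow> y t \<in> carrier M"
  shows "a \<odot>\<^bsub>M\<^esub> finsum M y T = (\<Oplus>\<^bsub>M\<^esub>t\<in>T. a \<odot>\<^bsub>M\<^esub> y t)"
  using assms(2)
proof (induction T rule: infinite_finite_induct)
  case (insert t T)
  then have "a \<odot>\<^bsub>M\<^esub> finsum M y (insert t T) = a \<odot>\<^bsub>M\<^esub> (y t \<oplus>\<^bsub>M\<^esub> finsum M y T)"
    by (subst M.finsum_insert) auto
  also have "\<dots> = a \<odot>\<^bsub>M\<^esub> y t \<oplus>\<^bsub>M\<^esub> (\<Oplus>\<^bsub>M\<^esub>t\<in>T. a \<odot>\<^bsub>M\<^esub> y t)"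
    using insert by (subst smult_r_distr) (auto simp: assms(1) intro!: M.finsum_closed)
  also have "\<dots> = (\<Oplus>\<^bsub>M\<^esub>t\<in>insert t T. a \<odot>\<^bsub>M\<^esub> y t)"
    using insert assms(1) by (subst M.finsum_insert) (auto simp: smult_closed)
  finally show ?case .
qed (simp_all add: smult_zero_right assms(1))

end

lemma mod_homI:
  assumes "\<And>x. x \<in> carrier M \<Longrightarrow> h x \<in> carrier N"
    and "\<And>x y. x \<in> carrier M \<Longrightarrow> y \<in> carrier M \<Longrightarrow> h (x \<oplus>\<^bsub>M\<^esub> y) = h x \<oplus>\<^bsub>N\<^esub> h y"
    and "\<And>a x. a \<in> carrier R \<Longrightarrow> x \<in> carrier M \<Longrightarrow> h (a \<odot>\<^bsub>M\<^esub> x) = a \<odot>\<^bsub>N\<^esub> h x"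
  shows "h \<in> mod_hom R M N"
  using assms by (auto simp: mod_hom_def)

lemma mod_homD:
  assumes "h \<in> mod_hom R M N"
  shows "x \<in> carrier M \<Longrightarrow> h x \<in> carrier N"
    and "x \<in> carrier M \<Longrightarrow> y \<in> carrier M \<Longrightarrow> h (x \<oplus>\<^bsub>M\<^esub> y) = h x \<oplus>\<^bsub>N\<^esub> h y"
    and "a \<in> carrier R \<Longrightarrow> x \<in> carrier M \<Longrightarrow> h (a \<odot>\<^bsub>M\<^esub> x) = a \<odot>\<^bsub>N\<^esub> h x"
  using assms by (auto simp: mod_hom_def)

lemma mod_hom_cong:
  assumes "h \<in> mod_hom R M N" "\<And>x. x \<in> carrier M \<Longrightarrow> k x = h x"
    "right_module R M"
  shows "k \<in> mod_hom R M N"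
proof -
  interpret M: right_module R M by fact
  show ?thesis
    by (rule mod_homI) (use assms(2) mod_homD[OF assms(1)] M.smult_closed in auto)
qed

lemma mod_hom_comp:
  assumes "h \<in> mod_hom R L M" "k \<in> mod_hom R M N"
  shows "(\<lambda>x. k (h x)) \<in> mod_hom R L N"
  by (rule mod_homI) (use mod_homD[OF assms(1)] mod_homD[OF assms(2)] in auto)

lemma mod_hom_id: "(\<lambda>x. x) \<in> mod_hom R M M"
  by (rule mod_homI) auto

lemma mod_hom_incl: "N \<subseteq> carrier M \<Longrightarrow> (\<lambda>x. x) \<in> mod_hom R (M\<lparr>carrier := N\<rparr>) M"
  by (rule mod_homI) auto

lemma mod_hom_funpow:
  assumes "h \<in> mod_hom R M M" shows "(h ^^ n) \<in> mod_hom R M M"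
proof (induction n)
  case 0
  then show ?case using mod_hom_id by (simp add: id_def)
next
  case (Suc n)
  then show ?case using mod_hom_comp[OF Suc assms] by (simp add: comp_def)
qed

locale module_hom = M: right_module R M + N: right_module R N
  for R :: "('a, 'r) ring_scheme" and M :: "('a, 'm, 'd) module_scheme"
    and N :: "('a, 'n, 'e) module_scheme" +
  fixes h
  assumes hom: "h \<in> mod_hom R M N"
begin

lemmas closed = mod_homD(1)[OF hom]
lemmas add = mod_homD(2)[OF hom]
lemmas smult = mod_homD(3)[OF hom]

lemma zero: "h \<zero>\<^bsub>M\<^esub> = \<zero>\<^bsub>N\<^esub>"
  using smult[of "\<zero>\<^bsub>R\<^esub>" "\<zero>\<^bsub>M\<^esub>"] M.smult_zero_left[of "\<zero>\<^bsub>M\<^esub>"] N.smult_zero_left closed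
  by simp

lemma uminus: "x \<in> carrier M \<Longrightarrow> h (\<ominus>\<^bsub>M\<^esub> x) = \<ominus>\<^bsub>N\<^esub> h x"
  by (simp add: M.uminus_eq_smult N.uminus_eq_smult smult closed)

lemma minus:
  "\<lbrakk>x \<in> carrier M; y \<in> carrier M\<rbrakk> \<Longrightarrow> h (x \<ominus>\<^bsub>M\<^esub> y) = h x \<ominus>\<^bsub>N\<^esub> h y"
  by (simp add: a_minus_def add uminus)

lemma finsum:
  assumes "\<And>t. t \<in> T \<Longrightarrow> y t \<in> carrier M"
  shows "h (finsum M y T) = (\<Oplus>\<^bsub>N\<^esub>t\<in>T. h (y t))"
  using assms
proof (induction T rule: infinite_finite_induct)
  case (insert t T)
  have "h (finsum M y (insert t T)) = h (y t \<oplus>\<^bsub>M\<^esub> finsum M y T)"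
    using insert by (subst M.finsum_insert) auto
  also have "\<dots> = h (y t) \<oplus>\<^bsub>N\<^esub> (\<Oplus>\<^bsub>N\<^esub>t\<in>T. h (y t))"
    using insert by (subst add) (auto intro!: M.finsum_closed)
  also have "\<dots> = (\<Oplus>\<^bsub>N\<^esub>t\<in>insert t T. h (y t))"
    using insert closed by (subst N.finsum_insert) auto
  finally show ?case .
qed (simp_all add: zero)

lemma image_submodule: "submodule (h ` carrier M) R N"
proof (rule N.submodule_intro)
  show "\<zero>\<^bsub>N\<^esub> \<in> h ` carrier M" using zero by (metis M.M.zero_closed image_eqI)
  show "x \<oplus>\<^bsub>N\<^esub> y \<in> h ` carrier M" if "x \<in> h ` carrier M" "y \<in> h ` carrier M" for x y
    using that add by (auto simp flip: add)
  show "a \<odot>\<^bsub>N\<^esub> x \<in> h ` carrier M" if "a \<in> carrier R" "x \<in> h ` carrier M" for a x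
    using that M.smult_closed by (auto simp flip: smult)
qed (use closed in auto)

lemma vimage_submodule:
  assumes "submodule L R N" shows "submodule {x \<in> carrier M. h x \<in> L} R M"
  by (rule M.submodule_intro)
    (use N.submoduleD[OF assms] zero add smult M.smult_closed in auto)

end

lemma module_homI:
  "\<lbrakk>right_module R M; right_module R N; h \<in> mod_hom R M N\<rbrakk> \<Longrightarrow> module_hom R M N h"
  by (simp add: module_hom_def module_hom_axioms_def)

lemma mod_hom_add:
  assumes "right_module R M" "right_module R N" "h \<in> mod_hom R M N" "k \<in> mod_hom R M N"
  shows "(\<lambda>x. h x \<oplus>\<^bsub>N\<^esub> k x) \<in> mod_hom R M N"
proof -
  interpret h: module_hom R M N h using assms by (simp add: module_homI)
  interpret k: module_hom R M N k using assms by (simp add: module_homI)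
  show ?thesis
    by (rule mod_homI)
      (auto simp: h.add k.add h.smult k.smult h.closed k.closed h.N.smult_r_distr
        h.N.M.a_ac)
qed

lemma mod_hom_minus:
  assumes "right_module R M" "right_module R N" "h \<in> mod_hom R M N" "k \<in> mod_hom R M N"
  shows "(\<lambda>x. h x \<ominus>\<^bsub>N\<^esub> k x) \<in> mod_hom R M N"
proof -
  interpret h: module_hom R M N h using assms by (simp add: module_homI)
  interpret k: module_hom R M N k using assms by (simp add: module_homI)
  show ?thesis
    by (rule mod_homI)
      (auto simp: h.add k.add h.smult k.smult h.closed k.closed h.N.smult_r_distr
        h.N.smult_uminus_right a_minus_def h.N.M.a_ac h.N.M.minus_add)
qed

lemma right_regular_simps [simp]:
  "carrier (right_regular R) = carrier R" "\<zero>\<^bsub>right_regular R\<^esub> = \<zero>\<^bsub>R\<^esub>"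
  "x \<oplus>\<^bsub>right_regular R\<^esub> y = x \<oplus>\<^bsub>R\<^esub> y" "a \<odot>\<^bsub>right_regular R\<^esub> x = x \<otimes>\<^bsub>R\<^esub> a"
  by (auto simp: right_regular_def)

lemma right_module_right_regular:
  assumes "ring R" shows "right_module R (right_regular R)"
proof -
  interpret ring R by fact
  have "abelian_group (right_regular R)"
    by (rule abelian_groupI) (auto simp: a_ac intro: l_neg bexI[of _ "\<ominus>\<^bsub>R\<^esub> x" for x])
  then show ?thesis
    by (intro right_module.intro right_module_axioms.intro assms)
      (auto simp: l_distr r_distr m_assoc)
qed

lemma finsum_right_regular: "finsum (right_regular R) = finsum R"
  by (rule ext)+ (simp add: finsum_def finprod_def right_regular_def)

lemma a_inv_right_regular: "a_inv (right_regular R) = a_inv R"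
  by (rule ext)+ (simp add: a_inv_def m_inv_def right_regular_def)

lemma a_minus_right_regular: "a_minus (right_regular R) = a_minus R"
  by (rule ext)+ (simp add: a_minus_def a_inv_right_regular)

section \<open>Dual bases and projective modules\<close>

definition fin_family ::
  "('a, 'r) ring_scheme \<Rightarrow> ('a, 'm, 'd) module_scheme \<Rightarrow> 'b set \<Rightarrow> ('b \<Rightarrow> 'm \<Rightarrow> 'a) \<Rightarrow> bool"
  where "fin_family R M B \<chi> \<longleftrightarrow> (\<forall>b\<in>B. \<chi> b \<in> mod_hom R M (right_regular R)) \<and>
    (\<forall>x\<in>carrier M. finite {b \<in> B. \<chi> b x \<noteq> \<zero>\<^bsub>R\<^esub>})"

text \<open>The sum runs over the support at \<open>x\<close> because \<open>B\<close> may be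
  infinite, and \<open>finsum\<close> over an infinite set is zero by convention. For a dual basis
  and \<open>n = q\<close> this is the expansion of \<open>x\<close>.\<close>

definition family_comb ::
  "('a, 'r) ring_scheme \<Rightarrow> ('a, 'n, 'e) module_scheme \<Rightarrow> 'b set \<Rightarrow> ('b \<Rightarrow> 'm \<Rightarrow> 'a) \<Rightarrow> ('b \<Rightarrow> 'n) \<Rightarrow> 'm \<Rightarrow> 'n"
  where "family_comb R N B \<chi> n x = (\<Oplus>\<^bsub>N\<^esub>b\<in>{b \<in> B. \<chi> b x \<noteq> \<zero>\<^bsub>R\<^esub>}. \<chi> b x \<odot>\<^bsub>N\<^esub> n b)"

text \<open>The dual basis criterion for projectivity. The index type is free, unlike the bases
  allowed in \<open>projective_right\<close>, so indices such as pairs of a number and a generator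
  can be used.\<close>

definition dual_basis ::
  "('a, 'r) ring_scheme \<Rightarrow> ('a, 'm, 'd) module_scheme \<Rightarrow> 'b set \<Rightarrow> ('b \<Rightarrow> 'm) \<Rightarrow> ('b \<Rightarrow> 'm \<Rightarrow> 'a) \<Rightarrow> bool"
  where "dual_basis R M B q \<chi> \<longleftrightarrow> fin_family R M B \<chi> \<and> (\<forall>b\<in>B. q b \<in> carrier M) \<and>
    (\<forall>x\<in>carrier M. family_comb R M B \<chi> q x = x)"

lemma fin_familyD:
  assumes "fin_family R M B \<chi>"
  shows "b \<in> B \<Longrightarrow> \<chi> b \<in> mod_hom R M (right_regular R)"
    and "x \<in> carrier M \<Longrightarrow> finite {b \<in> B. \<chi> b x \<noteq> \<zero>\<^bsub>R\<^esub>}"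
    and "b \<in> B \<Longrightarrow> x \<in> carrier M \<Longrightarrow> \<chi> b x \<in> carrier R"
  using assms mod_homD(1)[of "\<chi> b" R M "right_regular R"] by (auto simp: fin_family_def)

lemma fin_family_finite:
  "\<lbrakk>finite B; \<And>b. b \<in> B \<Longrightarrow> \<chi> b \<in> mod_hom R M (right_regular R)\<rbrakk> \<Longrightarrow> fin_family R M B \<chi>"
  by (simp add: fin_family_def)

lemma fin_family_pre:
  assumes "fin_family R N B \<chi>" "h \<in> mod_hom R M N"
  shows "fin_family R M B (\<lambda>b x. \<chi> b (h x))"
  using fin_familyD(1,2)[OF assms(1)] mod_hom_comp[OF assms(2)] mod_homD(1)[OF assms(2)]
  unfolding fin_family_def by auto

text \<open>Terms outside the support vanish; this brings several combinations onto one common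
  finite index set.\<close>

lemma family_comb_superset:
  assumes "right_module R N" "finite T" "T \<subseteq> B"
    "\<And>b. b \<in> B - T \<Longrightarrow> \<chi> b x = \<zero>\<^bsub>R\<^esub>"
    "\<And>b. b \<in> T \<Longrightarrow> \<chi> b x \<in> carrier R" "\<And>b. b \<in> T \<Longrightarrow> n b \<in> carrier N"
  shows "family_comb R N B \<chi> n x = (\<Oplus>\<^bsub>N\<^esub>b\<in>T. \<chi> b x \<odot>\<^bsub>N\<^esub> n b)"
proof -
  interpret right_module R N by fact
  show ?thesis unfolding family_comb_def
    by (rule M.add.finprod_mono_neutral_cong_left)
      (use assms in \<open>auto simp: smult_closed smult_zero_left\<close>)
qed

lemma family_comb_hom:
  assumes M: "right_module R M" and N: "right_module R N" and F: "fin_family R M B \<chi>"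
    and n: "\<And>b. b \<in> B \<Longrightarrow> n b \<in> carrier N"
  shows "family_comb R N B \<chi> n \<in> mod_hom R M N"
proof -
  interpret M: right_module R M by fact
  interpret N: right_module R N by fact
  note FD = fin_familyD[OF F]
  let ?s = "\<lambda>x. {b \<in> B. \<chi> b x \<noteq> \<zero>\<^bsub>R\<^esub>}"
  have hom: "module_hom R M (right_regular R) (\<chi> b)" if "b \<in> B" for b
    using FD(1)[OF that] M right_module_right_regular[OF M.R.ring_axioms]
    by (rule module_homI[rotated 2])
  have sup: "family_comb R N B \<chi> n x = (\<Oplus>\<^bsub>N\<^esub>b\<in>T. \<chi> b x \<odot>\<^bsub>N\<^esub> n b)"
    if "x \<in> carrier M" "finite T" "?s x \<subseteq> T" "T \<subseteq> B" for x T
    by (rule family_comb_superset[OF N]) (use that n FD(3) in auto)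
  show ?thesis
  proof (rule mod_homI)
    fix x assume x: "x \<in> carrier M"
    show "family_comb R N B \<chi> n x \<in> carrier N"
      unfolding family_comb_def using x n FD(3) by (auto intro!: N.M.finsum_closed N.smult_closed)
    fix y assume y: "y \<in> carrier M"
    \<comment> \<open>A common finite index set: the support at the sum of \<open>x\<close> and
      \<open>y\<close> may be smaller than this union, but never leaves it.\<close>
    let ?T = "?s x \<union> ?s y"
    have T: "finite ?T" using FD(2) x y by simp
    have s: "?s (x \<oplus>\<^bsub>M\<^esub> y) \<subseteq> ?T"
      using module_hom.add[OF hom] x y by auto
    have "family_comb R N B \<chi> n (x \<oplus>\<^bsub>M\<^esub> y) = (\<Oplus>\<^bsub>N\<^esub>b\<in>?T. \<chi> b (x \<oplus>\<^bsub>M\<^esub> y) \<odot>\<^bsub>N\<^esub> n b)"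
      by (rule sup) (use x y T s in auto)
    also have "\<dots> = (\<Oplus>\<^bsub>N\<^esub>b\<in>?T. \<chi> b x \<odot>\<^bsub>N\<^esub> n b \<oplus>\<^bsub>N\<^esub> \<chi> b y \<odot>\<^bsub>N\<^esub> n b)"
      by (rule N.M.finsum_cong')
        (use x y n FD(3) module_hom.add[OF hom] in \<open>auto simp: N.smult_closed N.smult_l_distr\<close>)
    also have "\<dots> = (\<Oplus>\<^bsub>N\<^esub>b\<in>?T. \<chi> b x \<odot>\<^bsub>N\<^esub> n b) \<oplus>\<^bsub>N\<^esub> (\<Oplus>\<^bsub>N\<^esub>b\<in>?T. \<chi> b y \<odot>\<^bsub>N\<^esub> n b)"
      by (rule N.M.finsum_addf) (use x y n FD(3) in \<open>auto simp: N.smult_closed\<close>)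
    also have "(\<Oplus>\<^bsub>N\<^esub>b\<in>?T. \<chi> b x \<odot>\<^bsub>N\<^esub> n b) = family_comb R N B \<chi> n x"
      by (rule sup[symmetric]) (use x T in auto)
    also have "(\<Oplus>\<^bsub>N\<^esub>b\<in>?T. \<chi> b y \<odot>\<^bsub>N\<^esub> n b) = family_comb R N B \<chi> n y"
      by (rule sup[symmetric]) (use y T in auto)
    finally show "family_comb R N B \<chi> n (x \<oplus>\<^bsub>M\<^esub> y) =
      family_comb R N B \<chi> n x \<oplus>\<^bsub>N\<^esub> family_comb R N B \<chi> n y" .
  next
    fix a x assume a: "a \<in> carrier R" and x: "x \<in> carrier M"
    let ?T = "?s x"
    have s: "?s (a \<odot>\<^bsub>M\<^esub> x) \<subseteq> ?T"
      using module_hom.smult[OF hom] x a by auto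
    have "family_comb R N B \<chi> n (a \<odot>\<^bsub>M\<^esub> x) = (\<Oplus>\<^bsub>N\<^esub>b\<in>?T. \<chi> b (a \<odot>\<^bsub>M\<^esub> x) \<odot>\<^bsub>N\<^esub> n b)"
      by (rule sup) (use x a M.smult_closed FD(2) s in auto)
    also have "\<dots> = (\<Oplus>\<^bsub>N\<^esub>b\<in>?T. a \<odot>\<^bsub>N\<^esub> (\<chi> b x \<odot>\<^bsub>N\<^esub> n b))"
      by (rule N.M.finsum_cong')
        (use x a n FD(3) module_hom.smult[OF hom] in \<open>auto simp: N.smult_closed N.smult_assoc\<close>)
    also have "\<dots> = a \<odot>\<^bsub>N\<^esub> (\<Oplus>\<^bsub>N\<^esub>b\<in>?T. \<chi> b x \<odot>\<^bsub>N\<^esub> n b)"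
      by (rule N.finsum_smult_right[symmetric]) (use x a n FD(3) in \<open>auto simp: N.smult_closed\<close>)
    finally show "family_comb R N B \<chi> n (a \<odot>\<^bsub>M\<^esub> x) = a \<odot>\<^bsub>N\<^esub> family_comb R N B \<chi> n x"
      by (simp add: family_comb_def)
  qed
qed

lemma hom_family_comb:
  assumes "module_hom R N L k" "fin_family R M B \<chi>" "\<And>b. b \<in> B \<Longrightarrow> n b \<in> carrier N" "x \<in> carrier M"
  shows "k (family_comb R N B \<chi> n x) = family_comb R L B \<chi> (\<lambda>b. k (n b)) x"
proof -
  interpret k: module_hom R N L k by fact
  note FD = fin_familyD[OF assms(2)]
  have "k (family_comb R N B \<chi> n x) = (\<Oplus>\<^bsub>L\<^esub>b\<in>{b \<in> B. \<chi> b x \<noteq> \<zero>\<^bsub>R\<^esub>}. k (\<chi> b x \<odot>\<^bsub>N\<^esub> n b))"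
    unfolding family_comb_def using FD(3) assms by (subst k.finsum) (auto simp: k.M.smult_closed)
  also have "\<dots> = family_comb R L B \<chi> (\<lambda>b. k (n b)) x"
    unfolding family_comb_def
    by (rule k.N.M.finsum_cong')
      (use FD(3) assms k.smult k.closed in \<open>auto simp: k.N.smult_closed\<close>)
  finally show ?thesis .
qed

lemma family_comb_cong:
  assumes "right_module R N" "fin_family R M B \<chi>" "x \<in> carrier M"
    "\<And>b. b \<in> B \<Longrightarrow> n b = n' b" "\<And>b. b \<in> B \<Longrightarrow> n b \<in> carrier N"
  shows "family_comb R N B \<chi> n x = family_comb R N B \<chi> n' x"
proof -
  interpret right_module R N by fact
  show ?thesis unfolding family_comb_def
    by (rule M.finsum_cong') (use assms fin_familyD(3)[OF assms(2)] in \<open>auto simp: smult_closed\<close>)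
qed

lemma dual_basisD:
  assumes "dual_basis R M B q \<chi>"
  shows "fin_family R M B \<chi>" "b \<in> B \<Longrightarrow> q b \<in> carrier M"
    "x \<in> carrier M \<Longrightarrow> family_comb R M B \<chi> q x = x"
  using assms by (auto simp: dual_basis_def)

text \<open>Preimages of the images of the dual basis vectors are chosen arbitrarily. Combining them
  with the functionals of \<open>Q\<close> is a homomorphism for every choice, so no relations
  between generators have to be checked.\<close>

lemma projective_lifting:
  assumes Q: "right_module R Q" and N: "right_module R N" and Y: "right_module R Y"
    and db: "dual_basis R Q B q \<chi>"
    and \<rho>: "\<rho> \<in> mod_hom R Q Y" and \<pi>: "\<pi> \<in> mod_hom R N Y" and surj: "\<pi> ` carrier N = carrier Y"
  obtains f where "f \<in> mod_hom R Q N" "\<And>x. x \<in> carrier Q \<Longrightarrow> \<pi> (f x) = \<rho> x"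
proof -
  note D = dual_basisD[OF db]
  interpret \<rho>: module_hom R Q Y \<rho> using Q Y \<rho> by (rule module_homI)
  interpret \<pi>: module_hom R N Y \<pi> using N Y \<pi> by (rule module_homI)
  have "\<exists>n. n \<in> carrier N \<and> \<pi> n = \<rho> (q b)" if "b \<in> B" for b
    using \<rho>.closed[OF D(2)[OF that]] surj by (metis imageE)
  then obtain n where n: "\<And>b. b \<in> B \<Longrightarrow> n b \<in> carrier N" "\<And>b. b \<in> B \<Longrightarrow> \<pi> (n b) = \<rho> (q b)"
    by metis
  show thesis
  proof (rule that)
    show "family_comb R N B \<chi> n \<in> mod_hom R Q N"
      using Q N D(1) n(1) by (rule family_comb_hom)
    fix x assume x: "x \<in> carrier Q"
    have "\<pi> (family_comb R N B \<chi> n x) = family_comb R Y B \<chi> (\<lambda>b. \<pi> (n b)) x"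
      using \<pi>.module_hom_axioms D(1) n(1) x by (rule hom_family_comb)
    also have "\<dots> = family_comb R Y B \<chi> (\<lambda>b. \<rho> (q b)) x"
      by (rule family_comb_cong[OF Y D(1) x]) (simp_all add: n \<rho>.closed D(2))
    also have "\<dots> = \<rho> (family_comb R Q B \<chi> q x)"
      by (rule hom_family_comb[symmetric, OF \<rho>.module_hom_axioms D(1) D(2) x])
    finally show "\<pi> (family_comb R N B \<chi> n x) = \<rho> x" using D(3)[OF x] by simp
  qed
qed

text \<open>Apply \<open>t\<close> to the expansion of \<open>s x\<close>.\<close>

lemma dual_basis_retract:
  assumes M: "right_module R M" and N: "right_module R N" and db: "dual_basis R N B q \<chi>"
    and s: "s \<in> mod_hom R M N" and t: "t \<in> mod_hom R N M"
    and ts: "\<And>x. x \<in> carrier M \<Longrightarrow> t (s x) = x"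
  shows "dual_basis R M B (\<lambda>b. t (q b)) (\<lambda>b x. \<chi> b (s x))"
proof -
  note D = dual_basisD[OF db]
  interpret t: module_hom R N M t using N M t by (rule module_homI)
  note F = fin_family_pre[OF D(1) s]
  have "family_comb R M B (\<lambda>b x. \<chi> b (s x)) (\<lambda>b. t (q b)) x = x" if x: "x \<in> carrier M" for x
  proof -
    have "family_comb R M B (\<lambda>b x. \<chi> b (s x)) (\<lambda>b. t (q b)) x = family_comb R M B \<chi> (\<lambda>b. t (q b)) (s x)"
      by (simp add: family_comb_def)
    also have "\<dots> = t (family_comb R N B \<chi> q (s x))"
      by (rule hom_family_comb[symmetric, OF t.module_hom_axioms D(1) D(2) mod_homD(1)[OF s x]])
    finally show ?thesis using D(3) mod_homD(1)[OF s x] ts x by simp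
  qed
  then show ?thesis using F t.closed D(2) by (simp add: dual_basis_def)
qed

section \<open>Free modules and their direct summands\<close>

lemma copower_right_simps:
  "carrier (copower (right_regular R) B) = {h \<in> B \<rightarrow>\<^sub>E carrier R. finite {b \<in> B. h b \<noteq> \<zero>\<^bsub>R\<^esub>}}"
  "\<zero>\<^bsub>copower (right_regular R) B\<^esub> = (\<lambda>b\<in>B. \<zero>\<^bsub>R\<^esub>)"
  "h \<oplus>\<^bsub>copower (right_regular R) B\<^esub> k = (\<lambda>b\<in>B. h b \<oplus>\<^bsub>R\<^esub> k b)"
  "a \<odot>\<^bsub>copower (right_regular R) B\<^esub> h = (\<lambda>b\<in>B. h b \<otimes>\<^bsub>R\<^esub> a)"
  by (simp_all add: copower_def)

text \<open>Common to \<open>copower\<close> and \<open>right_dual\<close>: in both, the elements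
  are functions determined on \<open>B\<close>, so each axiom can be checked at every point of
  \<open>B\<close>. Negatives are obtained from the scalar -1.\<close>

lemma right_module_pointwise:
  fixes R (structure) and N :: "('a, 'b \<Rightarrow> 'm, 'd) module_scheme" (structure)
  assumes M: "right_module R M" and sub: "carrier N \<subseteq> B \<rightarrow>\<^sub>E carrier M"
    and zero: "\<zero>\<^bsub>N\<^esub> = (\<lambda>b\<in>B. \<zero>\<^bsub>M\<^esub>)" "\<zero>\<^bsub>N\<^esub> \<in> carrier N"
    and add: "\<And>h k. h \<oplus>\<^bsub>N\<^esub> k = (\<lambda>b\<in>B. h b \<oplus>\<^bsub>M\<^esub> k b)"
      "\<And>h k. \<lbrakk>h \<in> carrier N; k \<in> carrier N\<rbrakk> \<Longrightarrow> h \<oplus>\<^bsub>N\<^esub> k \<in> carrier N"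
    and smult: "\<And>a h. a \<odot>\<^bsub>N\<^esub> h = (\<lambda>b\<in>B. a \<odot>\<^bsub>M\<^esub> h b)"
      "\<And>a h. \<lbrakk>a \<in> carrier R; h \<in> carrier N\<rbrakk> \<Longrightarrow> a \<odot>\<^bsub>N\<^esub> h \<in> carrier N"
  shows "right_module R N"
proof -
  interpret M: right_module R M by fact
  have cl: "h b \<in> carrier M" if "h \<in> carrier N" "b \<in> B" for h b
    using that sub by (auto simp: subset_eq)
  have eq: "h = k" if "h \<in> carrier N" "k \<in> carrier N" "\<forall>b\<in>B. h b = k b" for h k
    using that sub by (intro PiE_ext[of h B "\<lambda>_. carrier M" k]) auto
  note pw = zero(1) add(1) smult(1)
  have "abelian_group N"
  proof (rule abelian_groupI)
    fix h assume h: "h \<in> carrier N"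
    show "\<exists>k\<in>carrier N. k \<oplus>\<^bsub>N\<^esub> h = \<zero>\<^bsub>N\<^esub>"
    proof (rule bexI)
      show "((\<ominus>\<^bsub>R\<^esub> \<one>\<^bsub>R\<^esub>) \<odot>\<^bsub>N\<^esub> h) \<oplus>\<^bsub>N\<^esub> h = \<zero>\<^bsub>N\<^esub>"
      proof (rule eq)
        show "\<forall>b\<in>B. (((\<ominus>\<^bsub>R\<^esub> \<one>\<^bsub>R\<^esub>) \<odot>\<^bsub>N\<^esub> h) \<oplus>\<^bsub>N\<^esub> h) b = \<zero>\<^bsub>N\<^esub> b"
          using cl h by (simp add: pw M.M.l_neg flip: M.uminus_eq_smult)
      qed (intro add zero smult h M.R.a_inv_closed M.R.one_closed)+
    qed (intro smult h M.R.a_inv_closed M.R.one_closed)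
    show "\<zero>\<^bsub>N\<^esub> \<oplus>\<^bsub>N\<^esub> h = h"
      by (rule eq[OF add(2)[OF zero(2) h] h]) (use h cl in \<open>simp add: pw\<close>)
    fix k assume k: "k \<in> carrier N"
    show "h \<oplus>\<^bsub>N\<^esub> k \<in> carrier N" using h k by (rule add)
    show "h \<oplus>\<^bsub>N\<^esub> k = k \<oplus>\<^bsub>N\<^esub> h"
      by (rule eq[OF add(2)[OF h k] add(2)[OF k h]]) (use h k cl in \<open>simp add: pw M.M.a_comm\<close>)
    fix l assume l: "l \<in> carrier N"
    show "h \<oplus>\<^bsub>N\<^esub> k \<oplus>\<^bsub>N\<^esub> l = h \<oplus>\<^bsub>N\<^esub> (k \<oplus>\<^bsub>N\<^esub> l)"
      by (rule eq[OF add(2)[OF add(2)[OF h k] l] add(2)[OF h add(2)[OF k l]]])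
        (use h k l cl in \<open>simp add: pw M.M.a_assoc\<close>)
  qed (fact zero)
  then show ?thesis
  proof (intro right_module.intro right_module_axioms.intro M.R.ring_axioms)
    fix h assume h: "h \<in> carrier N"
    show "\<one>\<^bsub>R\<^esub> \<odot>\<^bsub>N\<^esub> h = h"
      by (rule eq[OF smult(2)[OF M.R.one_closed h] h]) (use h cl in \<open>simp add: pw M.smult_one\<close>)
    fix a assume a: "a \<in> carrier R"
    show "a \<odot>\<^bsub>N\<^esub> h \<in> carrier N" using a h by (rule smult)
    {
      fix k assume k: "k \<in> carrier N"
      show "a \<odot>\<^bsub>N\<^esub> (h \<oplus>\<^bsub>N\<^esub> k) = a \<odot>\<^bsub>N\<^esub> h \<oplus>\<^bsub>N\<^esub> a \<odot>\<^bsub>N\<^esub> k"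
        by (rule eq[OF smult(2)[OF a add(2)[OF h k]] add(2)[OF smult(2)[OF a h] smult(2)[OF a k]]])
          (use a h k cl in \<open>simp add: pw M.smult_r_distr\<close>)
    }
    fix b assume b: "b \<in> carrier R"
    show "(a \<oplus>\<^bsub>R\<^esub> b) \<odot>\<^bsub>N\<^esub> h = a \<odot>\<^bsub>N\<^esub> h \<oplus>\<^bsub>N\<^esub> b \<odot>\<^bsub>N\<^esub> h"
      by (rule eq[OF smult(2)[OF M.R.a_closed[OF a b] h] add(2)[OF smult(2)[OF a h] smult(2)[OF b h]]])
        (use a b h cl in \<open>simp add: pw M.smult_l_distr\<close>)
    show "(a \<otimes>\<^bsub>R\<^esub> b) \<odot>\<^bsub>N\<^esub> h = b \<odot>\<^bsub>N\<^esub> (a \<odot>\<^bsub>N\<^esub> h)"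
      by (rule eq[OF smult(2)[OF M.R.m_closed[OF a b] h] smult(2)[OF b smult(2)[OF a h]]])
        (use a b h cl in \<open>simp add: pw M.smult_assoc\<close>)
  qed
qed

lemma right_module_copower:
  fixes R (structure)
  assumes "ring R" shows "right_module R (copower (right_regular R) B)"
proof -
  interpret ring R by fact
  let ?F = "copower (right_regular R) B"
  show ?thesis
  proof (rule right_module_pointwise[OF right_module_right_regular[OF assms]])
    show "h \<oplus>\<^bsub>?F\<^esub> k \<in> carrier ?F" if "h \<in> carrier ?F" "k \<in> carrier ?F" for h k
    proof -
      have "finite ({b \<in> B. h b \<noteq> \<zero>} \<union> {b \<in> B. k b \<noteq> \<zero>})"
        using that by (simp add: copower_right_simps)
      then have "finite {b \<in> B. (h \<oplus>\<^bsub>?F\<^esub> k) b \<noteq> \<zero>}"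
        by (rule rev_finite_subset) (auto simp: copower_right_simps)
      then show ?thesis using that by (auto simp: copower_right_simps)
    qed
    show "a \<odot>\<^bsub>?F\<^esub> h \<in> carrier ?F" if "a \<in> carrier R" "h \<in> carrier ?F" for a h
    proof -
      have "finite {b \<in> B. h b \<noteq> \<zero>}" using that by (simp add: copower_right_simps)
      then have "finite {b \<in> B. (a \<odot>\<^bsub>?F\<^esub> h) b \<noteq> \<zero>}"
        by (rule rev_finite_subset) (use that in \<open>auto simp: copower_right_simps\<close>)
      then show ?thesis using that by (auto simp: copower_right_simps)
    qed
  qed (auto simp: copower_right_simps)
qed

text \<open>Unit vectors and coordinate functionals.\<close>

lemma dual_basis_copower:
  fixes R (structure)
  assumes "ring R"
  shows "dual_basis R (copower (right_regular R) B) B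
    (\<lambda>b. \<lambda>c\<in>B. if c = b then \<one> else \<zero>) (\<lambda>b h. h b)"
proof -
  interpret ring R by fact
  let ?F = "copower (right_regular R) B" and ?\<delta> = "\<lambda>b. \<lambda>c\<in>B. if c = b then \<one> else \<zero>"
  interpret F: right_module R ?F by (rule right_module_copower) fact
  have coord: "(\<lambda>h. h b) \<in> mod_hom R ?F (right_regular R)" if "b \<in> B" for b
    by (rule mod_homI) (use that in \<open>auto simp: copower_right_simps\<close>)
  then have fam: "fin_family R ?F B (\<lambda>b h. h b)"
    by (auto simp: fin_family_def copower_right_simps)
  have \<delta>: "?\<delta> b \<in> carrier ?F" if "b \<in> B" for b
    by (auto simp: copower_right_simps)
  have "family_comb R ?F B (\<lambda>b h. h b) ?\<delta> h = h" if h: "h \<in> carrier ?F" for h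
  proof -
    let ?c = "family_comb R ?F B (\<lambda>b h. h b) ?\<delta> h" and ?T = "{b \<in> B. h b \<noteq> \<zero>}"
    have c: "?c \<in> carrier ?F"
      using mod_homD(1)[OF family_comb_hom[OF F.right_module_axioms F.right_module_axioms fam \<delta>] h] by simp
    have hc: "h b \<in> carrier R" if "b \<in> B" for b
      using that h by (auto simp: copower_right_simps)
    have "?c b = h b" if b: "b \<in> B" for b
    proof -
      interpret k: module_hom R ?F "right_regular R" "\<lambda>h. h b"
        using F.right_module_axioms right_module_right_regular[OF assms] coord[OF b] by (rule module_homI)
      have "?c b = family_comb R (right_regular R) B (\<lambda>b h. h b) (\<lambda>c. ?\<delta> c b) h"
        using k.module_hom_axioms fam \<delta> h by (rule hom_family_comb)
      also have "\<dots> = (\<Oplus>c\<in>?T. if b = c then h c else \<zero>)"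
        unfolding family_comb_def finsum_right_regular
        by (rule finsum_cong') (use b hc in auto)
      also have "\<dots> = h b"
      \<comment> \<open>If the coordinate is zero, \<open>b\<close> lies outside the index set and
        every term of the sum is zero.\<close>
      proof (cases "h b = \<zero>")
        case True
        then have "(\<Oplus>c\<in>?T. if b = c then h c else \<zero>) = (\<Oplus>c\<in>?T. \<zero>)"
          by (intro finsum_cong') auto
        then show ?thesis using True by simp
      next
        case False
        then show ?thesis
          by (intro finsum_singleton) (use b h in \<open>auto simp: copower_right_simps\<close>)
      qed
      finally show ?thesis .
    qed
    then show ?thesis using c h
      by (intro PiE_ext[of _ B "\<lambda>_. carrier R"]) (auto simp: copower_right_simps)
  qed
  then show ?thesis using fam \<delta> by (simp add: dual_basis_def)
qed

text \<open>The complement is the kernel of \<open>t\<close>, by the decomposition h = s(t h) + (h -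
  s(t h)).\<close>

lemma direct_summand_of_retract:
  assumes M: "right_module R M" and F: "right_module R F"
    and s: "s \<in> mod_hom R M F" and t: "t \<in> mod_hom R F M"
    and ts: "\<And>x. x \<in> carrier M \<Longrightarrow> t (s x) = x"
  shows "direct_summand R F (s ` carrier M)" "mod_iso R M (F\<lparr>carrier := s ` carrier M\<rparr>)"
proof -
  interpret s: module_hom R M F s using M F s by (rule module_homI)
  interpret t: module_hom R F M t using F M t by (rule module_homI)
  let ?U = "s ` carrier M" and ?V = "{h \<in> carrier F. t h \<in> {\<zero>\<^bsub>M\<^esub>}}"
  have V: "submodule ?V R F"
    by (rule t.vimage_submodule, rule s.M.submodule_intro) (auto simp: s.M.smult_zero_right)
  have "?U \<inter> ?V = {\<zero>\<^bsub>F\<^esub>}"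
    using s.zero t.zero ts by (auto simp: image_iff) (metis s.M.M.zero_closed)
  moreover have "?U <+>\<^bsub>F\<^esub> ?V = carrier F"
  proof
    show "?U <+>\<^bsub>F\<^esub> ?V \<subseteq> carrier F" using s.closed by (auto simp: set_add_def')
    show "carrier F \<subseteq> ?U <+>\<^bsub>F\<^esub> ?V"
    proof
      fix h assume h: "h \<in> carrier F"
      have th: "s (t h) \<in> carrier F" using h s.closed t.closed by simp
      have "t (h \<ominus>\<^bsub>F\<^esub> s (t h)) = \<zero>\<^bsub>M\<^esub>"
        using h th t.minus ts t.closed by (simp add: s.M.M.minus_eq_zero_iff)
      then have "h \<ominus>\<^bsub>F\<^esub> s (t h) \<in> ?V" using h th by simp
      moreover have "h = s (t h) \<oplus>\<^bsub>F\<^esub> (h \<ominus>\<^bsub>F\<^esub> s (t h))"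
        using h th by (metis s.N.M.a_comm s.N.M.minus_add_cancel s.N.M.minus_closed)
      ultimately show "h \<in> ?U <+>\<^bsub>F\<^esub> ?V"
        unfolding set_add_def' using t.closed[OF h] by blast
    qed
  qed
  ultimately show "direct_summand R F ?U"
    unfolding direct_summand_def using V s.image_submodule by blast
  have "s \<in> mod_hom R M (F\<lparr>carrier := ?U\<rparr>)"
    by (rule mod_homI) (auto simp: s.add s.smult)
  moreover have "inj_on s (carrier M)" using ts by (metis inj_on_inverseI)
  ultimately show "mod_iso R M (F\<lparr>carrier := ?U\<rparr>)"
    unfolding mod_iso_def bij_betw_def by auto
qed

text \<open>\<open>projective_right\<close> asks for a basis in the element type of
  \<open>M\<close>, while \<open>B\<close> may have any type. Therefore the free module on
  \<open>carrier M\<close> is used, and the dual basis serves only to split its surjection onto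
  \<open>M\<close>.\<close>

lemma projective_right_of_dual_basis:
  fixes M :: "('a, 'm, 'd) module_scheme"
  assumes M: "right_module R M" and db: "dual_basis R M B q \<chi>"
  shows "projective_right R M"
proof -
  interpret M: right_module R M by fact
  let ?F = "copower (right_regular R) (carrier M)"
  have F: "right_module R ?F" by (rule right_module_copower) (rule M.R.ring_axioms)
  note dF = dual_basisD[OF dual_basis_copower[OF M.R.ring_axioms, of "carrier M"]]
  let ?t = "family_comb R M (carrier M) (\<lambda>b h. h b) (\<lambda>x. x)"
  have t: "?t \<in> mod_hom R ?F M"
    by (rule family_comb_hom[OF F M dF(1)])
  interpret t: module_hom R ?F M ?t using F M t by (rule module_homI)
  have "?t ` carrier ?F = carrier M"
  proof
    show "carrier M \<subseteq> ?t ` carrier ?F"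
    proof
      fix x assume x: "x \<in> carrier M"
      let ?\<delta> = "\<lambda>c\<in>carrier M. if c = x then \<one>\<^bsub>R\<^esub> else \<zero>\<^bsub>R\<^esub>"
      have \<delta>: "?\<delta> \<in> carrier ?F" by (auto simp: copower_right_simps)
      have "?t ?\<delta> = (\<Oplus>\<^bsub>M\<^esub>b\<in>{x}. ?\<delta> b \<odot>\<^bsub>M\<^esub> b)"
        by (rule family_comb_superset[OF M]) (use x in auto)
      also have "\<dots> = x" using x by (simp add: M.smult_one)
      finally show "x \<in> ?t ` carrier ?F" by (rule image_eqI[OF sym \<delta>])
    qed
  qed (use t.closed in auto)
  then obtain s where s: "s \<in> mod_hom R M ?F" "\<And>x. x \<in> carrier M \<Longrightarrow> ?t (s x) = x"
    using projective_lifting[OF M F M db mod_hom_id t] by metis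
  show ?thesis
    unfolding projective_right_def
    using M direct_summand_of_retract[OF M F s(1) t] s(2) by blast
qed

text \<open>Projecting the free module onto \<open>U\<close> along \<open>V\<close> and then
  inverting the isomorphism gives a retraction \<open>t\<close> of \<open>s\<close>; the coordinate
  dual basis is transferred along it.\<close>

lemma dual_basis_of_projective_right:
  fixes M :: "('a, 'm, 'd) module_scheme"
  assumes "projective_right R M"
  obtains B :: "'m set" and q \<chi> where "dual_basis R M B q \<chi>"
proof -
  from assms have M: "right_module R M" by (simp add: projective_right_def)
  interpret M: right_module R M by fact
  from assms obtain B :: "'m set" and U where
    U: "direct_summand R (copower (right_regular R) B) U"
    and iso: "mod_iso R M ((copower (right_regular R) B)\<lparr>carrier := U\<rparr>)"
    by (auto simp: projective_right_def)
  let ?F = "copower (right_regular R) B"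
  have F: "right_module R ?F" by (rule right_module_copower) (rule M.R.ring_axioms)
  interpret F: right_module R ?F by fact
  from U obtain V where sU: "submodule U R ?F" and sV: "submodule V R ?F"
    and UV: "U \<inter> V = {\<zero>\<^bsub>?F\<^esub>}" "U <+>\<^bsub>?F\<^esub> V = carrier ?F"
    by (auto simp: direct_summand_def)
  note DU = F.submoduleD[OF sU] and DV = F.submoduleD[OF sV]
  from iso obtain s where s0: "s \<in> mod_hom R M (?F\<lparr>carrier := U\<rparr>)"
    and bij: "bij_betw s (carrier M) U"
    by (auto simp: mod_iso_def)
  have s: "s \<in> mod_hom R M ?F"
    using mod_hom_comp[OF s0 mod_hom_incl[OF DU(1)]] .
  have uniq: "u = u'" if "u \<in> U" "v \<in> V" "u' \<in> U" "v' \<in> V" "u \<oplus>\<^bsub>?F\<^esub> v = u' \<oplus>\<^bsub>?F\<^esub> v'" for u v u' v'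
  proof -
    have c: "u \<in> carrier ?F" "v \<in> carrier ?F" "u' \<in> carrier ?F" "v' \<in> carrier ?F"
      using that DU DV by auto
    have "u \<ominus>\<^bsub>?F\<^esub> u' = v' \<ominus>\<^bsub>?F\<^esub> v"
      by (rule F.M.add_eq_add_imp_minus_eq[OF that(5) c])
    moreover have "u \<ominus>\<^bsub>?F\<^esub> u' \<in> U" "v' \<ominus>\<^bsub>?F\<^esub> v \<in> V" using that DU DV by auto
    ultimately have "u \<ominus>\<^bsub>?F\<^esub> u' = \<zero>\<^bsub>?F\<^esub>" using UV(1) by auto
    then show ?thesis using c by (simp add: F.M.minus_eq_zero_iff)
  qed
  define t where "t h = (THE x. x \<in> carrier M \<and> (\<exists>v\<in>V. h = s x \<oplus>\<^bsub>?F\<^esub> v))" for h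
  have t_eq: "t (s x \<oplus>\<^bsub>?F\<^esub> v) = x" if "x \<in> carrier M" "v \<in> V" for x v
    unfolding t_def
  proof (rule the_equality)
    show "x \<in> carrier M \<and> (\<exists>w\<in>V. s x \<oplus>\<^bsub>?F\<^esub> v = s x \<oplus>\<^bsub>?F\<^esub> w)" using that by auto
    fix y assume y: "y \<in> carrier M \<and> (\<exists>w\<in>V. s x \<oplus>\<^bsub>?F\<^esub> v = s y \<oplus>\<^bsub>?F\<^esub> w)"
    then have "s x = s y" using uniq that bij by (auto simp: bij_betw_def)
    then show "y = x" using y that bij by (auto simp: bij_betw_def inj_on_def)
  qed
  have dec: "\<exists>x\<in>carrier M. \<exists>v\<in>V. h = s x \<oplus>\<^bsub>?F\<^esub> v" if "h \<in> carrier ?F" for h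
    using that bij unfolding UV(2)[symmetric] set_add_def' bij_betw_def by fastforce
  have t: "t \<in> mod_hom R ?F M"
  proof (rule mod_homI)
    fix h assume "h \<in> carrier ?F"
    then obtain x v where x: "x \<in> carrier M" "v \<in> V" "h = s x \<oplus>\<^bsub>?F\<^esub> v" using dec by blast
    then show "t h \<in> carrier M" using t_eq by simp
    fix k assume "k \<in> carrier ?F"
    then obtain y w where y: "y \<in> carrier M" "w \<in> V" "k = s y \<oplus>\<^bsub>?F\<^esub> w" using dec by blast
    have c: "s x \<in> carrier ?F" "s y \<in> carrier ?F" "v \<in> carrier ?F" "w \<in> carrier ?F"
      using x y DV mod_homD(1)[OF s] by auto
    have "h \<oplus>\<^bsub>?F\<^esub> k = s (x \<oplus>\<^bsub>M\<^esub> y) \<oplus>\<^bsub>?F\<^esub> (v \<oplus>\<^bsub>?F\<^esub> w)"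
      using x y c mod_homD(2)[OF s] by (simp add: F.M.a_ac)
    then show "t (h \<oplus>\<^bsub>?F\<^esub> k) = t h \<oplus>\<^bsub>M\<^esub> t k" using x y t_eq DV by simp
  next
    fix a h assume a: "a \<in> carrier R" and "h \<in> carrier ?F"
    then obtain x v where x: "x \<in> carrier M" "v \<in> V" "h = s x \<oplus>\<^bsub>?F\<^esub> v" using dec by blast
    then have "a \<odot>\<^bsub>?F\<^esub> h = s (a \<odot>\<^bsub>M\<^esub> x) \<oplus>\<^bsub>?F\<^esub> a \<odot>\<^bsub>?F\<^esub> v"
      using a DV mod_homD[OF s] by (auto simp: F.smult_r_distr subset_eq)
    then show "t (a \<odot>\<^bsub>?F\<^esub> h) = a \<odot>\<^bsub>M\<^esub> t h" using x a t_eq DV M.smult_closed by simp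
  qed
  have "t (s x) = x" if x: "x \<in> carrier M" for x
    using t_eq[OF x DV(2)] mod_homD(1)[OF s x] by simp
  then have "dual_basis R M B (\<lambda>b. t (\<lambda>c\<in>B. if c = b then \<one>\<^bsub>R\<^esub> else \<zero>\<^bsub>R\<^esub>)) (\<lambda>b x. s x b)"
    using dual_basis_retract[OF M F dual_basis_copower[OF M.R.ring_axioms] s t] by simp
  then show thesis by (rule that)
qed

section \<open>Reduction modulo an ideal\<close>

lemma submodule_Inter:
  assumes M: "right_module R M" and "\<And>N. N \<in> A \<Longrightarrow> submodule N R M" "A \<noteq> {}"
  shows "submodule (\<Inter>A) R M"
proof -
  interpret right_module R M by fact
  show ?thesis
  proof (rule submodule_intro)
    show "\<Inter>A \<subseteq> carrier M" using assms(3) submoduleD(1)[OF assms(2)] by blast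
    show "\<zero>\<^bsub>M\<^esub> \<in> \<Inter>A" using submoduleD(2)[OF assms(2)] by blast
    show "x \<oplus>\<^bsub>M\<^esub> y \<in> \<Inter>A" if "x \<in> \<Inter>A" "y \<in> \<Inter>A" for x y
      using that submoduleD(3)[OF assms(2)] by blast
    show "a \<odot>\<^bsub>M\<^esub> x \<in> \<Inter>A" if "a \<in> carrier R" "x \<in> \<Inter>A" for a x
      using that submoduleD(6)[OF assms(2)] by blast
  qed
qed

context right_module
begin

lemma mod_span_submodule: "S \<subseteq> carrier M \<Longrightarrow> submodule (mod_span R M S) R M"
  unfolding mod_span_def
  by (rule submodule_Inter[OF right_module_axioms]) (use carrier_submodule in auto)

lemma mod_span_least: "\<lbrakk>submodule N R M; S \<subseteq> N\<rbrakk> \<Longrightarrow> mod_span R M S \<subseteq> N"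
  by (auto simp: mod_span_def)

lemma mod_span_superset: "S \<subseteq> mod_span R M S"
  by (auto simp: mod_span_def)

end

section \<open>Dual bases and generating sets\<close>

lemma family_comb_mod_span:
  assumes M: "right_module R M" and db: "dual_basis R M B q \<chi>"
  shows "mod_span R M (q ` B) = carrier M"
proof -
  interpret right_module R M by fact
  note D = dual_basisD[OF db]
  have sub: "submodule (mod_span R M (q ` B)) R M"
    by (rule mod_span_submodule) (use D(2) in auto)
  have "x \<in> mod_span R M (q ` B)" if x: "x \<in> carrier M" for x
  proof -
    have "family_comb R M B \<chi> q x \<in> mod_span R M (q ` B)"
      unfolding family_comb_def
      using fin_familyD(3)[OF D(1) _ x] mod_span_superset submoduleD(6)[OF sub]
      by (intro submodule_finsum[OF sub]) blast
    then show ?thesis using D(3)[OF x] by simp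
  qed
  then show ?thesis using submoduleD(1)[OF sub] by blast
qed

lemma countably_gen_of_dual_basis:
  "\<lbrakk>right_module R M; dual_basis R M B q \<chi>; countable B\<rbrakk> \<Longrightarrow> countably_gen R M"
  unfolding countably_gen_def
  by (rule exI[of _ "q ` B"]) (auto simp: family_comb_mod_span dest: dual_basisD(2))

lemma fin_gen_of_dual_basis:
  "\<lbrakk>right_module R M; dual_basis R M B q \<chi>; finite B\<rbrakk> \<Longrightarrow> fin_gen R M"
  unfolding fin_gen_def
  by (rule exI[of _ "q ` B"]) (auto simp: family_comb_mod_span dest: dual_basisD(2))

lemma fin_gen_image:
  assumes "module_hom R M N h" "fin_gen R M" "h ` carrier M = carrier N"
  shows "fin_gen R N"
proof -
  interpret h: module_hom R M N h by fact
  from assms(2) obtain S where S: "S \<subseteq> carrier M" "finite S" "mod_span R M S = carrier M"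
    by (auto simp: fin_gen_def)
  have hS: "h ` S \<subseteq> carrier N" using S h.closed by auto
  note sub = h.N.mod_span_submodule[OF hS]
  have "mod_span R M S \<subseteq> {x \<in> carrier M. h x \<in> mod_span R N (h ` S)}"
    by (rule h.M.mod_span_least[OF h.vimage_submodule[OF sub]])
      (use S h.N.mod_span_superset[of "h ` S"] in auto)
  then have "h ` carrier M \<subseteq> mod_span R N (h ` S)" unfolding S(3) by auto
  then have "carrier N \<subseteq> mod_span R N (h ` S)" by (simp only: assms(3))
  then show ?thesis using hS S(2) h.N.submoduleD(1)[OF sub] by (auto simp: fin_gen_def)
qed

text \<open>Keep only the functionals that are nonzero on some generator. The common kernel of all
  others is a submodule containing the generators, hence everything, so dropping them changes no
  expansion.\<close>

lemma finite_dual_basis: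
  fixes R (structure)
  assumes M: "right_module R M" and db: "dual_basis R M B q \<chi>" and fg: "fin_gen R M"
  obtains T where "finite T" "dual_basis R M T q \<chi>"
proof -
  interpret right_module R M by fact
  note D = dual_basisD[OF db]
  from fg obtain S where S: "S \<subseteq> carrier M" "finite S" "mod_span R M S = carrier M"
    by (auto simp: fin_gen_def)
  let ?T = "\<Union>x\<in>S. {b \<in> B. \<chi> b x \<noteq> \<zero>}"
  have T: "finite ?T" using S fin_familyD(2)[OF D(1)] by auto
  let ?N = "{x \<in> carrier M. \<forall>b\<in>B - ?T. \<chi> b x = \<zero>}"
  have hom: "module_hom R M (right_regular R) (\<chi> b)" if "b \<in> B" for b
    using fin_familyD(1)[OF D(1) that] M right_module_right_regular[OF R.ring_axioms]
    by (rule module_homI[rotated 2])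
  have "submodule ?N R M"
    by (rule submodule_intro)
      (use smult_closed module_hom.zero[OF hom] module_hom.add[OF hom] module_hom.smult[OF hom] in auto)
  then have "mod_span R M S \<subseteq> ?N" by (rule mod_span_least) (use S in auto)
  then have *: "\<chi> b x = \<zero>" if "x \<in> carrier M" "b \<in> B - ?T" for x b using that S(3) by auto
  have "family_comb R M ?T \<chi> q x = x" if x: "x \<in> carrier M" for x
  proof -
    have "{b \<in> B. \<chi> b x \<noteq> \<zero>} = {b \<in> ?T. \<chi> b x \<noteq> \<zero>}" using * x by auto
    then show ?thesis using D(3)[OF x] by (simp add: family_comb_def)
  qed
  then have "dual_basis R M ?T q \<chi>"
    using D fin_family_finite[OF T fin_familyD(1)[OF D(1)]] unfolding dual_basis_def by auto
  with T show thesis by (rule that)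
qed

locale ring_ideal = R?: ring R + I?: ideal I R for R (structure) and I

sublocale ideal \<subseteq> ring_ideal R I
  by unfold_locales

context ring_ideal
begin

lemma ideal_gen_subset: "right_module R M \<Longrightarrow> {a \<odot>\<^bsub>M\<^esub> x |a x. a \<in> I \<and> x \<in> carrier M} \<subseteq> carrier M"
  using I.Icarr right_module.smult_closed by fastforce

lemma ideal_mult_submodule: "right_module R M \<Longrightarrow> submodule (ideal_mult R I M) R M"
  unfolding ideal_mult_def by (rule right_module.mod_span_submodule) (auto dest!: ideal_gen_subset)

lemma ideal_multI: "\<lbrakk>right_module R M; a \<in> I; x \<in> carrier M\<rbrakk> \<Longrightarrow> a \<odot>\<^bsub>M\<^esub> x \<in> ideal_mult R I M"
  unfolding ideal_mult_def by (rule right_module.mod_span_superset[THEN subsetD]) auto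

lemma ideal_mult_least:
  assumes "right_module R M" "submodule N R M" "\<And>a x. a \<in> I \<Longrightarrow> x \<in> carrier M \<Longrightarrow> a \<odot>\<^bsub>M\<^esub> x \<in> N"
  shows "ideal_mult R I M \<subseteq> N"
  unfolding ideal_mult_def by (rule right_module.mod_span_least) (use assms in auto)

lemma hom_ideal_mult:
  assumes "module_hom R M N h" "x \<in> ideal_mult R I M"
  shows "h x \<in> ideal_mult R I N"
proof -
  interpret h: module_hom R M N h by fact
  have "ideal_mult R I M \<subseteq> {x \<in> carrier M. h x \<in> ideal_mult R I N}"
    by (rule ideal_mult_least[OF h.M.right_module_axioms h.vimage_submodule])
      (use ideal_mult_submodule[OF h.N.right_module_axioms] ideal_multI[OF h.N.right_module_axioms]
        h.M.smult_closed h.smult h.closed in auto)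
  then show ?thesis using assms(2) by auto
qed

text \<open>Both sides of the ideal enter: as a right ideal \<open>I\<close> is a submodule of the
  right regular module, and as a left ideal it contains h(x)a for a in \<open>I\<close>.\<close>

lemma functional_ideal_mult:
  assumes M: "right_module R M" and h: "h \<in> mod_hom R M (right_regular R)" and x: "x \<in> ideal_mult R I M"
  shows "h x \<in> I"
proof -
  interpret h: module_hom R M "right_regular R" h
    using M right_module_right_regular[OF R.ring_axioms] h by (rule module_homI)
  have "submodule I R (right_regular R)"
    by (rule h.N.submodule_intro) (auto simp: I.Icarr I.I_r_closed)
  then have "ideal_mult R I M \<subseteq> {x \<in> carrier M. h x \<in> I}"
    by (intro ideal_mult_least[OF M h.vimage_submodule])
      (use h.M.smult_closed h.smult h.closed I.Icarr I.I_l_closed in auto)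
  then show ?thesis using x by auto
qed

text \<open>An expansion with all coefficients in \<open>I\<close> lies in MI. This coordinate test
  is what makes congruences accessible to functionals, and so to duality.\<close>

lemma ideal_mult_iff_dual_basis:
  assumes M: "right_module R M" and db: "dual_basis R M B q \<chi>" and x: "x \<in> carrier M"
  shows "x \<in> ideal_mult R I M \<longleftrightarrow> (\<forall>b\<in>B. \<chi> b x \<in> I)"
proof
  note D = dual_basisD[OF db]
  show "x \<in> ideal_mult R I M \<Longrightarrow> \<forall>b\<in>B. \<chi> b x \<in> I"
    using functional_ideal_mult[OF M fin_familyD(1)[OF D(1)]] by blast
  assume *: "\<forall>b\<in>B. \<chi> b x \<in> I"
  have "family_comb R M B \<chi> q x \<in> ideal_mult R I M"
    unfolding family_comb_def
    by (rule right_module.submodule_finsum[OF M ideal_mult_submodule[OF M]])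
      (use * D(2) ideal_multI[OF M] in auto)
  then show "x \<in> ideal_mult R I M" using D(3)[OF x] by simp
qed

end

text \<open>Membership in the carrier is built in, so that chains of congruences carry their own
  closure conditions.\<close>

definition mcong ::
  "('a, 'r) ring_scheme \<Rightarrow> 'a set \<Rightarrow> ('a, 'm, 'd) module_scheme \<Rightarrow> 'm \<Rightarrow> 'm \<Rightarrow> bool"
  where "mcong R I M x y \<longleftrightarrow> x \<in> carrier M \<and> y \<in> carrier M \<and> x \<ominus>\<^bsub>M\<^esub> y \<in> ideal_mult R I M"

context ring_ideal
begin

context
  fixes M :: "('a, 'm, 'd) module_scheme"
  assumes M: "right_module R M"
begin

interpretation M: right_module R M by (rule M)

lemmas IM_D = M.submoduleD[OF ideal_mult_submodule[OF M]]

lemma mcong_refl: "x \<in> carrier M \<Longrightarrow> mcong R I M x x"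
  using IM_D(2) by (simp add: mcong_def M.M.minus_eq_zero_iff[THEN iffD2])

lemma mcong_sym: "mcong R I M x y \<Longrightarrow> mcong R I M y x"
  using IM_D(4)[of "x \<ominus>\<^bsub>M\<^esub> y"]
  by (auto simp: mcong_def a_minus_def M.M.minus_add M.M.a_comm[of "\<ominus>\<^bsub>M\<^esub> x"])

lemma mcong_trans:
  assumes "mcong R I M x y" "mcong R I M y z" shows "mcong R I M x z"
proof -
  have c: "x \<in> carrier M" "y \<in> carrier M" "z \<in> carrier M" using assms by (auto simp: mcong_def)
  have "(x \<ominus>\<^bsub>M\<^esub> y) \<oplus>\<^bsub>M\<^esub> (y \<ominus>\<^bsub>M\<^esub> z) = x \<ominus>\<^bsub>M\<^esub> z"
    using c by (simp add: a_minus_def M.M.a_assoc M.M.r_neg1)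
  then show ?thesis using IM_D(3) assms c unfolding mcong_def by metis
qed

lemma mcong_add:
  assumes "mcong R I M x y" "mcong R I M x' y'" shows "mcong R I M (x \<oplus>\<^bsub>M\<^esub> x') (y \<oplus>\<^bsub>M\<^esub> y')"
proof -
  have c: "x \<in> carrier M" "y \<in> carrier M" "x' \<in> carrier M" "y' \<in> carrier M"
    using assms by (auto simp: mcong_def)
  have "(x \<ominus>\<^bsub>M\<^esub> y) \<oplus>\<^bsub>M\<^esub> (x' \<ominus>\<^bsub>M\<^esub> y') = (x \<oplus>\<^bsub>M\<^esub> x') \<ominus>\<^bsub>M\<^esub> (y \<oplus>\<^bsub>M\<^esub> y')"
    using c by (simp add: a_minus_def M.M.minus_add M.M.a_ac)
  then show ?thesis using IM_D(3) assms c unfolding mcong_def by (metis M.M.a_closed)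
qed

lemma mcong_uminus:
  assumes "mcong R I M x y" shows "mcong R I M (\<ominus>\<^bsub>M\<^esub> x) (\<ominus>\<^bsub>M\<^esub> y)"
proof -
  have c: "x \<in> carrier M" "y \<in> carrier M" using assms by (auto simp: mcong_def)
  have "\<ominus>\<^bsub>M\<^esub> (x \<ominus>\<^bsub>M\<^esub> y) = \<ominus>\<^bsub>M\<^esub> x \<ominus>\<^bsub>M\<^esub> \<ominus>\<^bsub>M\<^esub> y"
    using c by (simp add: a_minus_def M.M.minus_add)
  then show ?thesis using IM_D(4) assms c unfolding mcong_def by (metis M.M.a_inv_closed)
qed

lemma mcong_minus:
  "\<lbrakk>mcong R I M x y; mcong R I M x' y'\<rbrakk> \<Longrightarrow> mcong R I M (x \<ominus>\<^bsub>M\<^esub> x') (y \<ominus>\<^bsub>M\<^esub> y')"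
  unfolding a_minus_def by (intro mcong_add mcong_uminus)

lemma mcong_zero_iff: "x \<in> carrier M \<Longrightarrow> mcong R I M x \<zero>\<^bsub>M\<^esub> \<longleftrightarrow> x \<in> ideal_mult R I M"
  by (simp add: mcong_def a_minus_def M.M.uminus_zero)

lemma mcong_ideal_mult:
  "mcong R I M x y \<Longrightarrow> x \<in> ideal_mult R I M \<longleftrightarrow> y \<in> ideal_mult R I M"
  by (metis mcong_def mcong_sym mcong_trans mcong_zero_iff)

end

lemma mcong_hom:
  assumes "module_hom R M N h" "mcong R I M x y" shows "mcong R I N (h x) (h y)"
proof -
  interpret h: module_hom R M N h by fact
  show ?thesis using assms(2) hom_ideal_mult[OF assms(1), of "x \<ominus>\<^bsub>M\<^esub> y"]
    by (auto simp: mcong_def h.closed h.minus)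
qed

end

text \<open>Restriction of scalars along $R \<rightarrow> R/I$.\<close>

definition res ::
  "('a, 'r) ring_scheme \<Rightarrow> 'a set \<Rightarrow> ('a set, 'y, 'd) module_scheme \<Rightarrow> ('a, 'y) module"
  where "res R I Y = \<lparr>carrier = carrier Y, mult = undefined, one = undefined, zero = \<zero>\<^bsub>Y\<^esub>,
    add = add Y, smult = (\<lambda>a y. (I +>\<^bsub>R\<^esub> a) \<odot>\<^bsub>Y\<^esub> y)\<rparr>"

lemma res_simps [simp]:
  "carrier (res R I Y) = carrier Y" "\<zero>\<^bsub>res R I Y\<^esub> = \<zero>\<^bsub>Y\<^esub>"
  "x \<oplus>\<^bsub>res R I Y\<^esub> y = x \<oplus>\<^bsub>Y\<^esub> y" "a \<odot>\<^bsub>res R I Y\<^esub> y = (I +>\<^bsub>R\<^esub> a) \<odot>\<^bsub>Y\<^esub> y"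
  by (auto simp: res_def)

context ring_ideal
begin

lemma right_module_res:
  assumes "right_module (R Quot I) Y" shows "right_module R (res R I Y)"
proof -
  interpret Y: right_module "R Quot I" Y by fact
  have c: "I +> a \<in> carrier (R Quot I)" if "a \<in> carrier R" for a
    using that by (auto simp: FactRing_simps)
  have add: "(I +> a) \<oplus>\<^bsub>R Quot I\<^esub> (I +> b) = I +> (a \<oplus> b)"
    and mult: "(I +> a) \<otimes>\<^bsub>R Quot I\<^esub> (I +> b) = I +> (a \<otimes> b)" if "a \<in> carrier R" "b \<in> carrier R" for a b
    using that by (simp_all add: FactRing_def I.a_rcos_sum I.rcoset_mult_add)
  have one: "\<one>\<^bsub>R Quot I\<^esub> = I +> \<one>" by (simp add: FactRing_def)
  have "abelian_group (res R I Y)"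
    by (rule abelian_groupI) (auto simp: Y.M.a_ac intro: Y.M.l_neg)
  then show ?thesis
    by (intro right_module.intro right_module_axioms.intro R.ring_axioms)
      (use c in \<open>auto simp: Y.smult_closed Y.smult_r_distr Y.smult_assoc
         simp flip: add mult Y.smult_l_distr one intro: Y.smult_one\<close>)
qed

context
  fixes M :: "('a, 'm, 'd) module_scheme"
  assumes M: "right_module R M"
begin

interpretation M: right_module R M by (rule M)

interpretation IM: abelian_subgroup "ideal_mult R I M" M
  using ideal_mult_submodule[OF M]
  by (intro abelian_subgroupI3 additive_subgroupI M.M.abelian_group_axioms) (simp add: submodule_def)

lemma coset_eq_iff_mcong:
  assumes "x \<in> carrier M" "y \<in> carrier M"
  shows "ideal_mult R I M +>\<^bsub>M\<^esub> x = ideal_mult R I M +>\<^bsub>M\<^esub> y \<longleftrightarrow> mcong R I M x y"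
proof -
  have "mcong R I M x y \<longleftrightarrow> x \<in> ideal_mult R I M +>\<^bsub>M\<^esub> y"
  proof
    assume "mcong R I M x y"
    then have "(x \<ominus>\<^bsub>M\<^esub> y) \<oplus>\<^bsub>M\<^esub> y \<in> ideal_mult R I M +>\<^bsub>M\<^esub> y"
      using assms by (intro M.M.a_rcosI IM.a_subset) (auto simp: mcong_def)
    then show "x \<in> ideal_mult R I M +>\<^bsub>M\<^esub> y" using assms by (simp add: M.M.minus_add_cancel)
  next
    assume "x \<in> ideal_mult R I M +>\<^bsub>M\<^esub> y"
    then obtain z where z: "z \<in> ideal_mult R I M" "x = z \<oplus>\<^bsub>M\<^esub> y" by (auto simp: a_r_coset_def')
    then have "x \<ominus>\<^bsub>M\<^esub> y = z" using assms IM.a_subset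
      by (auto simp: a_minus_def M.M.a_assoc M.M.r_neg subset_eq)
    then show "mcong R I M x y" using z assms by (simp add: mcong_def)
  qed
  also have "\<dots> \<longleftrightarrow> ideal_mult R I M +>\<^bsub>M\<^esub> x = ideal_mult R I M +>\<^bsub>M\<^esub> y"
    using assms IM.a_repr_independence'[of x y] IM.a_rcos_self[of x] by auto
  finally show ?thesis by simp
qed

lemma mod_reduction_simps:
  "carrier (mod_reduction R I M) = (\<lambda>x. ideal_mult R I M +>\<^bsub>M\<^esub> x) ` carrier M"
  "\<zero>\<^bsub>mod_reduction R I M\<^esub> = ideal_mult R I M"
  "\<lbrakk>x \<in> carrier M; y \<in> carrier M\<rbrakk> \<Longrightarrow>
    (ideal_mult R I M +>\<^bsub>M\<^esub> x) \<oplus>\<^bsub>mod_reduction R I M\<^esub> (ideal_mult R I M +>\<^bsub>M\<^esub> y) =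
    ideal_mult R I M +>\<^bsub>M\<^esub> (x \<oplus>\<^bsub>M\<^esub> y)"
  by (auto simp: mod_reduction_def A_RCOSETS_def' IM.a_rcos_sum)

lemma coset_memD:
  assumes "x \<in> carrier M" "y \<in> ideal_mult R I M +>\<^bsub>M\<^esub> x" shows "mcong R I M x y"
proof -
  have "y \<in> carrier M" using assms M.M.a_r_coset_subset_G[OF IM.a_subset] by blast
  then show ?thesis
    using assms IM.a_repr_independence'[of y x] coset_eq_iff_mcong by blast
qed

text \<open>The union over representatives collapses because all its members are the same coset: for
  b = i + a with i in \<open>I\<close>, the difference of the two products is the product of i with
  y plus the product of a with y - x, and both terms lie in MI.\<close>

lemma mod_reduction_smult:
  assumes a: "a \<in> carrier R" and x: "x \<in> carrier M"
  shows "(I +> a) \<odot>\<^bsub>mod_reduction R I M\<^esub> (ideal_mult R I M +>\<^bsub>M\<^esub> x) = ideal_mult R I M +>\<^bsub>M\<^esub> (a \<odot>\<^bsub>M\<^esub> x)"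
proof -
  have "ideal_mult R I M +>\<^bsub>M\<^esub> (b \<odot>\<^bsub>M\<^esub> y) = ideal_mult R I M +>\<^bsub>M\<^esub> (a \<odot>\<^bsub>M\<^esub> x)"
    if b: "b \<in> I +> a" and y: "y \<in> ideal_mult R I M +>\<^bsub>M\<^esub> x" for b y
  proof -
    have yc: "mcong R I M y x" using coset_memD[OF x y] by (rule mcong_sym[OF M])
    from b obtain i where i: "i \<in> I" "b = i \<oplus> a" by (auto simp: a_r_coset_def')
    have yM: "y \<in> carrier M" and ic: "i \<in> carrier R" and bc: "b \<in> carrier R"
      using yc i a by (auto simp: mcong_def I.Icarr)
    have e: "b \<odot>\<^bsub>M\<^esub> y \<ominus>\<^bsub>M\<^esub> a \<odot>\<^bsub>M\<^esub> x = i \<odot>\<^bsub>M\<^esub> y \<oplus>\<^bsub>M\<^esub> a \<odot>\<^bsub>M\<^esub> (y \<ominus>\<^bsub>M\<^esub> x)"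
      using yM ic a x i(2)
      by (simp add: M.smult_l_distr M.smult_r_distr M.smult_uminus_right a_minus_def M.M.a_assoc M.smult_closed)
    have "mcong R I M (b \<odot>\<^bsub>M\<^esub> y) (a \<odot>\<^bsub>M\<^esub> x)"
      unfolding mcong_def e
      using yM ic bc a x yc i(1) IM_D[OF M] ideal_multI[OF M] by (auto simp: mcong_def M.smult_closed)
    then show ?thesis using coset_eq_iff_mcong M.smult_closed a x yM bc by blast
  qed
  moreover have "a \<in> I +> a" "x \<in> ideal_mult R I M +>\<^bsub>M\<^esub> x"
    using a x I.a_rcos_self IM.a_rcos_self by auto
  ultimately show ?thesis unfolding mod_reduction_def module.simps by blast
qed

lemma right_module_mod_reduction: "right_module (R Quot I) (mod_reduction R I M)"
proof -
  let ?Y = "mod_reduction R I M" and ?c = "\<lambda>x. ideal_mult R I M +>\<^bsub>M\<^esub> x"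
  note S = mod_reduction_simps and SM = mod_reduction_smult
  have ab: "abelian_group ?Y"
  proof (rule abelian_groupI)
    fix C assume "C \<in> carrier ?Y"
    then obtain x where x: "x \<in> carrier M" "C = ?c x" by (auto simp: S(1))
    show "\<exists>D\<in>carrier ?Y. D \<oplus>\<^bsub>?Y\<^esub> C = \<zero>\<^bsub>?Y\<^esub>"
      using x by (intro bexI[of _ "?c (\<ominus>\<^bsub>M\<^esub> x)"]) (auto simp: S M.M.l_neg IM.a_subset)
    have "\<zero>\<^bsub>?Y\<^esub> = ?c \<zero>\<^bsub>M\<^esub>" by (simp add: S IM.a_subset)
    then show "\<zero>\<^bsub>?Y\<^esub> \<oplus>\<^bsub>?Y\<^esub> C = C" using x by (simp add: S(3))
  next
    have "ideal_mult R I M = ?c \<zero>\<^bsub>M\<^esub>" by (simp add: IM.a_subset)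
    then show "\<zero>\<^bsub>?Y\<^esub> \<in> carrier ?Y" unfolding S by blast
  qed (auto simp: S M.M.a_ac)
  have q: "\<exists>a\<in>carrier R. A = I +> a" if "A \<in> carrier (R Quot I)" for A
    using that by (auto simp: FactRing_simps)
  show ?thesis
  proof (intro right_module.intro right_module_axioms.intro I.quotient_is_ring ab)
    show "\<one>\<^bsub>R Quot I\<^esub> \<odot>\<^bsub>?Y\<^esub> C = C" if "C \<in> carrier ?Y" for C
      using that by (auto simp: S(1) FactRing_def SM M.smult_one)
    fix A C assume A: "A \<in> carrier (R Quot I)" and C: "C \<in> carrier ?Y"
    from q[OF A] C obtain a x where ax: "a \<in> carrier R" "A = I +> a" "x \<in> carrier M" "C = ?c x"
      unfolding S(1) by blast
    then show "A \<odot>\<^bsub>?Y\<^esub> C \<in> carrier ?Y" by (simp add: SM S(1) M.smult_closed)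
    {
      fix D assume "D \<in> carrier ?Y"
      then obtain y where y: "y \<in> carrier M" "D = ?c y" by (auto simp: S(1))
      then show "A \<odot>\<^bsub>?Y\<^esub> (C \<oplus>\<^bsub>?Y\<^esub> D) = A \<odot>\<^bsub>?Y\<^esub> C \<oplus>\<^bsub>?Y\<^esub> A \<odot>\<^bsub>?Y\<^esub> D"
        using ax by (simp add: S(3) SM M.smult_closed M.smult_r_distr)
    }
    fix B assume "B \<in> carrier (R Quot I)"
    then obtain b where b: "b \<in> carrier R" "B = I +> b" using q by auto
    have "A \<oplus>\<^bsub>R Quot I\<^esub> B = I +> (a \<oplus> b)" "A \<otimes>\<^bsub>R Quot I\<^esub> B = I +> (a \<otimes> b)"
      using ax b by (simp_all add: FactRing_def I.a_rcos_sum I.rcoset_mult_add)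
    then show "(A \<oplus>\<^bsub>R Quot I\<^esub> B) \<odot>\<^bsub>?Y\<^esub> C = A \<odot>\<^bsub>?Y\<^esub> C \<oplus>\<^bsub>?Y\<^esub> B \<odot>\<^bsub>?Y\<^esub> C"
      and "(A \<otimes>\<^bsub>R Quot I\<^esub> B) \<odot>\<^bsub>?Y\<^esub> C = B \<odot>\<^bsub>?Y\<^esub> (A \<odot>\<^bsub>?Y\<^esub> C)"
      using ax b by (simp_all add: SM S(3) M.smult_closed M.smult_l_distr M.smult_assoc)
  qed
qed

lemma coset_hom: "(\<lambda>x. ideal_mult R I M +>\<^bsub>M\<^esub> x) \<in> mod_hom R M (res R I (mod_reduction R I M))"
  by (rule mod_homI) (auto simp: mod_reduction_simps mod_reduction_smult)

lemma coset_zero_iff: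
  "x \<in> carrier M \<Longrightarrow> ideal_mult R I M +>\<^bsub>M\<^esub> x = \<zero>\<^bsub>mod_reduction R I M\<^esub> \<longleftrightarrow> x \<in> ideal_mult R I M"
  using coset_eq_iff_mcong[of x "\<zero>\<^bsub>M\<^esub>"] mcong_zero_iff[OF M]
  by (simp add: mod_reduction_simps IM.a_subset)

text \<open>The isomorphism theorem in the form used later: an isomorphism from M/MI is traded for a
  surjection from \<open>M\<close> with kernel MI, which avoids computing with cosets of
  \<open>M\<close>.\<close>

lemma mod_iso_reduction_iff:
  assumes X: "right_module (R Quot I) X"
  shows "mod_iso (R Quot I) (mod_reduction R I M) X \<longleftrightarrow>
    (\<exists>\<rho>\<in>mod_hom R M (res R I X). \<rho> ` carrier M = carrier X \<and>
      (\<forall>x\<in>carrier M. \<rho> x = \<zero>\<^bsub>X\<^esub> \<longleftrightarrow> x \<in> ideal_mult R I M))"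
proof
  let ?Y = "mod_reduction R I M" and ?c = "\<lambda>x. ideal_mult R I M +>\<^bsub>M\<^esub> x"
  assume "mod_iso (R Quot I) ?Y X"
  then obtain h where h: "h \<in> mod_hom (R Quot I) ?Y X" "bij_betw h (carrier ?Y) (carrier X)"
    by (auto simp: mod_iso_def)
  interpret h: module_hom "R Quot I" ?Y X h
    using right_module_mod_reduction X h(1) by (rule module_homI)
  have "(\<lambda>x. h (?c x)) \<in> mod_hom R M (res R I X)"
  proof (rule mod_homI)
    fix a x assume "a \<in> carrier R" "x \<in> carrier M"
    moreover from this have "I +> a \<in> carrier (R Quot I)" "?c x \<in> carrier ?Y"
      by (auto simp: FactRing_simps mod_reduction_simps)
    ultimately show "h (?c (a \<odot>\<^bsub>M\<^esub> x)) = a \<odot>\<^bsub>res R I X\<^esub> h (?c x)"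
      by (simp flip: mod_reduction_smult h.smult)
  next
    fix x y assume "x \<in> carrier M" "y \<in> carrier M"
    then show "h (?c (x \<oplus>\<^bsub>M\<^esub> y)) = h (?c x) \<oplus>\<^bsub>res R I X\<^esub> h (?c y)"
      using h.add[of "?c x" "?c y"] by (simp add: mod_reduction_simps)
  qed (use h.closed in \<open>simp add: mod_reduction_simps\<close>)
  moreover have "(\<lambda>x. h (?c x)) ` carrier M = carrier X"
    using bij_betw_imp_surj_on[OF h(2)] by (simp add: mod_reduction_simps image_image)
  moreover have "h (?c x) = \<zero>\<^bsub>X\<^esub> \<longleftrightarrow> x \<in> ideal_mult R I M" if x: "x \<in> carrier M" for x
  proof -
    have "h (?c x) = h \<zero>\<^bsub>?Y\<^esub> \<longleftrightarrow> ?c x = \<zero>\<^bsub>?Y\<^esub>"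
      using x h.M.M.zero_closed
      by (intro inj_on_eq_iff[OF bij_betw_imp_inj_on[OF h(2)]]) (auto simp: mod_reduction_simps(1))
    then show ?thesis using coset_zero_iff[OF x] by (simp add: h.zero)
  qed
  ultimately show "\<exists>\<rho>\<in>mod_hom R M (res R I X). \<rho> ` carrier M = carrier X \<and>
      (\<forall>x\<in>carrier M. \<rho> x = \<zero>\<^bsub>X\<^esub> \<longleftrightarrow> x \<in> ideal_mult R I M)" by blast
next
  let ?Y = "mod_reduction R I M" and ?c = "\<lambda>x. ideal_mult R I M +>\<^bsub>M\<^esub> x"
  assume "\<exists>\<rho>\<in>mod_hom R M (res R I X). \<rho> ` carrier M = carrier X \<and>
      (\<forall>x\<in>carrier M. \<rho> x = \<zero>\<^bsub>X\<^esub> \<longleftrightarrow> x \<in> ideal_mult R I M)"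
  then obtain \<rho> where \<rho>: "\<rho> \<in> mod_hom R M (res R I X)" "\<rho> ` carrier M = carrier X"
    "\<And>x. x \<in> carrier M \<Longrightarrow> \<rho> x = \<zero>\<^bsub>X\<^esub> \<longleftrightarrow> x \<in> ideal_mult R I M" by blast
  interpret \<rho>: module_hom R M "res R I X" \<rho> using M right_module_res[OF X] \<rho>(1) by (rule module_homI)
  interpret Y: right_module "R Quot I" ?Y by (rule right_module_mod_reduction)
  have eq: "\<rho> x = \<rho> y \<longleftrightarrow> ?c x = ?c y" if "x \<in> carrier M" "y \<in> carrier M" for x y
    using that \<rho>(3)[of "x \<ominus>\<^bsub>M\<^esub> y"] \<rho>.minus[of x y] \<rho>.N.M.minus_eq_zero_iff[of "\<rho> x" "\<rho> y"] \<rho>.closed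
    by (simp add: coset_eq_iff_mcong mcong_def)
  \<comment> \<open>Evaluates \<open>\<rho>\<close> at an arbitrary representative;
    \<open>eq\<close> makes the value independent of the choice.\<close>
  define h where "h C = \<rho> (SOME x. x \<in> carrier M \<and> C = ?c x)" for C
  have h: "h (?c x) = \<rho> x" if "x \<in> carrier M" for x
  proof -
    have "(SOME y. y \<in> carrier M \<and> ?c x = ?c y) \<in> carrier M \<and>
        ?c x = ?c (SOME y. y \<in> carrier M \<and> ?c x = ?c y)"
      by (rule someI[of "\<lambda>y. y \<in> carrier M \<and> ?c x = ?c y" x]) (use that in simp)
    then show ?thesis using eq[OF _ that] unfolding h_def by blast
  qed
  have q: "\<exists>a\<in>carrier R. A = I +> a" if "A \<in> carrier (R Quot I)" for A
    using that by (auto simp: FactRing_simps)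
  have "h \<in> mod_hom (R Quot I) ?Y X"
  proof (rule mod_homI)
    fix C assume "C \<in> carrier ?Y"
    then obtain x where x: "x \<in> carrier M" "C = ?c x" by (auto simp: mod_reduction_simps)
    then show "h C \<in> carrier X" using h \<rho>.closed by simp
    {
      fix D assume "D \<in> carrier ?Y"
      then obtain y where y: "y \<in> carrier M" "D = ?c y" by (auto simp: mod_reduction_simps)
      then show "h (C \<oplus>\<^bsub>?Y\<^esub> D) = h C \<oplus>\<^bsub>X\<^esub> h D" using x h \<rho>.add by (simp add: mod_reduction_simps)
    }
    fix A assume "A \<in> carrier (R Quot I)"
    then obtain a where a: "a \<in> carrier R" "A = I +> a" using q by blast
    then show "h (A \<odot>\<^bsub>?Y\<^esub> C) = A \<odot>\<^bsub>X\<^esub> h C" using x h \<rho>.smult M.smult_closed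
      by (simp add: mod_reduction_smult)
  qed
  moreover have "bij_betw h (carrier ?Y) (carrier X)"
    unfolding bij_betw_def
  proof
    show "inj_on h (carrier ?Y)" using h eq by (auto simp: inj_on_def mod_reduction_simps(1))
    show "h ` carrier ?Y = carrier X" using h \<rho>(2) by (simp add: mod_reduction_simps(1) image_image)
  qed
  ultimately show "mod_iso (R Quot I) ?Y X" unfolding mod_iso_def by blast
qed

end

end

section \<open>Ideals contained in the Jacobson radical\<close>

text \<open>Otherwise (1 - a)R is a proper right ideal, and Zorn's lemma gives a maximal one above
  it. That one contains both a and 1 - a, hence 1.\<close>

lemma (in ring) right_inverse_of_one_minus_radical:
  assumes a: "a \<in> jacobson_radical R"
  shows "\<exists>r\<in>carrier R. (\<one> \<ominus> a) \<otimes> r = \<one>"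
proof (rule ccontr)
  interpret RR: right_module R "right_regular R" by (rule right_module_right_regular) (rule ring_axioms)
  have aR: "a \<in> carrier R" using a by (auto simp: jacobson_radical_def)
  assume no: "\<not> ?thesis"
  let ?K = "(\<lambda>r. (\<one> \<ominus> a) \<otimes> r) ` carrier R"
  \<comment> \<open>Properness is expressed by the absence of 1, a condition that passes to unions
    of chains.\<close>
  let ?A = "{L. submodule L R (right_regular R) \<and> ?K \<subseteq> L \<and> \<one> \<notin> L}"
  have "submodule ?K R (right_regular R)"
  proof (rule RR.submodule_intro)
    show "\<zero>\<^bsub>right_regular R\<^esub> \<in> ?K" using aR by (auto intro!: image_eqI[of _ _ "\<zero>"])
    show "x \<oplus>\<^bsub>right_regular R\<^esub> y \<in> ?K" if "x \<in> ?K" "y \<in> ?K" for x y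
      using that aR by (auto simp flip: r_distr)
    show "r \<odot>\<^bsub>right_regular R\<^esub> x \<in> ?K" if "r \<in> carrier R" "x \<in> ?K" for r x
      using that aR by (auto simp: m_assoc)
  qed (use aR in auto)
  then have K: "?K \<in> ?A" using no by auto
  have "\<exists>M\<in>?A. \<forall>L\<in>?A. M \<subseteq> L \<longrightarrow> L = M"
  proof (rule subset_Zorn_nonempty)
    fix C assume C: "C \<noteq> {}" "subset.chain ?A C"
    have CA: "L \<in> ?A" if "L \<in> C" for L using C(2) that by (auto simp: subset.chain_def)
    have D: "submodule L R (right_regular R)" if "L \<in> C" for L using CA[OF that] by simp
    have "submodule (\<Union>C) R (right_regular R)"
    proof (rule RR.submodule_intro)
      show "\<Union>C \<subseteq> carrier (right_regular R)" using RR.submoduleD(1)[OF D] by blast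
      show "\<zero>\<^bsub>right_regular R\<^esub> \<in> \<Union>C" using RR.submoduleD(2)[OF D] C(1) by blast
      show "x \<oplus>\<^bsub>right_regular R\<^esub> y \<in> \<Union>C" if xy: "x \<in> \<Union>C" "y \<in> \<Union>C" for x y
      proof -
        from xy obtain L L' where L: "L \<in> C" "L' \<in> C" "x \<in> L" "y \<in> L'" by blast
        moreover have "L \<subseteq> L' \<or> L' \<subseteq> L" using C(2) L by (auto simp: subset.chain_def)
        ultimately show ?thesis
          using RR.submoduleD(3)[OF D[OF L(1)], of x y] RR.submoduleD(3)[OF D[OF L(2)], of x y] by blast
      qed
      show "r \<odot>\<^bsub>right_regular R\<^esub> x \<in> \<Union>C" if "r \<in> carrier R" "x \<in> \<Union>C" for r x
        using that RR.submoduleD(6)[OF D] by blast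
    qed
    then show "\<Union>C \<in> ?A" using C(1) CA by blast
  qed (use K in blast)
  then obtain M where M: "M \<in> ?A" "\<And>L. L \<in> ?A \<Longrightarrow> M \<subseteq> L \<Longrightarrow> L = M" by (elim bexE) simp
  have "maximal_right_ideal R M"
    unfolding maximal_right_ideal_def
  proof (intro conjI allI impI)
    fix L assume L: "submodule L R (right_regular R)" "M \<subseteq> L"
    show "L = M \<or> L = carrier R"
    proof (cases "\<one> \<in> L")
      case True
      have "r \<in> L" if "r \<in> carrier R" for r
        using RR.submoduleD(6)[OF L(1) that True] that by simp
      then show ?thesis using RR.submoduleD(1)[OF L(1)] by auto
    next
      case False
      then show ?thesis using M L by blast
    qed
  qed (use M in auto)
  then have aM: "a \<in> M" using a by (auto simp: jacobson_radical_def)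
  have "(\<one> \<ominus> a) \<otimes> \<one> \<in> ?K" by blast
  then have "\<one> \<ominus> a \<in> M" using M(1) aR by auto
  then have "(\<one> \<ominus> a) \<oplus> a \<in> M" using RR.submoduleD(3) M(1) aM by fastforce
  then show False using M(1) aR by (simp add: minus_add_cancel)
qed

text \<open>All that is kept of the Jacobson radical. In this form the hypothesis is left-right
  symmetric and passes to the opposite ring, whereas \<open>jacobson_radical\<close> is defined
  through right ideals.\<close>

locale radical_ideal = ring_ideal +
  assumes one_minus_unit: "a \<in> I \<Longrightarrow> \<one> \<ominus> a \<in> Units R"

text \<open>A right inverse r of 1 - a equals 1 + ar, so it again has the form 1 - i with i in
  \<open>I\<close> and itself has a right inverse. That second inverse must be 1 - a, so the inverse
  is two-sided.\<close>

lemma radical_idealI: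
  fixes R (structure)
  assumes "ring R" "ideal I R" "I \<subseteq> jacobson_radical R"
  shows "radical_ideal R I"
proof -
  interpret ideal I R by fact
  have inv: "\<exists>i\<in>I. (\<one> \<ominus> a) \<otimes> (\<one> \<ominus> i) = \<one>" if a: "a \<in> I" for a
  proof -
    have aR: "a \<in> carrier R" using a by (rule Icarr)
    obtain r where r: "r \<in> carrier R" "(\<one> \<ominus> a) \<otimes> r = \<one>"
      using right_inverse_of_one_minus_radical assms(3) a by blast
    have "r = \<one> \<ominus> (\<ominus> (a \<otimes> r))"
    proof -
      have "\<one> \<oplus> a \<otimes> r = (\<one> \<ominus> a) \<otimes> r \<oplus> a \<otimes> r" using r by simp
      also have "\<dots> = ((\<one> \<ominus> a) \<oplus> a) \<otimes> r" using r aR by (simp add: l_distr)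
      also have "\<dots> = r" using r aR by (simp add: minus_add_cancel)
      finally show ?thesis using r aR by (simp add: a_minus_def)
    qed
    moreover have "\<ominus> (a \<otimes> r) \<in> I" using a r I_r_closed a_inv_closed by blast
    ultimately show ?thesis using r by metis
  qed
  have "\<one> \<ominus> a \<in> Units R" if a: "a \<in> I" for a
  proof -
    obtain i where i: "i \<in> I" "(\<one> \<ominus> a) \<otimes> (\<one> \<ominus> i) = \<one>" using inv[OF a] by blast
    obtain j where j: "j \<in> I" "(\<one> \<ominus> i) \<otimes> (\<one> \<ominus> j) = \<one>" using inv[OF i(1)] by blast
    let ?a = "\<one> \<ominus> a" and ?i = "\<one> \<ominus> i" and ?j = "\<one> \<ominus> j"
    have c: "?a \<in> carrier R" "?i \<in> carrier R" "?j \<in> carrier R" using a i j Icarr by auto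
    have "?a = ?a \<otimes> (?i \<otimes> ?j)" using j c by simp
    also have "\<dots> = ?j" using i c by (simp flip: m_assoc)
    finally show ?thesis using i j c by (auto simp: Units_def intro!: bexI[of _ ?i])
  qed
  then show ?thesis
    by (intro radical_ideal.intro ring_ideal_axioms radical_ideal_axioms.intro)
qed

context radical_ideal
begin

text \<open>Nakayama's lemma for the left module of functions on \<open>S\<close>, by eliminating the elements of
  \<open>T\<close> one at a time; the pivots $1 - n_{tt}$ are units.\<close>

lemma nakayama_functions:
  fixes v :: "'i \<Rightarrow> 's \<Rightarrow> 'a"
  assumes fin: "finite T"
    and "\<And>b c. \<lbrakk>b \<in> T; c \<in> T\<rbrakk> \<Longrightarrow> n b c \<in> I"
    and "\<And>b s. \<lbrakk>b \<in> T; s \<in> S\<rbrakk> \<Longrightarrow> v b s \<in> carrier R"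
    and add: "\<And>v w. \<lbrakk>v \<in> W; w \<in> W\<rbrakk> \<Longrightarrow> (\<lambda>s. v s \<oplus> w s) \<in> W"
    and smult: "\<And>r v. \<lbrakk>r \<in> carrier R; v \<in> W\<rbrakk> \<Longrightarrow> (\<lambda>s. r \<otimes> v s) \<in> W"
    and cong: "\<And>v w. \<lbrakk>v \<in> W; \<And>s. s \<in> S \<Longrightarrow> w s = v s\<rbrakk> \<Longrightarrow> w \<in> W"
    and "\<And>b. b \<in> T \<Longrightarrow> (\<lambda>s. v b s \<ominus> (\<Oplus>c\<in>T. n b c \<otimes> v c s)) \<in> W"
  shows "b \<in> T \<Longrightarrow> v b \<in> W"
  using fin assms(2,3,7)
proof (induction T arbitrary: n b rule: finite_induct)
  case (insert t T)
  note n = insert.prems(2) and v = insert.prems(3) and w = insert.prems(4)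
  have nR: "n b c \<in> carrier R" if "b \<in> insert t T" "c \<in> insert t T" for b c
    using n[OF that] by (rule I.Icarr)
  define r where "r = inv (\<one> \<ominus> n t t)"
  have u: "\<one> \<ominus> n t t \<in> Units R" using n by (intro one_minus_unit) auto
  have r: "r \<in> carrier R" "r \<otimes> (\<one> \<ominus> n t t) = \<one>"
    using u by (simp_all add: r_def)
  define \<sigma> where "\<sigma> b s = (\<Oplus>c\<in>T. n b c \<otimes> v c s)" for b s
  have \<sigma>: "\<sigma> b s \<in> carrier R" if "b \<in> insert t T" "s \<in> S" for b s
    unfolding \<sigma>_def using that nR v by (auto intro!: R.finsum_closed)
  have split: "(\<Oplus>c\<in>insert t T. n b c \<otimes> v c s) = n b t \<otimes> v t s \<oplus> \<sigma> b s"
    if "b \<in> insert t T" "s \<in> S" for b s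
    unfolding \<sigma>_def using insert.hyps that nR v by (subst R.finsum_insert) auto
  define w where "w b s = v b s \<ominus> (\<Oplus>c\<in>insert t T. n b c \<otimes> v c s)" for b s
  have w_eq: "w b s = v b s \<ominus> (n b t \<otimes> v t s \<oplus> \<sigma> b s)" if "b \<in> insert t T" "s \<in> S" for b s
    using split[OF that] by (simp add: w_def)
  have wW: "w b \<in> W" if "b \<in> insert t T" for b
    using insert.prems(4)[OF that] by (simp add: w_def[abs_def])
  \<comment> \<open>The relation with index \<open>t\<close>, solved for \<open>v t\<close> by means
    of the unit 1 - n_tt.\<close>
  have pivot: "v t s = r \<otimes> (w t s \<oplus> \<sigma> t s)" if s: "s \<in> S" for s
  proof -
    have c: "v t s \<in> carrier R" "n t t \<in> carrier R" "\<sigma> t s \<in> carrier R"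
      using s v nR \<sigma> by auto
    have "w t s \<oplus> \<sigma> t s = (\<one> \<ominus> n t t) \<otimes> v t s"
      using c s by (subst w_eq) (simp_all, algebra)
    then have "r \<otimes> (w t s \<oplus> \<sigma> t s) = (r \<otimes> (\<one> \<ominus> n t t)) \<otimes> v t s"
      using c r(1) by (simp add: R.m_assoc)
    then show ?thesis using r(2) c by simp
  qed
  \<comment> \<open>Substituting the pivot formula into the other relations eliminates
    \<open>v t\<close>. The new coefficients are n_bc + n_bt r n_tc (a Schur complement), still in
    \<open>I\<close>, and the new defect w_b + n_bt r w_t is still in \<open>W\<close>.\<close>
  have vT: "v b \<in> W" if b: "b \<in> T" for b
  proof (rule insert.IH[OF b, of "\<lambda>b c. n b c \<oplus> n b t \<otimes> r \<otimes> n t c"])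
    show "n b c \<oplus> n b t \<otimes> r \<otimes> n t c \<in> I" if "b \<in> T" "c \<in> T" for b c
      using that n r nR by (intro I.a_closed I.I_l_closed) auto
    show "v b s \<in> carrier R" if "b \<in> T" "s \<in> S" for b s using that v by auto
    fix b assume b: "b \<in> T"
    have "(\<lambda>s. w b s \<oplus> (n b t \<otimes> r) \<otimes> w t s) \<in> W"
      using b wW nR r by (intro add smult) auto
    then show "(\<lambda>s. v b s \<ominus> (\<Oplus>c\<in>T. (n b c \<oplus> n b t \<otimes> r \<otimes> n t c) \<otimes> v c s)) \<in> W"
    proof (rule cong)
      fix s assume s: "s \<in> S"
      have c: "v t s \<in> carrier R" "v b s \<in> carrier R" "n b t \<in> carrier R" "\<sigma> t s \<in> carrier R"
        "\<sigma> b s \<in> carrier R" "w t s \<in> carrier R"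
        using s b v nR \<sigma> w_eq by auto
      have "(\<Oplus>c\<in>T. (n b c \<oplus> n b t \<otimes> r \<otimes> n t c) \<otimes> v c s)
        = (\<Oplus>c\<in>T. n b c \<otimes> v c s \<oplus> (n b t \<otimes> r) \<otimes> (n t c \<otimes> v c s))"
        using s b nR v r by (intro R.finsum_cong') (auto simp: R.l_distr R.m_assoc)
      also have "\<dots> = \<sigma> b s \<oplus> (\<Oplus>c\<in>T. (n b t \<otimes> r) \<otimes> (n t c \<otimes> v c s))"
        unfolding \<sigma>_def using s b nR v r by (intro R.finsum_addf) auto
      also have "(\<Oplus>c\<in>T. (n b t \<otimes> r) \<otimes> (n t c \<otimes> v c s)) = (n b t \<otimes> r) \<otimes> \<sigma> t s"
        unfolding \<sigma>_def using s b nR v r insert.hyps by (intro R.finsum_rdistr[symmetric]) auto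
      finally have e: "(\<Oplus>c\<in>T. (n b c \<oplus> n b t \<otimes> r \<otimes> n t c) \<otimes> v c s)
        = \<sigma> b s \<oplus> (n b t \<otimes> r) \<otimes> \<sigma> t s" .
      have p: "n b t \<otimes> v t s = (n b t \<otimes> r) \<otimes> w t s \<oplus> (n b t \<otimes> r) \<otimes> \<sigma> t s"
        using c r by (subst pivot[OF s]) (simp add: R.m_assoc R.r_distr)
      have wb: "w b s = v b s \<ominus> (n b t \<otimes> v t s \<oplus> \<sigma> b s)" using s b by (intro w_eq) auto
      have "(n b t \<otimes> r) \<otimes> w t s \<in> carrier R" "(n b t \<otimes> r) \<otimes> \<sigma> t s \<in> carrier R" using c r by auto
      then show "v b s \<ominus> (\<Oplus>c\<in>T. (n b c \<oplus> n b t \<otimes> r \<otimes> n t c) \<otimes> v c s)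
        = w b s \<oplus> (n b t \<otimes> r) \<otimes> w t s"
        unfolding e wb p using c(2,5) by algebra
    qed
  qed
  \<comment> \<open>Back substitution: the other \<open>v c\<close> are now known to lie in
    \<open>W\<close>. Starting the sum from \<open>w t\<close> keeps every partial sum in
    \<open>W\<close>, which is given as closed under binary sums only.\<close>
  have sumW: "(\<lambda>s. w t s \<oplus> (\<Oplus>c\<in>T'. n t c \<otimes> v c s)) \<in> W" if "T' \<subseteq> T" for T'
    using finite_subset[OF that insert.hyps(1)] that
  proof (induction T' rule: finite_induct)
    case empty
    then show ?case using wW[of t] w_eq v nR \<sigma> by (auto intro: cong)
  next
    case (insert c T')
    have c: "c \<in> T" using insert by auto
    have "(\<lambda>s. (w t s \<oplus> (\<Oplus>c\<in>T'. n t c \<otimes> v c s)) \<oplus> n t c \<otimes> v c s) \<in> W"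
      using insert c nR vT by (intro add[OF _ smult]) auto
    then show ?case
    proof (rule cong)
      fix s assume s: "s \<in> S"
      have "(\<Oplus>c\<in>insert c T'. n t c \<otimes> v c s) = n t c \<otimes> v c s \<oplus> (\<Oplus>c\<in>T'. n t c \<otimes> v c s)"
        using insert s nR v by (subst R.finsum_insert) auto
      moreover have "(\<Oplus>c\<in>T'. n t c \<otimes> v c s) \<in> carrier R" "n t c \<otimes> v c s \<in> carrier R" "w t s \<in> carrier R"
        using insert c s nR v \<sigma> w_eq by (auto intro!: R.finsum_closed)
      ultimately show "w t s \<oplus> (\<Oplus>c\<in>insert c T'. n t c \<otimes> v c s)
        = (w t s \<oplus> (\<Oplus>c\<in>T'. n t c \<otimes> v c s)) \<oplus> n t c \<otimes> v c s"
        by (simp add: R.a_ac)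
    qed
  qed
  have "(\<lambda>s. r \<otimes> (w t s \<oplus> \<sigma> t s)) \<in> W"
    using smult[OF r(1) sumW[of T]] by (simp add: \<sigma>_def)
  then have "v t \<in> W" by (rule cong) (rule pivot)
  then show ?case using vT insert.prems(1) by auto
qed simp

text \<open>The coordinates of the elements of \<open>S\<close> satisfy a finite linear system whose
  matrix is the identity minus a matrix over \<open>I\<close>, so they can be recovered from values
  of functionals at the points h(y). Combining these functionals with the dual basis vectors gives
  \<open>k\<close>. Outside \<open>S\<close> nothing is claimed, and for \<open>Q\<close> not
  finitely generated no global inverse can be expected.\<close>

lemma local_left_inverse:
  assumes Q: "right_module R Q" and db: "dual_basis R Q B q \<chi>"
    and h: "h \<in> mod_hom R Q Q" and h1: "\<And>y. y \<in> carrier Q \<Longrightarrow> mcong R I Q (h y) y"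
    and S: "finite S" "S \<subseteq> carrier Q"
  obtains k where "k \<in> mod_hom R Q Q" "\<And>y. y \<in> S \<Longrightarrow> k (h y) = y"
proof -
  interpret h: module_hom R Q Q h using Q Q h by (rule module_homI)
  have RR: "right_module R (right_regular R)" by (rule right_module_right_regular) (rule R.ring_axioms)
  interpret RR: right_module R "right_regular R" by (rule RR)
  note D = dual_basisD[OF db] and F = fin_familyD[OF dual_basisD(1)[OF db]]
  \<comment> \<open>Only these coordinates are visible on \<open>S\<close>, so the system is
    finite.\<close>
  define T where "T = (\<Union>y\<in>S. {b \<in> B. \<chi> b y \<noteq> \<zero>})"
  have T: "finite T" "T \<subseteq> B" using S F(2) by (auto simp: T_def)
  \<comment> \<open>On the dual basis vectors these functionals take values in \<open>I\<close>,
    since x - h(x) lies in QI; the values form the coefficient matrix.\<close>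
  define d where "d b x = \<chi> b (x \<ominus>\<^bsub>Q\<^esub> h x)" for b x
  have d: "d b \<in> mod_hom R Q (right_regular R)" if "b \<in> B" for b
    unfolding d_def[abs_def]
    by (rule mod_hom_comp[OF mod_hom_minus[OF Q Q mod_hom_id h] F(1)[OF that]])
  \<comment> \<open>Functions that on \<open>S\<close> factor through \<open>h\<close> by a
    functional; this is closed under left multiplication by scalars.\<close>
  define W where "W = {v. \<exists>\<kappa>\<in>mod_hom R Q (right_regular R). \<forall>y\<in>S. v y = \<kappa> (h y)}"
  have \<chi>W: "\<chi> b \<in> W" if "b \<in> T" for b
  proof (rule nakayama_functions[where T = T and n = "\<lambda>b c. d b (q c)" and S = S and v = \<chi>])
    show "finite T" "b \<in> T" by (fact T(1), fact that)
    show "d b (q c) \<in> I" if "b \<in> T" "c \<in> T" for b c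
      unfolding d_def using that T(2) D(2) h1[THEN mcong_sym[OF Q]]
      by (intro functional_ideal_mult[OF Q F(1)]) (auto simp: mcong_def)
    show "\<chi> b y \<in> carrier R" if "b \<in> T" "y \<in> S" for b y using that T(2) S(2) F(3) by blast
    show "(\<lambda>s. v s \<oplus> w s) \<in> W" if vw: "v \<in> W" "w \<in> W" for v w
    proof -
      from vw obtain \<kappa> \<kappa>' where "\<kappa> \<in> mod_hom R Q (right_regular R)" "\<kappa>' \<in> mod_hom R Q (right_regular R)"
        "\<forall>y\<in>S. v y = \<kappa> (h y)" "\<forall>y\<in>S. w y = \<kappa>' (h y)" by (auto simp: W_def)
      then show ?thesis using mod_hom_add[OF Q RR, of \<kappa> \<kappa>'] unfolding W_def
        by (intro CollectI bexI[of _ "\<lambda>x. \<kappa> x \<oplus>\<^bsub>right_regular R\<^esub> \<kappa>' x"]) auto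
    qed
    show "(\<lambda>s. r \<otimes> v s) \<in> W" if r: "r \<in> carrier R" and v: "v \<in> W" for r v
    proof -
      from v obtain \<kappa> where \<kappa>: "\<kappa> \<in> mod_hom R Q (right_regular R)" "\<forall>y\<in>S. v y = \<kappa> (h y)" by (auto simp: W_def)
      have "(\<lambda>x. r \<otimes> \<kappa> x) \<in> mod_hom R Q (right_regular R)"
        by (rule mod_homI) (use mod_homD[OF \<kappa>(1)] r in \<open>auto simp: R.r_distr R.m_assoc\<close>)
      then show ?thesis using \<kappa>(2) by (auto simp: W_def)
    qed
    show "w \<in> W" if "v \<in> W" "\<And>s. s \<in> S \<Longrightarrow> w s = v s" for v w
      using that by (auto simp: W_def)
    fix b assume b: "b \<in> T"
    have bB: "b \<in> B" using b T(2) by auto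
    \<comment> \<open>Expanding y inside d_b(y) = \<chi>_b(y) - \<chi>_b(h y) produces the required
      relation, and its defect \<chi>_b(h y) lies in \<open>W\<close> by construction.\<close>
    have "\<chi> b y \<ominus> (\<Oplus>c\<in>T. d b (q c) \<otimes> \<chi> c y) = \<chi> b (h y)" if y: "y \<in> S" for y
    proof -
      have yQ: "y \<in> carrier Q" using y S by auto
      interpret db: module_hom R Q "right_regular R" "d b" using Q RR d[OF bB] by (rule module_homI)
      interpret \<chi>b: module_hom R Q "right_regular R" "\<chi> b" using Q RR F(1)[OF bB] by (rule module_homI)
      have "d b y = d b (family_comb R Q B \<chi> q y)" using D(3) yQ by simp
      also have "\<dots> = family_comb R (right_regular R) B \<chi> (\<lambda>c. d b (q c)) y"
        by (rule hom_family_comb[OF db.module_hom_axioms D(1) D(2) yQ])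
      also have "\<dots> = (\<Oplus>\<^bsub>right_regular R\<^esub>c\<in>T. \<chi> c y \<odot>\<^bsub>right_regular R\<^esub> d b (q c))"
        by (rule family_comb_superset[OF RR T])
          (use y yQ T(2) F(3) D(2) db.closed in \<open>auto simp: T_def\<close>)
      finally have "(\<Oplus>c\<in>T. d b (q c) \<otimes> \<chi> c y) = \<chi> b y \<ominus> \<chi> b (h y)"
        using yQ h.closed by (simp add: finsum_right_regular d_def \<chi>b.minus a_minus_right_regular)
      then show ?thesis using yQ h.closed \<chi>b.closed by (simp add: R.minus_minus_cancel)
    qed
    then show "(\<lambda>y. \<chi> b y \<ominus> (\<Oplus>c\<in>T. d b (q c) \<otimes> \<chi> c y)) \<in> W"
      using F(1)[OF bB] by (auto simp: W_def)
  qed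
  then obtain \<kappa> where \<kappa>: "\<And>b. b \<in> T \<Longrightarrow> \<kappa> b \<in> mod_hom R Q (right_regular R)"
    "\<And>b y. b \<in> T \<Longrightarrow> y \<in> S \<Longrightarrow> \<chi> b y = \<kappa> b (h y)"
    unfolding W_def by simp metis
  have fam: "fin_family R Q T \<kappa>" using T(1) \<kappa>(1) by (rule fin_family_finite)
  have qT: "q b \<in> carrier Q" if "b \<in> T" for b using that T(2) D(2) by auto
  show thesis
  proof (rule that)
    show "family_comb R Q T \<kappa> q \<in> mod_hom R Q Q" by (rule family_comb_hom[OF Q Q fam qT])
    fix y assume y: "y \<in> S"
    then have yQ: "y \<in> carrier Q" using S by auto
    have "family_comb R Q T \<kappa> q (h y) = (\<Oplus>\<^bsub>Q\<^esub>b\<in>T. \<kappa> b (h y) \<odot>\<^bsub>Q\<^esub> q b)"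
      by (rule family_comb_superset[OF Q T(1) subset_refl])
        (use fin_familyD(3)[OF fam] qT h.closed yQ in auto)
    also have "\<dots> = (\<Oplus>\<^bsub>Q\<^esub>b\<in>T. \<chi> b y \<odot>\<^bsub>Q\<^esub> q b)"
      by (rule h.M.M.finsum_cong') (use \<kappa>(2) y yQ F(3) T(2) qT in \<open>auto simp flip: \<kappa>(2) intro!: h.M.smult_closed\<close>)
    also have "\<dots> = family_comb R Q B \<chi> q y"
      by (rule family_comb_superset[OF Q T, symmetric]) (use y yQ T(2) F(3) qT in \<open>auto simp: T_def\<close>)
    finally show "family_comb R Q T \<kappa> q (h y) = y" using D(3) yQ by simp
  qed
qed

text \<open>Injectivity concerns two elements at a time, so a left inverse on \<open>{x, y}\<close>
  is enough; \<open>Q\<close> may have any number of generators.\<close>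

lemma inj_on_of_mcong_id:
  assumes "right_module R Q" "dual_basis R Q B q \<chi>"
    and "h \<in> mod_hom R Q Q" "\<And>y. y \<in> carrier Q \<Longrightarrow> mcong R I Q (h y) y"
  shows "inj_on h (carrier Q)"
proof (rule inj_onI)
  fix x y assume xy: "x \<in> carrier Q" "y \<in> carrier Q" "h x = h y"
  obtain k where "\<And>z. z \<in> {x, y} \<Longrightarrow> k (h z) = z"
    by (rule local_left_inverse[OF assms, of "{x, y}"]) (use xy in auto)
  then show "x = y" using xy by (metis insertCI)
qed

text \<open>With finitely many generators, a left inverse on the generators is a left inverse
  everywhere.\<close>

lemma inverse_of_mcong_id:
  assumes P: "right_module R P" and db: "dual_basis R P K p \<phi>" and K: "finite K"
    and u: "u \<in> mod_hom R P P" and u1: "\<And>x. x \<in> carrier P \<Longrightarrow> mcong R I P (u x) x"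
  obtains w where "w \<in> mod_hom R P P" "\<And>x. x \<in> carrier P \<Longrightarrow> w (u x) = x"
    "\<And>x. x \<in> carrier P \<Longrightarrow> u (w x) = x" "\<And>x. x \<in> carrier P \<Longrightarrow> mcong R I P (w x) x"
proof -
  note D = dual_basisD[OF db]
  have left: "\<exists>w\<in>mod_hom R P P. (\<forall>x\<in>carrier P. w (u x) = x) \<and> (\<forall>x\<in>carrier P. mcong R I P (w x) x)"
    if u: "u \<in> mod_hom R P P" and u1: "\<And>x. x \<in> carrier P \<Longrightarrow> mcong R I P (u x) x" for u
  proof -
    obtain w where w: "w \<in> mod_hom R P P" "\<And>y. y \<in> p ` K \<Longrightarrow> w (u y) = y"
      using local_left_inverse[OF P db u u1, of "p ` K"] K D(2) by auto
    interpret w: module_hom R P P w using P P w(1) by (rule module_homI)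
    interpret wu: module_hom R P P "\<lambda>x. w (u x)" using P P mod_hom_comp[OF u w(1)] by (rule module_homI)
    have wu: "w (u x) = x" if x: "x \<in> carrier P" for x
    proof -
      have "w (u (family_comb R P K \<phi> p x)) = family_comb R P K \<phi> (\<lambda>b. w (u (p b))) x"
        by (rule hom_family_comb[OF wu.module_hom_axioms D(1) D(2) x])
      also have "\<dots> = family_comb R P K \<phi> p x"
        by (rule family_comb_cong[OF P D(1) x]) (use w(2) D(2) in auto)
      finally show ?thesis using D(3)[OF x] by simp
    qed
    moreover have "mcong R I P (w x) x" if x: "x \<in> carrier P" for x
      using mcong_hom[OF w.module_hom_axioms mcong_sym[OF P u1[OF x]]] wu[OF x] by simp
    ultimately show ?thesis using w(1) by blast
  qed
  obtain w where w: "w \<in> mod_hom R P P" "\<And>x. x \<in> carrier P \<Longrightarrow> w (u x) = x"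
    "\<And>x. x \<in> carrier P \<Longrightarrow> mcong R I P (w x) x"
    using left[OF u u1] by blast
  \<comment> \<open>The left inverse \<open>w\<close> is again congruent to the identity and so has
    a left inverse \<open>z\<close>; evaluating z w u in two ways gives z = u, whence uw =
    1.\<close>
  obtain z where z: "\<And>x. x \<in> carrier P \<Longrightarrow> z (w x) = x"
    using left[OF w(1) w(3)] by blast
  have "z x = u x" if "x \<in> carrier P" for x
    using z[of "u x"] w(2)[OF that] mod_homD(1)[OF u that] by simp
  then have "u (w x) = x" if "x \<in> carrier P" for x
    using z[OF that] mod_homD(1)[OF w(1) that] by simp
  then show thesis using that w by blast
qed

end

section \<open>Lifting an idempotent modulo the ideal\<close>

text \<open>\<open>X\<close> is isomorphic, via \<open>\<pi>\<close>, to the image of the endomorphism of $P/PI$ induced by \<open>e\<close>.\<close>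

definition represents ::
  "('a, 'r) ring_scheme \<Rightarrow> 'a set \<Rightarrow> ('a, 'm, 'd) module_scheme \<Rightarrow> ('m \<Rightarrow> 'm) \<Rightarrow>
   ('a set, 'x, 'e) module_scheme \<Rightarrow> ('m \<Rightarrow> 'x) \<Rightarrow> bool"
  where "represents R I P e X \<pi> \<longleftrightarrow> \<pi> \<in> mod_hom R P (res R I X) \<and> \<pi> ` carrier P = carrier X \<and>
    (\<forall>x\<in>carrier P. \<pi> x = \<zero>\<^bsub>X\<^esub> \<longleftrightarrow> e x \<in> ideal_mult R I P)"

text \<open>The condition on \<open>e\<close> whose dual is the same condition on \<open>1 - e\<close>.\<close>

definition half_lifts ::
  "('a, 'r) ring_scheme \<Rightarrow> 'a set \<Rightarrow> ('a, 'm, 'd) module_scheme \<Rightarrow> ('m \<Rightarrow> 'm) \<Rightarrow> bool"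
  where "half_lifts R I P e \<longleftrightarrow> (\<exists>a\<in>mod_hom R P P. \<exists>c\<in>mod_hom R P P. \<forall>x\<in>carrier P.
    c (a x) = \<zero>\<^bsub>P\<^esub> \<and> mcong R I P (a x) (e x) \<and> mcong R I P (c x) (x \<ominus>\<^bsub>P\<^esub> e x))"

definition idem_lifts ::
  "('a, 'r) ring_scheme \<Rightarrow> 'a set \<Rightarrow> ('a, 'm, 'd) module_scheme \<Rightarrow> ('m \<Rightarrow> 'm) \<Rightarrow> bool"
  where "idem_lifts R I P e \<longleftrightarrow> (\<exists>d\<in>mod_hom R P P. \<forall>x\<in>carrier P.
    d (d x) = d x \<and> mcong R I P (d x) (e x))"

lemma half_liftsI:
  assumes "a \<in> mod_hom R P P" "c \<in> mod_hom R P P"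
    "\<And>x. x \<in> carrier P \<Longrightarrow> c (a x) = \<zero>\<^bsub>P\<^esub>"
    "\<And>x. x \<in> carrier P \<Longrightarrow> mcong R I P (a x) (e x)"
    "\<And>x. x \<in> carrier P \<Longrightarrow> mcong R I P (c x) (x \<ominus>\<^bsub>P\<^esub> e x)"
  shows "half_lifts R I P e"
  unfolding half_lifts_def using assms by blast

text \<open>Moves a module to another element type along an injection; needed because lifts are
  asserted to exist with elements in \<open>nat \<Rightarrow> 'a\<close>.\<close>

definition transport ::
  "('m \<Rightarrow> 'n) \<Rightarrow> ('a, 'm, 'd) module_scheme \<Rightarrow> ('a, 'n) module"
  where "transport \<iota> M = \<lparr>carrier = \<iota> ` carrier M, mult = undefined, one = undefined,
    zero = \<iota> \<zero>\<^bsub>M\<^esub>,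
    add = (\<lambda>u v. \<iota> (inv_into (carrier M) \<iota> u \<oplus>\<^bsub>M\<^esub> inv_into (carrier M) \<iota> v)),
    smult = (\<lambda>a u. \<iota> (a \<odot>\<^bsub>M\<^esub> inv_into (carrier M) \<iota> u))\<rparr>"

lemma transport:
  assumes M: "right_module R M" and inj: "inj_on \<iota> (carrier M)"
  shows "right_module R (transport \<iota> M)" "\<iota> \<in> mod_hom R M (transport \<iota> M)"
    "inv_into (carrier M) \<iota> \<in> mod_hom R (transport \<iota> M) M"
proof -
  interpret M: right_module R M by fact
  let ?T = "transport \<iota> M" and ?j = "inv_into (carrier M) \<iota>"
  have j: "?j (\<iota> x) = x" if "x \<in> carrier M" for x using that inj by (rule inv_into_f_f[rotated])
  have c: "carrier ?T = \<iota> ` carrier M" "\<zero>\<^bsub>?T\<^esub> = \<iota> \<zero>\<^bsub>M\<^esub>" by (simp_all add: transport_def)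
  have ad: "\<iota> x \<oplus>\<^bsub>?T\<^esub> \<iota> y = \<iota> (x \<oplus>\<^bsub>M\<^esub> y)" if "x \<in> carrier M" "y \<in> carrier M" for x y
    using that j by (simp add: transport_def)
  have sm: "a \<odot>\<^bsub>?T\<^esub> \<iota> x = \<iota> (a \<odot>\<^bsub>M\<^esub> x)" if "x \<in> carrier M" for a x
    using that j by (simp add: transport_def)
  have "abelian_group ?T"
  proof (rule abelian_groupI)
    fix u assume "u \<in> carrier ?T"
    then obtain x where "x \<in> carrier M" "u = \<iota> x" by (auto simp: c)
    then show "\<exists>v\<in>carrier ?T. v \<oplus>\<^bsub>?T\<^esub> u = \<zero>\<^bsub>?T\<^esub>"
      by (intro bexI[of _ "\<iota> (\<ominus>\<^bsub>M\<^esub> x)"]) (auto simp: c ad M.M.l_neg)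
  qed (auto simp: c ad M.M.a_ac)
  then show "right_module R ?T"
    by (intro right_module.intro right_module_axioms.intro M.R.ring_axioms)
      (auto simp: c ad sm M.smult_closed M.smult_l_distr M.smult_r_distr M.smult_assoc M.smult_one)
  show "\<iota> \<in> mod_hom R M ?T" by (rule mod_homI) (auto simp: c ad sm)
  show "?j \<in> mod_hom R ?T M"
    by (rule mod_homI) (auto simp: c ad sm j M.smult_closed)
qed

context ring_ideal
begin

lemma represents_eq_iff:
  assumes "right_module R P" "right_module (R Quot I) X" "module_hom R P P e" "represents R I P e X \<pi>"
    "x \<in> carrier P" "y \<in> carrier P"
  shows "\<pi> x = \<pi> y \<longleftrightarrow> mcong R I P (e x) (e y)"
proof -
  interpret e: module_hom R P P e by fact
  interpret \<pi>: module_hom R P "res R I X" \<pi>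
    using assms(1) right_module_res[OF assms(2)] by (rule module_homI) (use assms(4) in \<open>simp add: represents_def\<close>)
  have "\<pi> x = \<pi> y \<longleftrightarrow> \<pi> (x \<ominus>\<^bsub>P\<^esub> y) = \<zero>\<^bsub>X\<^esub>"
    using assms(5,6) \<pi>.closed \<pi>.N.M.minus_eq_zero_iff[of "\<pi> x" "\<pi> y"] by (simp add: \<pi>.minus)
  also have "\<dots> \<longleftrightarrow> e (x \<ominus>\<^bsub>P\<^esub> y) \<in> ideal_mult R I P"
    using assms(4-6) by (simp add: represents_def)
  also have "\<dots> \<longleftrightarrow> mcong R I P (e x) (e y)"
    using assms(5,6) e.closed by (simp add: mcong_def e.minus)
  finally show ?thesis .
qed

lemma right_lift_iff:
  assumes "right_module (R Quot I) X"
  shows "right_lift R I X Q \<longleftrightarrow> projective_right R Q \<and> (\<exists>\<rho>. represents R I Q (\<lambda>x. x) X \<rho>)"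
  using mod_iso_reduction_iff[OF _ assms, of Q]
  by (auto simp: right_lift_def represents_def projective_right_def)

text \<open>An element is determined by its coordinates, so a countable dual basis embeds
  \<open>Q\<close> into \<open>nat \<Rightarrow> 'a\<close>.\<close>

lemma right_lift_nat_of_dual_basis:
  fixes Q :: "('a, 'm, 'd) module_scheme"
  assumes X: "right_module (R Quot I) X" and Q: "right_module R Q"
    and db: "dual_basis R Q B q \<chi>" and B: "countable B" and \<rho>: "represents R I Q (\<lambda>x. x) X \<rho>"
  shows "\<exists>Q' :: ('a, nat \<Rightarrow> 'a) module. right_lift R I X Q' \<and> countably_gen R Q'"
proof -
  note D = dual_basisD[OF db]
  \<comment> \<open>Coordinates are listed along the enumeration of \<open>B\<close>; positions that
    code no index are padded with zero.\<close>
  define \<iota> where "\<iota> x n = (if n \<in> to_nat_on B ` B then \<chi> (from_nat_into B n) x else \<zero>)" for x n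
  let ?T = "transport \<iota> Q" and ?j = "inv_into (carrier Q) \<iota>"
  have inj: "inj_on \<iota> (carrier Q)"
  proof (rule inj_onI)
    fix x y assume xy: "x \<in> carrier Q" "y \<in> carrier Q" "\<iota> x = \<iota> y"
    have "\<chi> b x = \<chi> b y" if "b \<in> B" for b
      using fun_cong[OF xy(3), of "to_nat_on B b"] that B by (simp add: \<iota>_def)
    then have "family_comb R Q B \<chi> q x = family_comb R Q B \<chi> q y"
      unfolding family_comb_def
      using xy fin_familyD(3)[OF D(1)] D(2)
      by (intro abelian_monoid.finsum_cong'[OF abelian_group.axioms(1)[OF right_module.axioms(2)[OF Q]]])
        (auto intro!: right_module.smult_closed[OF Q])
    then show "x = y" using D(3) xy by simp
  qed
  note T = transport[OF Q inj]
  interpret \<iota>: module_hom R Q ?T \<iota> using Q T(1,2) by (rule module_homI)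
  interpret j: module_hom R ?T Q ?j using T(1) Q T(3) by (rule module_homI)
  have cT: "carrier ?T = \<iota> ` carrier Q" by (simp add: transport_def)
  have \<iota>j: "\<iota> (?j u) = u" if "u \<in> carrier ?T" for u
    using that unfolding cT by (rule f_inv_into_f)
  have dbT: "dual_basis R ?T B (\<lambda>b. \<iota> (q b)) (\<lambda>b u. \<chi> b (?j u))"
    by (rule dual_basis_retract[OF T(1) Q db T(3,2) \<iota>j])
  have "represents R I ?T (\<lambda>x. x) X (\<lambda>u. \<rho> (?j u))"
    unfolding represents_def
  proof (intro conjI ballI)
    show "(\<lambda>u. \<rho> (?j u)) \<in> mod_hom R ?T (res R I X)"
      using mod_hom_comp[OF T(3)] \<rho> by (auto simp: represents_def)
    have "(\<lambda>u. \<rho> (?j u)) ` carrier ?T = \<rho> ` carrier Q"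
      unfolding cT image_image using inj by (intro image_cong) auto
    then show "(\<lambda>u. \<rho> (?j u)) ` carrier ?T = carrier X" using \<rho> by (simp add: represents_def)
    fix u assume u: "u \<in> carrier ?T"
    have "?j u \<in> ideal_mult R I Q \<longleftrightarrow> u \<in> ideal_mult R I ?T"
      using hom_ideal_mult[OF j.module_hom_axioms] hom_ideal_mult[OF \<iota>.module_hom_axioms] \<iota>j[OF u] by metis
    then show "\<rho> (?j u) = \<zero>\<^bsub>X\<^esub> \<longleftrightarrow> u \<in> ideal_mult R I ?T"
      using \<rho> j.closed[OF u] by (simp add: represents_def)
  qed
  then have "right_lift R I X ?T"
    using projective_right_of_dual_basis[OF T(1) dbT] right_lift_iff[OF X] by blast
  then show ?thesis using countably_gen_of_dual_basis[OF T(1) dbT B] by blast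
qed

end

text \<open>Idempotency holds only modulo PI; whether \<open>e\<close> can be replaced by a true
  idempotent is the separate condition \<open>idem_lifts\<close>. The index type stays general so
  that the dual can reuse the same \<open>K\<close>.\<close>

locale mod_idempotent = radical_ideal R I + P: right_module R P
  for R :: "('a, 'r) ring_scheme" (structure) and I and P :: "('a, 'm, 'd) module_scheme" +
  fixes K :: "'k set" and p and \<phi> and e
  assumes fin: "finite K" and db: "dual_basis R P K p \<phi>"
    and e: "e \<in> mod_hom R P P"
    and e_idem: "x \<in> carrier P \<Longrightarrow> mcong R I P (e (e x)) (e x)"
begin

lemmas P_mod = P.right_module_axioms
lemmas db_D = dual_basisD[OF db]

sublocale e: module_hom R P P e
  using P_mod P_mod e by (rule module_homI)

lemma endI: "a \<in> mod_hom R P P \<Longrightarrow> module_hom R P P a"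
  using P_mod P_mod by (rule module_homI)

lemma hom_eqI:
  assumes "module_hom R P N h" "module_hom R P N h'" "\<And>i. i \<in> K \<Longrightarrow> h (p i) = h' (p i)" "x \<in> carrier P"
  shows "h x = h' x"
proof -
  interpret h: module_hom R P N h by fact
  have "h (family_comb R P K \<phi> p x) = family_comb R N K \<phi> (\<lambda>i. h (p i)) x"
    by (rule hom_family_comb[OF assms(1) db_D(1) db_D(2) assms(4)])
  also have "\<dots> = family_comb R N K \<phi> (\<lambda>i. h' (p i)) x"
    by (rule family_comb_cong[OF h.N.right_module_axioms db_D(1) assms(4)]) (use db_D(2) h.closed in \<open>auto simp flip: assms(3)\<close>)
  also have "\<dots> = h' (family_comb R P K \<phi> p x)"
    by (rule hom_family_comb[OF assms(2) db_D(1) db_D(2) assms(4), symmetric])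
  finally show ?thesis using db_D(3)[OF assms(4)] by simp
qed

lemma e_add_complement: "x \<in> carrier P \<Longrightarrow> e x \<oplus>\<^bsub>P\<^esub> (x \<ominus>\<^bsub>P\<^esub> e x) = x"
  by (rule P.M.add_minus_cancel) (auto intro: e.closed)

lemma complement: "mod_idempotent R I P K p \<phi> (\<lambda>x. x \<ominus>\<^bsub>P\<^esub> e x)"
proof unfold_locales
  show "(\<lambda>x. x \<ominus>\<^bsub>P\<^esub> e x) \<in> mod_hom R P P"
    by (rule mod_hom_minus[OF P_mod P_mod mod_hom_id e])
  fix x assume x: "x \<in> carrier P"
  have c: "e x \<in> carrier P" "e (e x) \<in> carrier P" using x e.closed by auto
  have "mcong R I P ((x \<ominus>\<^bsub>P\<^esub> e x) \<ominus>\<^bsub>P\<^esub> (e x \<ominus>\<^bsub>P\<^esub> e (e x))) ((x \<ominus>\<^bsub>P\<^esub> e x) \<ominus>\<^bsub>P\<^esub> (e x \<ominus>\<^bsub>P\<^esub> e x))"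
    using x c e_idem by (intro mcong_minus[OF P_mod] mcong_refl[OF P_mod]) auto
  moreover have "(x \<ominus>\<^bsub>P\<^esub> e x) \<ominus>\<^bsub>P\<^esub> (e x \<ominus>\<^bsub>P\<^esub> e x) = x \<ominus>\<^bsub>P\<^esub> e x"
    using x c by (simp add: a_minus_def P.M.r_neg P.M.uminus_zero)
  ultimately show "mcong R I P (x \<ominus>\<^bsub>P\<^esub> e x \<ominus>\<^bsub>P\<^esub> e (x \<ominus>\<^bsub>P\<^esub> e x)) (x \<ominus>\<^bsub>P\<^esub> e x)"
    using x c by (simp add: e.minus)
qed (fact fin, fact db)

end

text \<open>If \<open>X\<close> is the image of \<open>e\<close> on $P/PI$, then \<open>f\<close> and \<open>g\<close> lift the inclusion of $Q/QI \cong X$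
  into $P/PI$ and the projection onto it.\<close>

locale lift_pair = mod_idempotent R I P K p \<phi> e + Q: right_module R Q
  for R :: "('a, 'r) ring_scheme" (structure) and I and P :: "('a, 'm, 'd) module_scheme"
    and K :: "'k set" and p \<phi> e and Q :: "('a, 'q, 'f) module_scheme" +
  fixes f g
  assumes proj: "projective_right R Q"
    and f: "f \<in> mod_hom R Q P" and g: "g \<in> mod_hom R P Q"
    and gf: "q \<in> carrier Q \<Longrightarrow> mcong R I Q (g (f q)) q"
    and fg: "x \<in> carrier P \<Longrightarrow> mcong R I P (f (g x)) (e x)"
    and ef: "q \<in> carrier Q \<Longrightarrow> mcong R I P (e (f q)) (f q)"
begin

lemmas Q_mod = Q.right_module_axioms

sublocale f: module_hom R Q P f using Q_mod P_mod f by (rule module_homI)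
sublocale g: module_hom R P Q g using P_mod Q_mod g by (rule module_homI)

lemma local_retraction:
  assumes "finite S" "S \<subseteq> carrier Q"
  obtains k where "k \<in> mod_hom R Q Q" "\<And>q. q \<in> S \<Longrightarrow> k (g (f q)) = q"
proof -
  obtain B q \<chi> where "dual_basis R Q (B :: 'q set) q \<chi>"
    using dual_basis_of_projective_right[OF proj] .
  then show thesis
    using local_left_inverse[OF Q_mod _ mod_hom_comp[OF f g] gf assms] that by blast
qed

lemma inj_of_mcong:
  assumes "h \<in> mod_hom R Q Q" "\<And>q. q \<in> carrier Q \<Longrightarrow> mcong R I Q (h q) q"
  shows "inj_on h (carrier Q)"
proof -
  obtain B q \<chi> where "dual_basis R Q (B :: 'q set) q \<chi>"
    using dual_basis_of_projective_right[OF proj] .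
  then show ?thesis using inj_on_of_mcong_id[OF Q_mod _ assms] by blast
qed

text \<open>A finite system has finitely many constants f(q_i). With \<open>k\<close> recovering
  these q_i from g(f(q_i)), the endomorphism fkg of \<open>P\<close> fixes all constants and has
  values in the image of \<open>f\<close>, so it carries a solution in \<open>P\<close> to a
  solution in the image.\<close>

lemma pure_image:
  "pure_submodule R P (f ` carrier Q)" "mod_iso R Q (P\<lparr>carrier := f ` carrier Q\<rparr>)"
proof -
  have "inj_on (\<lambda>q. g (f q)) (carrier Q)" using mod_hom_comp[OF f g] gf by (rule inj_of_mcong)
  then have "inj_on f (carrier Q)" by (auto simp: inj_on_def)
  moreover have "f \<in> mod_hom R Q (P\<lparr>carrier := f ` carrier Q\<rparr>)"
    by (rule mod_homI) (auto simp: f.add f.smult)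
  ultimately show "mod_iso R Q (P\<lparr>carrier := f ` carrier Q\<rparr>)"
    unfolding mod_iso_def bij_betw_def by auto
  show "pure_submodule R P (f ` carrier Q)"
    unfolding pure_submodule_def
  proof (intro conjI allI impI)
    show "submodule (f ` carrier Q) R P" by (rule f.image_submodule)
    fix m n :: nat and A c
    assume A: "\<forall>i<m. \<forall>j<n. A i j \<in> carrier R" and c: "\<forall>i<m. c i \<in> f ` carrier Q"
      and "\<exists>x. (\<forall>j<n. x j \<in> carrier P) \<and> (\<forall>i<m. (\<Oplus>\<^bsub>P\<^esub>j\<in>{..<n}. A i j \<odot>\<^bsub>P\<^esub> x j) = c i)"
    then obtain x where x: "\<And>j. j < n \<Longrightarrow> x j \<in> carrier P"
      "\<And>i. i < m \<Longrightarrow> (\<Oplus>\<^bsub>P\<^esub>j\<in>{..<n}. A i j \<odot>\<^bsub>P\<^esub> x j) = c i" by blast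
    from c have "\<forall>i<m. \<exists>q. q \<in> carrier Q \<and> c i = f q" by blast
    then obtain q where q: "\<And>i. i < m \<Longrightarrow> q i \<in> carrier Q" "\<And>i. i < m \<Longrightarrow> c i = f (q i)" by metis
    obtain k where k: "k \<in> mod_hom R Q Q" "\<And>y. y \<in> q ` {..<m} \<Longrightarrow> k (g (f y)) = y"
      by (rule local_retraction[of "q ` {..<m}"]) (use q in auto)
    let ?b = "\<lambda>x. f (k (g x))"
    interpret b: module_hom R P P ?b
      using mod_hom_comp[OF mod_hom_comp[OF g k(1)] f] by (rule endI)
    have "(\<Oplus>\<^bsub>P\<^esub>j\<in>{..<n}. A i j \<odot>\<^bsub>P\<^esub> ?b (x j)) = c i" if i: "i < m" for i
    proof -
      have "(\<Oplus>\<^bsub>P\<^esub>j\<in>{..<n}. A i j \<odot>\<^bsub>P\<^esub> ?b (x j)) = (\<Oplus>\<^bsub>P\<^esub>j\<in>{..<n}. ?b (A i j \<odot>\<^bsub>P\<^esub> x j))"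
        using A i x(1) b.smult b.closed P.smult_closed by (intro P.M.finsum_cong') auto
      also have "\<dots> = ?b (\<Oplus>\<^bsub>P\<^esub>j\<in>{..<n}. A i j \<odot>\<^bsub>P\<^esub> x j)"
        using A i x(1) P.smult_closed by (intro b.finsum[symmetric]) auto
      also have "\<dots> = c i" using x(2)[OF i] q i k(2) by simp
      finally show ?thesis .
    qed
    moreover have "?b (x j) \<in> f ` carrier Q" if "j < n" for j
      using that x(1) g.closed mod_homD(1)[OF k(1)] by auto
    ultimately show "\<exists>y. (\<forall>j<n. y j \<in> f ` carrier Q) \<and>
      (\<forall>i<m. (\<Oplus>\<^bsub>P\<^esub>j\<in>{..<n}. A i j \<odot>\<^bsub>P\<^esub> y j) = c i)"
      by (intro exI[of _ "\<lambda>j. ?b (x j)"]) blast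
  qed
qed

text \<open>Take b = fkg with \<open>k\<close> a left inverse of gf on a suitable finite set. The
  freedom in \<open>S\<close> lets \<open>b\<close> fix additional prescribed elements of the image
  of \<open>f\<close>.\<close>

lemma local_identity:
  assumes S: "finite S" "S \<subseteq> carrier Q"
  obtains b where "b \<in> mod_hom R P P" "\<And>x. x \<in> carrier P \<Longrightarrow> mcong R I P (b x) (e x)"
    "\<And>q. q \<in> S \<Longrightarrow> b (f q) = f q" "\<And>x. x \<in> carrier P \<Longrightarrow> b (f (g x)) = f (g x)"
proof -
  \<comment> \<open>Adding the images of the generators makes kgfg = g hold on all of
    \<open>P\<close>, and hence bfg = fg.\<close>
  let ?S = "S \<union> (\<lambda>i. g (p i)) ` K"
  obtain k where k: "k \<in> mod_hom R Q Q" "\<And>q. q \<in> ?S \<Longrightarrow> k (g (f q)) = q"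
    by (rule local_retraction[of ?S]) (use S fin db_D(2) g.closed in auto)
  interpret k: module_hom R Q Q k using Q_mod Q_mod k(1) by (rule module_homI)
  have "module_hom R P Q (\<lambda>x. k (g (f (g x))))"
    using P_mod Q_mod mod_hom_comp[OF mod_hom_comp[OF mod_hom_comp[OF g f] g] k(1)] by (rule module_homI)
  then have kg: "k (g (f (g x))) = g x" if "x \<in> carrier P" for x
    by (rule hom_eqI[OF _ g.module_hom_axioms _ that]) (use k(2) in auto)
  have "mcong R I P (f (k (g x))) (e x)" if x: "x \<in> carrier P" for x
  proof -
    \<comment> \<open>Apply \<open>k\<close> to the congruence between g(x) and g(f(g(x))), and use
      kgfg = g.\<close>
    have "mcong R I Q (k (g x)) (g x)"
      using mcong_hom[OF k.module_hom_axioms mcong_sym[OF Q_mod gf[OF g.closed[OF x]]]] kg[OF x] by simp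
    then show ?thesis
      using mcong_hom[OF f.module_hom_axioms] fg[OF x] mcong_trans[OF P_mod] by blast
  qed
  then show thesis
    using k(2) kg by (intro that[of "\<lambda>x. f (k (g x))"] mod_hom_comp[OF mod_hom_comp[OF g k(1)] f]) auto
qed

lemma half_lifts: "half_lifts R I P e"
proof -
  obtain b where b: "b \<in> mod_hom R P P" "\<And>x. x \<in> carrier P \<Longrightarrow> mcong R I P (b x) (e x)"
    "\<And>x. x \<in> carrier P \<Longrightarrow> b (f (g x)) = f (g x)"
    by (rule local_identity[of "{}"]) auto
  show ?thesis
  proof (rule half_liftsI)
    show "(\<lambda>x. f (g x)) \<in> mod_hom R P P" using g f by (rule mod_hom_comp)
    show "(\<lambda>x. x \<ominus>\<^bsub>P\<^esub> b x) \<in> mod_hom R P P"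
      by (rule mod_hom_minus[OF P_mod P_mod mod_hom_id b(1)])
    fix x assume x: "x \<in> carrier P"
    then show "f (g x) \<ominus>\<^bsub>P\<^esub> b (f (g x)) = \<zero>\<^bsub>P\<^esub>" "mcong R I P (f (g x)) (e x)"
      using b(3) fg f.closed g.closed by (simp_all add: P.M.minus_eq_zero_iff)
    show "mcong R I P (x \<ominus>\<^bsub>P\<^esub> b x) (x \<ominus>\<^bsub>P\<^esub> e x)"
      using x b(2) by (intro mcong_minus[OF P_mod] mcong_refl[OF P_mod])
  qed
qed

text \<open>If \<open>Q\<close> is finitely generated, gf is invertible and yields an idempotent.
  Conversely, an idempotent \<open>d\<close> forces \<open>g\<close> to be onto, so that
  \<open>Q\<close> is an image of the finitely generated \<open>P\<close>.\<close>

lemma fin_gen_iff: "fin_gen R Q \<longleftrightarrow> idem_lifts R I P e"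
proof
  assume fg_Q: "fin_gen R Q"
  obtain B q \<chi> where "dual_basis R Q (B :: 'q set) q \<chi>"
    using dual_basis_of_projective_right[OF proj] .
  then obtain T where T: "finite T" "dual_basis R Q T q \<chi>"
    using finite_dual_basis[OF Q_mod _ fg_Q] by blast
  \<comment> \<open>A genuine inverse of gf; then fwg is idempotent because (fwg)(fwg) = fw(gfw)g =
    fwg.\<close>
  obtain w where w: "w \<in> mod_hom R Q Q" "\<And>y. y \<in> carrier Q \<Longrightarrow> w (g (f y)) = y"
    "\<And>y. y \<in> carrier Q \<Longrightarrow> g (f (w y)) = y" "\<And>y. y \<in> carrier Q \<Longrightarrow> mcong R I Q (w y) y"
    by (rule inverse_of_mcong_id[OF Q_mod T(2,1) mod_hom_comp[OF f g] gf]) (assumption | rule that)+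
  show "idem_lifts R I P e"
    unfolding idem_lifts_def
  proof (intro bexI ballI conjI)
    show "(\<lambda>x. f (w (g x))) \<in> mod_hom R P P" by (rule mod_hom_comp[OF mod_hom_comp[OF g w(1)] f])
    fix x assume x: "x \<in> carrier P"
    show "f (w (g (f (w (g x))))) = f (w (g x))"
      using x g.closed mod_homD(1)[OF w(1)] by (simp add: w(2))
    show "mcong R I P (f (w (g x))) (e x)"
      using mcong_hom[OF f.module_hom_axioms w(4)[OF g.closed[OF x]]] fg[OF x] by (rule mcong_trans[OF P_mod])
  qed
next
  assume "idem_lifts R I P e"
  then obtain d where d: "d \<in> mod_hom R P P" "\<And>x. x \<in> carrier P \<Longrightarrow> d (d x) = d x"
    "\<And>x. x \<in> carrier P \<Longrightarrow> mcong R I P (d x) (e x)" by (auto simp: idem_lifts_def)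
  interpret d: module_hom R P P d using d(1) by (rule endI)
  note tr = mcong_trans[OF P_mod]
  \<comment> \<open>Block diagonal for the decomposition of \<open>P\<close> by \<open>d\<close>:
    the compression dfgd on the image of \<open>d\<close> and the identity on the complement. It is
    congruent to e + (1 - e), hence invertible.\<close>
  let ?v = "\<lambda>x. d (f (g (d x))) \<oplus>\<^bsub>P\<^esub> (x \<ominus>\<^bsub>P\<^esub> d x)"
  have dfg: "(\<lambda>x. d (f (g (d x)))) \<in> mod_hom R P P"
    by (rule mod_hom_comp[OF mod_hom_comp[OF mod_hom_comp[OF d(1) g] f] d(1)])
  have c: "d x \<in> carrier P" "d (f (g (d x))) \<in> carrier P" "f (g (d x)) \<in> carrier P" if "x \<in> carrier P" for x
    using that d.closed f.closed g.closed by auto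
  have v: "?v \<in> mod_hom R P P"
    by (rule mod_hom_add[OF P_mod P_mod dfg mod_hom_minus[OF P_mod P_mod mod_hom_id d(1)]])
  have "mcong R I P (?v x) x" if x: "x \<in> carrier P" for x
  proof -
    have "mcong R I P (d (f (g (d x)))) (e (f (g (d x))))" using c x d(3) by blast
    also have "mcong R I P \<dots> (f (g (d x)))" using x c g.closed ef by blast
    also (tr) have "mcong R I P \<dots> (e (d x))" using c x fg by blast
    also (tr) have "mcong R I P \<dots> (e (e x))" using mcong_hom[OF e.module_hom_axioms d(3)[OF x]] .
    also (tr) have "mcong R I P \<dots> (e x)" using x e_idem by blast
    finally (tr) have "mcong R I P (?v x) (e x \<oplus>\<^bsub>P\<^esub> (x \<ominus>\<^bsub>P\<^esub> e x))"
      using x d(3) by (intro mcong_add[OF P_mod] mcong_minus[OF P_mod] mcong_refl[OF P_mod])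
    then show ?thesis using x by (simp add: e_add_complement)
  qed
  then obtain w where w: "w \<in> mod_hom R P P" "\<And>x. x \<in> carrier P \<Longrightarrow> w (?v x) = x"
    "\<And>x. x \<in> carrier P \<Longrightarrow> ?v (w x) = x" "\<And>x. x \<in> carrier P \<Longrightarrow> mcong R I P (w x) x"
    by (rule inverse_of_mcong_id[OF P_mod db fin v]) (assumption | rule that)+
  have dv: "d (?v x) = d (f (g (d x)))" if x: "x \<in> carrier P" for x
  proof -
    have "d (?v x) = d (f (g (d x))) \<oplus>\<^bsub>P\<^esub> (d x \<ominus>\<^bsub>P\<^esub> d x)"
      using x c by (simp add: d.add d.minus d(2))
    then show ?thesis using x c by (simp add: a_minus_def P.M.r_neg)
  qed
  \<comment> \<open>gdf is congruent to the identity of \<open>Q\<close> and therefore injective,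
    even though \<open>Q\<close> is not yet known to be finitely generated; consequently df is
    injective.\<close>
  have "inj_on (\<lambda>q. g (d (f q))) (carrier Q)"
  proof (rule inj_of_mcong)
    show "(\<lambda>q. g (d (f q))) \<in> mod_hom R Q Q" by (rule mod_hom_comp[OF mod_hom_comp[OF f d(1)] g])
    fix q assume q: "q \<in> carrier Q"
    have "mcong R I P (d (f q)) (f q)" using tr[OF d(3) ef] q f.closed by blast
    then show "mcong R I Q (g (d (f q))) q"
      using mcong_hom[OF g.module_hom_axioms] gf[OF q] mcong_trans[OF Q_mod] by blast
  qed
  then have inj: "q = q'" if "q \<in> carrier Q" "q' \<in> carrier Q" "d (f q) = d (f q')" for q q'
    using that by (auto simp: inj_on_def)
  have "q \<in> g ` carrier P" if q: "q \<in> carrier Q" for q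
  proof -
    have wq: "w (f q) \<in> carrier P" using q f.closed mod_homD(1)[OF w(1)] by blast
    \<comment> \<open>Writing f(q) = v(w(f q)) and using dv = dfgd places d(f q) in the image of
      dfg; cancelling df exhibits q as a value of \<open>g\<close>.\<close>
    have "d (f q) = d (f (g (d (w (f q)))))" using dv[OF wq] w(3)[OF f.closed[OF q]] by simp
    then have "q = g (d (w (f q)))" using q wq c g.closed by (intro inj) auto
    then show ?thesis using wq c by blast
  qed
  then have "g ` carrier P = carrier Q" using g.closed by auto
  then show "fin_gen R Q"
    using fin_gen_image[OF g.module_hom_axioms fin_gen_of_dual_basis[OF P_mod db fin]] by blast
qed

end

context mod_idempotent
begin

text \<open>Both \<open>Q\<close> and \<open>P\<close> are projective and map onto \<open>X\<close>,
  so each map lifts through the other.\<close>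

lemma lift_pair_of_lift:
  assumes X: "right_module (R Quot I) X" and \<pi>: "represents R I P e X \<pi>" and lift: "right_lift R I X Q"
  obtains f g where "lift_pair R I P K p \<phi> e Q f g"
proof -
  from lift obtain \<rho> where proj: "projective_right R Q" and \<rho>: "represents R I Q (\<lambda>x. x) X \<rho>"
    by (auto simp: right_lift_iff[OF X])
  then have Q: "right_module R Q" by (simp add: projective_right_def)
  interpret Q: right_module R Q by fact
  obtain B q \<chi> where dbQ: "dual_basis R Q (B :: 'e set) q \<chi>"
    using dual_basis_of_projective_right[OF proj] .
  note resX = right_module_res[OF X]
  obtain f1 where f1: "f1 \<in> mod_hom R Q P" "\<And>x. x \<in> carrier Q \<Longrightarrow> \<pi> (f1 x) = \<rho> x"
    using projective_lifting[OF Q P_mod resX dbQ, of \<rho> \<pi>] \<rho> \<pi> by (auto simp: represents_def)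
  obtain g where g: "g \<in> mod_hom R P Q" "\<And>x. x \<in> carrier P \<Longrightarrow> \<rho> (g x) = \<pi> x"
    using projective_lifting[OF P_mod Q resX db, of \<pi> \<rho>] \<rho> \<pi> by (auto simp: represents_def)
  have idQ: "module_hom R Q Q (\<lambda>x. x)" using Q Q mod_hom_id by (rule module_homI)
  note eqP = represents_eq_iff[OF P_mod X e.module_hom_axioms \<pi>]
  note eqQ = represents_eq_iff[OF Q X idQ \<rho>]
  note c = mod_homD(1)[OF f1(1)] mod_homD(1)[OF g(1)] e.closed
  have \<pi>e: "\<pi> (e x) = \<pi> x" if "x \<in> carrier P" for x
    using that e_idem eqP c by simp
  show thesis
  proof (rule that, intro lift_pair.intro lift_pair_axioms.intro mod_idempotent_axioms Q proj)
    \<comment> \<open>\<open>\<pi>\<close> sees an element only through \<open>e\<close>, so the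
      lift \<open>f1\<close> is undetermined on the other summand. Composing with \<open>e\<close>
      removes this ambiguity and leaves its image in \<open>X\<close> unchanged.\<close>
    show "(\<lambda>x. e (f1 x)) \<in> mod_hom R Q P" using f1(1) e by (rule mod_hom_comp)
    show "g \<in> mod_hom R P Q" by fact
    show "mcong R I Q (g (e (f1 q))) q" if "q \<in> carrier Q" for q
      using that c by (subst eqQ[symmetric]) (simp_all add: g(2) \<pi>e f1(2))
    show "mcong R I P (e (f1 (g x))) (e x)" if "x \<in> carrier P" for x
      using that c by (subst eqP[symmetric]) (simp_all add: g(2) f1(2))
    show "mcong R I P (e (e (f1 q))) (e (f1 q))" if "q \<in> carrier Q" for q
      using that c e_idem by simp
  qed
qed

text \<open>The images of the maps lifting the two complementary summands are independent, since
  on a common element \<open>\<delta>\<close> suitable lifts \<open>b\<close> of \<open>e\<close> and \<open>b'\<close> of \<open>1 - e\<close> are both the identity,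
  and $1 - (b + b' - 1)$ is invertible.\<close>

lemma idem_lifts_of_two_lifts:
  assumes "lift_pair R I P K p \<phi> e Q f g" "lift_pair R I P K p \<phi> (\<lambda>x. x \<ominus>\<^bsub>P\<^esub> e x) Q' f' g'"
  shows "idem_lifts R I P e"
proof -
  interpret L: lift_pair R I P K p \<phi> e Q f g by fact
  interpret L': lift_pair R I P K p \<phi> "\<lambda>x. x \<ominus>\<^bsub>P\<^esub> e x" Q' f' g' by fact
  have one: "mcong R I P (b x \<oplus>\<^bsub>P\<^esub> b' x) x"
    if "x \<in> carrier P" "mcong R I P (b x) (e x)" "mcong R I P (b' x) (x \<ominus>\<^bsub>P\<^esub> e x)" for x b b'
    using mcong_add[OF P_mod that(2,3)] that(1) by (simp add: e_add_complement)
  have indep: "f q = \<zero>\<^bsub>P\<^esub>" if q: "q \<in> carrier Q" "q' \<in> carrier Q'" "f q = f' q'" for q q'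
  proof -
    obtain b where b: "b \<in> mod_hom R P P" "\<And>x. x \<in> carrier P \<Longrightarrow> mcong R I P (b x) (e x)" "b (f q) = f q"
      by (rule L.local_identity[of "{q}"]) (use q in auto)
    obtain b' where b': "b' \<in> mod_hom R P P"
      "\<And>x. x \<in> carrier P \<Longrightarrow> mcong R I P (b' x) (x \<ominus>\<^bsub>P\<^esub> e x)" "b' (f' q') = f' q'"
      by (rule L'.local_identity[of "{q'}"]) (use q(2) in auto)
    \<comment> \<open>This is 2 - b - b'. It is congruent to the identity, so injective, and it
      kills any element fixed by both \<open>b\<close> and \<open>b'\<close>.\<close>
    let ?\<nu> = "\<lambda>x. x \<ominus>\<^bsub>P\<^esub> ((b x \<oplus>\<^bsub>P\<^esub> b' x) \<ominus>\<^bsub>P\<^esub> x)"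
    have \<nu>: "?\<nu> \<in> mod_hom R P P"
      by (rule mod_hom_minus[OF P_mod P_mod mod_hom_id mod_hom_minus[OF P_mod P_mod
            mod_hom_add[OF P_mod P_mod b(1) b'(1)] mod_hom_id]])
    have "mcong R I P (?\<nu> x) x" if x: "x \<in> carrier P" for x
    proof -
      have "mcong R I P (?\<nu> x) (x \<ominus>\<^bsub>P\<^esub> (x \<ominus>\<^bsub>P\<^esub> x))"
        using x one b(2) b'(2) by (intro mcong_minus[OF P_mod] mcong_refl[OF P_mod]) auto
      then show ?thesis using x by (simp add: P.M.minus_minus_cancel)
    qed
    then have inj: "inj_on ?\<nu> (carrier P)" using \<nu> by (intro inj_on_of_mcong_id[OF P_mod db])
    have c: "f q \<in> carrier P" using q(1) by (rule L.f.closed)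
    have "?\<nu> (f q) = \<zero>\<^bsub>P\<^esub>"
      using c b(3) b'(3) q(3) by (simp add: a_minus_def P.M.a_assoc P.M.r_neg)
    moreover have "?\<nu> \<zero>\<^bsub>P\<^esub> = \<zero>\<^bsub>P\<^esub>"
      using module_hom.zero[OF endI[OF \<nu>]] .
    ultimately show ?thesis using inj c unfolding inj_on_def by (metis P.M.zero_closed)
  qed
  \<comment> \<open>Congruent to e + (1 - e), hence invertible: \<open>P\<close> is the sum of the
    images of \<open>f\<close> and \<open>f'\<close>.\<close>
  let ?w = "\<lambda>x. f (g x) \<oplus>\<^bsub>P\<^esub> f' (g' x)"
  have w: "?w \<in> mod_hom R P P"
    by (rule mod_hom_add[OF P_mod P_mod mod_hom_comp[OF L.g L.f] mod_hom_comp[OF L'.g L'.f]])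
  have "mcong R I P (?w x) x" if "x \<in> carrier P" for x
    using that L.fg L'.fg by (intro one)
  then obtain z where z: "z \<in> mod_hom R P P" "\<And>x. x \<in> carrier P \<Longrightarrow> z (?w x) = x"
    "\<And>x. x \<in> carrier P \<Longrightarrow> ?w (z x) = x" "\<And>x. x \<in> carrier P \<Longrightarrow> mcong R I P (z x) x"
    by (rule inverse_of_mcong_id[OF P_mod db fin w]) (assumption | rule that)+
  note zc = mod_homD(1)[OF z(1)]
  \<comment> \<open>f(q) and its decomposition through w(z(f q)) differ by an element of both
    images, which is zero by \<open>indep\<close>. So fgz is the projection onto the image of
    \<open>f\<close>.\<close>
  have fix_f: "f (g (z (f q))) = f q" if q: "q \<in> carrier Q" for q
  proof -
    have c: "f q \<in> carrier P" "z (f q) \<in> carrier P" "g (z (f q)) \<in> carrier Q"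
      "f (g (z (f q))) \<in> carrier P" "g' (z (f q)) \<in> carrier Q'" "f' (g' (z (f q))) \<in> carrier P"
      using q zc L.f.closed L.g.closed L'.f.closed L'.g.closed by auto
    have eq: "f q = f (g (z (f q))) \<oplus>\<^bsub>P\<^esub> f' (g' (z (f q)))" using z(3)[OF c(1)] by simp
    have "f (q \<ominus>\<^bsub>Q\<^esub> g (z (f q))) = f q \<ominus>\<^bsub>P\<^esub> f (g (z (f q)))"
      using q c by (simp add: L.f.minus)
    also have "\<dots> = f' (g' (z (f q))) \<ominus>\<^bsub>P\<^esub> \<zero>\<^bsub>P\<^esub>"
      using eq c by (intro P.M.add_eq_add_imp_minus_eq) simp_all
    also have "\<dots> = f' (g' (z (f q)))" using c by (simp add: a_minus_def P.M.uminus_zero)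
    finally have "f (q \<ominus>\<^bsub>Q\<^esub> g (z (f q))) = \<zero>\<^bsub>P\<^esub>"
      using indep[of "q \<ominus>\<^bsub>Q\<^esub> g (z (f q))" "g' (z (f q))"] q c by simp
    then show ?thesis using q c by (simp add: L.f.minus P.M.minus_eq_zero_iff)
  qed
  show ?thesis
    unfolding idem_lifts_def
  proof (intro bexI ballI conjI)
    show "(\<lambda>x. f (g (z x))) \<in> mod_hom R P P"
      by (rule mod_hom_comp[OF mod_hom_comp[OF z(1) L.g] L.f])
    fix x assume x: "x \<in> carrier P"
    show "f (g (z (f (g (z x))))) = f (g (z x))" using x zc L.g.closed by (intro fix_f) auto
    show "mcong R I P (f (g (z x))) (e x)"
      using mcong_trans[OF P_mod L.fg[OF zc[OF x]] mcong_hom[OF e.module_hom_axioms z(4)[OF x]]] .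
  qed
qed

lemma idem_lifts_complement:
  assumes "idem_lifts R I P e" shows "idem_lifts R I P (\<lambda>x. x \<ominus>\<^bsub>P\<^esub> e x)"
proof -
  from assms obtain d where d: "d \<in> mod_hom R P P" "\<And>x. x \<in> carrier P \<Longrightarrow> d (d x) = d x"
    "\<And>x. x \<in> carrier P \<Longrightarrow> mcong R I P (d x) (e x)" by (auto simp: idem_lifts_def)
  interpret d: module_hom R P P d using d(1) by (rule endI)
  show ?thesis unfolding idem_lifts_def
  proof (intro bexI ballI conjI)
    show "(\<lambda>x. x \<ominus>\<^bsub>P\<^esub> d x) \<in> mod_hom R P P"
      by (rule mod_hom_minus[OF P_mod P_mod mod_hom_id d(1)])
    fix x assume x: "x \<in> carrier P"
    show "x \<ominus>\<^bsub>P\<^esub> d x \<ominus>\<^bsub>P\<^esub> d (x \<ominus>\<^bsub>P\<^esub> d x) = x \<ominus>\<^bsub>P\<^esub> d x"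
      using x d.closed by (simp add: d.minus d(2)) (simp add: a_minus_def P.M.r_neg P.M.uminus_zero)
    show "mcong R I P (x \<ominus>\<^bsub>P\<^esub> d x) (x \<ominus>\<^bsub>P\<^esub> e x)"
      using x d(3) by (intro mcong_minus[OF P_mod] mcong_refl[OF P_mod])
  qed
qed

lemma half_lifts_of_idem_lifts:
  assumes "idem_lifts R I P e" shows "half_lifts R I P e"
proof -
  from assms obtain d where d: "d \<in> mod_hom R P P" "\<And>x. x \<in> carrier P \<Longrightarrow> d (d x) = d x"
    "\<And>x. x \<in> carrier P \<Longrightarrow> mcong R I P (d x) (e x)" by (auto simp: idem_lifts_def)
  show ?thesis
  proof (rule half_liftsI)
    show "d \<in> mod_hom R P P" by fact
    show "(\<lambda>x. x \<ominus>\<^bsub>P\<^esub> d x) \<in> mod_hom R P P"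
      by (rule mod_hom_minus[OF P_mod P_mod mod_hom_id d(1)])
    fix x assume x: "x \<in> carrier P"
    then show "d x \<ominus>\<^bsub>P\<^esub> d (d x) = \<zero>\<^bsub>P\<^esub>" "mcong R I P (d x) (e x)"
      using d mod_homD(1)[OF d(1)] by (simp_all add: P.M.minus_eq_zero_iff)
    show "mcong R I P (x \<ominus>\<^bsub>P\<^esub> d x) (x \<ominus>\<^bsub>P\<^esub> e x)"
      using x d(3) by (intro mcong_minus[OF P_mod] mcong_refl[OF P_mod])
  qed
qed

text \<open>Sakhajev's construction: if $ca = 0$ and \<open>u = a + c\<close> is invertible with inverse \<open>w\<close>, then
  $a_n = w^{n+1} a u^n$ satisfies $a_{n+1} a_n = a_n$. The lift is the union of the images of the
  $a_n$; it is projective because $x = \sum_n a_n (x - a_{n-1} x)$ there, with $a_{-1} = 0$.\<close>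

lemma lift_of_half_lifts:
  assumes X: "right_module (R Quot I) X" and \<pi>: "represents R I P e X \<pi>" and half: "half_lifts R I P e"
  shows "\<exists>Q :: ('a, nat \<Rightarrow> 'a) module. right_lift R I X Q \<and> countably_gen R Q"
proof -
  note tr = mcong_trans[OF P_mod]
  from half obtain a c where a: "a \<in> mod_hom R P P" and c: "c \<in> mod_hom R P P"
    and ca: "\<And>x. x \<in> carrier P \<Longrightarrow> c (a x) = \<zero>\<^bsub>P\<^esub>"
    and ae: "\<And>x. x \<in> carrier P \<Longrightarrow> mcong R I P (a x) (e x)"
    and ce: "\<And>x. x \<in> carrier P \<Longrightarrow> mcong R I P (c x) (x \<ominus>\<^bsub>P\<^esub> e x)"
    unfolding half_lifts_def by blast
  \<comment> \<open>Congruent to e + (1 - e), hence invertible on the finitely generated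
    \<open>P\<close>.\<close>
  define u where "u x = a x \<oplus>\<^bsub>P\<^esub> c x" for x
  have u: "u \<in> mod_hom R P P" unfolding u_def[abs_def] by (rule mod_hom_add[OF P_mod P_mod a c])
  have u1: "mcong R I P (u x) x" if "x \<in> carrier P" for x
    using mcong_add[OF P_mod ae ce] that unfolding u_def by (metis e_add_complement)
  obtain w where w: "w \<in> mod_hom R P P" "\<And>x. x \<in> carrier P \<Longrightarrow> w (u x) = x"
    "\<And>x. x \<in> carrier P \<Longrightarrow> u (w x) = x" "\<And>x. x \<in> carrier P \<Longrightarrow> mcong R I P (w x) x"
    by (rule inverse_of_mcong_id[OF P_mod db fin u u1]) (assumption | rule that)+
  note un = mod_hom_funpow[OF u] and wn = mod_hom_funpow[OF w(1)]
  note uc = mod_homD(1)[OF un] and wc = mod_homD(1)[OF wn] and ac = mod_homD(1)[OF a]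
  have pow1: "mcong R I P ((v ^^ n) x) x"
    if v: "v \<in> mod_hom R P P" "\<And>x. x \<in> carrier P \<Longrightarrow> mcong R I P (v x) x" and x: "x \<in> carrier P" for v n x
  proof (induction n)
    case 0
    show ?case using mcong_refl[OF P_mod x] by simp
  next
    case (Suc n)
    show ?case using tr[OF v(2)[OF mod_homD(1)[OF mod_hom_funpow[OF v(1)] x]] Suc] by simp
  qed
  have uw: "(u ^^ n) ((w ^^ n) x) = x" if x: "x \<in> carrier P" for n x
    using x
  proof (induction n arbitrary: x)
    case (Suc n)
    have "(u ^^ Suc n) ((w ^^ Suc n) x) = (u ^^ n) (u (w ((w ^^ n) x)))"
      unfolding funpow_Suc_right[of n u] by simp
    then show ?case using Suc wc w(3) by simp
  qed simp
  define A where "A n x = (w ^^ Suc n) (a ((u ^^ n) x))" for n x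
  have A: "A n \<in> mod_hom R P P" for n
    unfolding A_def[abs_def] by (rule mod_hom_comp[OF mod_hom_comp[OF un a] wn])
  note Ac = mod_homD(1)[OF A]
  have Ae: "mcong R I P (A n x) (e x)" if x: "x \<in> carrier P" for n x
  proof -
    have "mcong R I P (A n x) (a ((u ^^ n) x))"
      unfolding A_def using x uc ac by (intro pow1[OF w(1,4)]) auto
    also have "mcong R I P \<dots> (e ((u ^^ n) x))" using x uc ae by blast
    also (tr) have "mcong R I P \<dots> (e x)"
      by (rule mcong_hom[OF e.module_hom_axioms pow1[OF u u1 x]])
    finally (tr) show ?thesis .
  qed
  have step: "A (Suc n) (A n x) = A n x" if x: "x \<in> carrier P" for n x
  proof -
    let ?y = "(u ^^ n) x"
    have y: "?y \<in> carrier P" "a ?y \<in> carrier P" "a (a ?y) \<in> carrier P" using x uc ac by auto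
    \<comment> \<open>The one use of ca = 0: it gives aa = ua, so the surplus factor u cancels
      against one power of w.\<close>
    have "a (a ?y) = u (a ?y)" using y ca[OF y(1)] by (simp add: u_def)
    then have "A (Suc n) (A n x) = (w ^^ Suc (Suc n)) (u (a ?y))"
      unfolding A_def using y uw[of "a ?y" "Suc n"] by simp
    also have "\<dots> = (w ^^ Suc n) (w (u (a ?y)))" unfolding funpow_Suc_right[of "Suc n" w] by simp
    finally show ?thesis using y w(2) by (simp add: A_def)
  qed
  have stable: "A m x = x" if x: "x \<in> carrier P" "A n x = x" "n \<le> m" for n m x
    using x(3)
  proof (induction m rule: dec_induct)
    case (step m)
    then show ?case using \<open>\<And>x n. x \<in> carrier P \<Longrightarrow> A (Suc n) (A n x) = A n x\<close>[OF x(1), of m] by simp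
  qed (fact x(2))
  \<comment> \<open>Union of the images, described by fixed points: values of \<open>A n\<close> are
    fixed by \<open>A (Suc n)\<close>. In this form \<open>stable\<close> shows that the union is
    increasing, and so a submodule.\<close>
  define N where "N = {x \<in> carrier P. \<exists>n. A n x = x}"
  have AN: "A n x \<in> N" if "x \<in> carrier P" for n x
    using that step Ac by (auto simp: N_def)
  interpret A: module_hom R P P "A n" for n using A by (rule endI)
  have N: "submodule N R P"
  proof (rule P.submodule_intro)
    show "\<zero>\<^bsub>P\<^esub> \<in> N" using A.zero by (auto simp: N_def)
    show "x \<oplus>\<^bsub>P\<^esub> y \<in> N" if "x \<in> N" "y \<in> N" for x y
    proof -
      from that obtain n m where "A n x = x" "A m y = y" and xy: "x \<in> carrier P" "y \<in> carrier P"
        by (auto simp: N_def)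
      then have "A (max n m) x = x" "A (max n m) y = y"
        using stable[of x n "max n m"] stable[of y m "max n m"] by auto
      then show ?thesis using xy A.add[of x y "max n m"] by (auto simp: N_def)
    qed
    show "r \<odot>\<^bsub>P\<^esub> x \<in> N" if "r \<in> carrier R" "x \<in> N" for r x
      using that P.smult_closed by (auto simp: N_def) (metis A.smult)
  qed (auto simp: N_def)
  let ?Q = "P\<lparr>carrier := N\<rparr>"
  have Q: "right_module R ?Q" by (rule P.right_module_submodule[OF N])
  interpret Q: right_module R ?Q by fact
  have NP: "N \<subseteq> carrier P" by (auto simp: N_def)
  note incl = mod_hom_incl[OF NP]
  interpret incl: module_hom R ?Q P "\<lambda>x. x" using Q P_mod incl by (rule module_homI)
  \<comment> \<open>The factor x - A_(n-1) x; the case 0 encodes A_(-1) = 0.\<close>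
  define s where "s n x = (case n of 0 \<Rightarrow> x | Suc m \<Rightarrow> x \<ominus>\<^bsub>P\<^esub> A m x)" for n x
  have s: "s n \<in> mod_hom R P P" for n
    unfolding s_def[abs_def]
    using mod_hom_id mod_hom_minus[OF P_mod P_mod mod_hom_id A] by (cases n) auto
  interpret s: module_hom R P P "s n" for n using s by (rule endI)
  \<comment> \<open>Each summand A_n(s_n x) is expanded by the dual basis of \<open>P\<close>, which
    leads to the countable index set of pairs (n, i).\<close>
  define \<chi> where "\<chi> = (\<lambda>(n, i) x. \<phi> i (s n x))"
  define q where "q = (\<lambda>(n :: nat, i). A n (p i))"
  note \<phi> = fin_familyD[OF db_D(1)]
  \<comment> \<open>Once \<open>A n\<close> fixes \<open>x\<close>, all later \<open>A m\<close> do,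
    so the corresponding \<open>s (Suc m) x\<close> vanish. This yields finite support.\<close>
  have \<chi>0: "\<chi> b x = \<zero>" if x: "x \<in> carrier P" "A n x = x" and b: "b \<in> UNIV \<times> K - {..n} \<times> K" for n x b
  proof -
    obtain m i where b': "b = (Suc m, i)" "i \<in> K" "n \<le> m" using b by (cases b; cases "fst b") auto
    then have "s (Suc m) x = \<zero>\<^bsub>P\<^esub>" using stable[OF x b'(3)] x by (simp add: s_def P.M.minus_eq_zero_iff)
    moreover have "\<phi> i \<zero>\<^bsub>P\<^esub> = \<zero>"
      using module_hom.zero[OF module_homI[OF P_mod right_module_right_regular[OF R.ring_axioms] \<phi>(1)]] b' by simp
    ultimately show ?thesis using b' by (simp add: \<chi>_def)
  qed
  have famQ: "fin_family R ?Q (UNIV \<times> K) \<chi>"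
    unfolding fin_family_def
  proof (intro conjI ballI)
    show "\<chi> b \<in> mod_hom R ?Q (right_regular R)" if "b \<in> UNIV \<times> K" for b
      using that mod_hom_comp[OF mod_hom_comp[OF incl s] \<phi>(1)] by (auto simp: \<chi>_def)
    fix x assume "x \<in> carrier ?Q"
    then obtain n where x: "x \<in> carrier P" "A n x = x" by (auto simp: N_def)
    have "{b \<in> UNIV \<times> K. \<chi> b x \<noteq> \<zero>} \<subseteq> {..n} \<times> K" using \<chi>0[OF x] by blast
    then show "finite {b \<in> UNIV \<times> K. \<chi> b x \<noteq> \<zero>}" by (rule finite_subset) (use fin in simp)
  qed
  have qQ: "q b \<in> carrier ?Q" if "b \<in> UNIV \<times> K" for b
    using that AN db_D(2) by (auto simp: q_def)
  have \<chi>R: "\<chi> b x \<in> carrier R" if "b \<in> UNIV \<times> K" "x \<in> carrier P" for b x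
    using that \<phi>(3) s.closed by (auto simp: \<chi>_def)
  have term_closed: "\<chi> b x \<odot>\<^bsub>P\<^esub> q b \<in> carrier P" if "b \<in> UNIV \<times> K" "x \<in> carrier P" for b x
    using that \<chi>R qQ NP by (intro P.smult_closed) auto
  have row: "(\<Oplus>\<^bsub>P\<^esub>b\<in>{n} \<times> K. \<chi> b x \<odot>\<^bsub>P\<^esub> q b) = A n (s n x)" if x: "x \<in> carrier P" for n x
  proof -
    have sx: "s n x \<in> carrier P" using x s.closed by simp
    have K_eq: "{n} \<times> K = Pair n ` K" by auto
    have "(\<Oplus>\<^bsub>P\<^esub>b\<in>{n} \<times> K. \<chi> b x \<odot>\<^bsub>P\<^esub> q b) = (\<Oplus>\<^bsub>P\<^esub>i\<in>K. \<chi> (n, i) x \<odot>\<^bsub>P\<^esub> q (n, i))"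
      unfolding K_eq by (rule P.M.finsum_reindex) (use x term_closed in \<open>auto simp: inj_on_def\<close>)
    also have "\<dots> = (\<Oplus>\<^bsub>P\<^esub>i\<in>K. \<phi> i (s n x) \<odot>\<^bsub>P\<^esub> A n (p i))" by (simp add: \<chi>_def q_def)
    also have "\<dots> = family_comb R P K \<phi> (\<lambda>i. A n (p i)) (s n x)"
      by (rule family_comb_superset[OF P_mod fin subset_refl, symmetric]) (use \<phi>(3) sx A.closed db_D(2) in auto)
    also have "\<dots> = A n (family_comb R P K \<phi> p (s n x))"
      by (rule hom_family_comb[OF A.module_hom_axioms db_D(1) db_D(2) sx, symmetric])
    finally show ?thesis using db_D(3)[OF sx] by simp
  qed
  have telescope: "(\<Oplus>\<^bsub>P\<^esub>b\<in>{..n} \<times> K. \<chi> b x \<odot>\<^bsub>P\<^esub> q b) = A n x" if x: "x \<in> carrier P" for n x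
  proof (induction n)
    case 0
    have "{..0 :: nat} = {0}" by auto
    then show ?case using row[OF x, of 0] by (simp add: s_def)
  next
    case (Suc n)
    have "{..Suc n} \<times> K = {..n} \<times> K \<union> {Suc n} \<times> K" by auto
    then have "(\<Oplus>\<^bsub>P\<^esub>b\<in>{..Suc n} \<times> K. \<chi> b x \<odot>\<^bsub>P\<^esub> q b)
      = (\<Oplus>\<^bsub>P\<^esub>b\<in>{..n} \<times> K. \<chi> b x \<odot>\<^bsub>P\<^esub> q b) \<oplus>\<^bsub>P\<^esub> (\<Oplus>\<^bsub>P\<^esub>b\<in>{Suc n} \<times> K. \<chi> b x \<odot>\<^bsub>P\<^esub> q b)"
      using fin x term_closed by (simp only:) (intro P.M.finsum_Un_disjoint, auto)
    \<comment> \<open>Telescoping rests on A_(n+1) A_n = A_n.\<close>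
    also have "\<dots> = A n x \<oplus>\<^bsub>P\<^esub> (A (Suc n) x \<ominus>\<^bsub>P\<^esub> A n x)"
      using Suc row[OF x, of "Suc n"] x A.closed step by (simp add: s_def A.minus)
    also have "\<dots> = A (Suc n) x"
      using x A.closed by (simp add: P.M.add_minus_cancel)
    finally show ?case .
  qed
  have combQ: "family_comb R ?Q (UNIV \<times> K) \<chi> q x = x" if xQ: "x \<in> carrier ?Q" for x
  proof -
    obtain n where x: "x \<in> carrier P" "A n x = x" using xQ by (auto simp: N_def)
    have "family_comb R ?Q (UNIV \<times> K) \<chi> q x = family_comb R P (UNIV \<times> K) \<chi> q x"
      by (rule hom_family_comb[OF incl.module_hom_axioms famQ qQ xQ])
    also have "\<dots> = (\<Oplus>\<^bsub>P\<^esub>b\<in>{..n} \<times> K. \<chi> b x \<odot>\<^bsub>P\<^esub> q b)"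
    proof (rule family_comb_superset[OF P_mod])
      show "\<chi> b x \<in> carrier R" "q b \<in> carrier P" if "b \<in> {..n} \<times> K" for b
        using that \<chi>R[of b x] qQ[of b] x NP by auto
    qed (use fin \<chi>0[OF x] in auto)
    finally show ?thesis using telescope[OF x(1)] x(2) by simp
  qed
  have dbQ: "dual_basis R ?Q (UNIV \<times> K) q \<chi>"
    using famQ qQ combQ by (simp add: dual_basis_def)
  have repQ: "represents R I ?Q (\<lambda>x. x) X \<pi>"
    unfolding represents_def
  proof (intro conjI ballI)
    have \<pi>h: "\<pi> \<in> mod_hom R P (res R I X)" using \<pi> by (simp add: represents_def)
    show "\<pi> \<in> mod_hom R ?Q (res R I X)" using mod_hom_comp[OF incl \<pi>h] .
    \<comment> \<open>Restricting to \<open>N\<close> loses nothing of \<open>X\<close>: A_0 x is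
      congruent to e(x), and \<open>\<pi>\<close> depends on \<open>e\<close> of its argument
      only.\<close>
    have \<pi>A: "\<pi> (A 0 x) = \<pi> x" if x: "x \<in> carrier P" for x
    proof -
      have "mcong R I P (e (A 0 x)) (e x)"
        using tr[OF mcong_hom[OF e.module_hom_axioms Ae[OF x]] e_idem[OF x]] .
      then show ?thesis
        using represents_eq_iff[OF P_mod X e.module_hom_axioms \<pi>] x A.closed by simp
    qed
    have "\<pi> x \<in> \<pi> ` N" if "x \<in> carrier P" for x
      using imageI[OF AN[OF that, of 0], of \<pi>] \<pi>A[OF that] by simp
    then have "\<pi> ` N = \<pi> ` carrier P" using NP by blast
    then show "\<pi> ` carrier ?Q = carrier X" using \<pi> by (simp add: represents_def)
    fix x assume xQ: "x \<in> carrier ?Q"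
    then obtain n where x: "x \<in> carrier P" "A n x = x" by (auto simp: N_def)
    have "\<pi> x = \<zero>\<^bsub>X\<^esub> \<longleftrightarrow> e x \<in> ideal_mult R I P" using \<pi> x by (simp add: represents_def)
    also have "\<dots> \<longleftrightarrow> x \<in> ideal_mult R I P"
      using mcong_ideal_mult[OF P_mod Ae[OF x(1), of n]] x(2) by simp
    also have "\<dots> \<longleftrightarrow> x \<in> ideal_mult R I ?Q"
    proof
      \<comment> \<open>\<open>N\<close> meets PI only in NI, because \<open>A n\<close> maps
        \<open>P\<close> into \<open>N\<close> and fixes \<open>x\<close>.\<close>
      have "A n \<in> mod_hom R P ?Q" by (rule mod_homI) (auto simp: AN A.add A.smult)
      then show "x \<in> ideal_mult R I P \<Longrightarrow> x \<in> ideal_mult R I ?Q"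
        using hom_ideal_mult[OF module_homI[OF P_mod Q]] x(2) by metis
    qed (rule hom_ideal_mult[OF incl.module_hom_axioms])
    finally show "\<pi> x = \<zero>\<^bsub>X\<^esub> \<longleftrightarrow> x \<in> ideal_mult R I ?Q" .
  qed
  show ?thesis
    by (rule right_lift_nat_of_dual_basis[OF X Q dbQ _ repQ]) (use fin in \<open>simp add: countable_finite\<close>)
qed

end

section \<open>The opposite ring\<close>

text \<open>Module records have one scalar multiplication for both sides, so a left
  \<open>R\<close>-module is, as the same record, a right module over \<open>opp R\<close>.\<close>

definition opp :: "('a, 'r) ring_scheme \<Rightarrow> 'a ring"
  where "opp R = \<lparr>carrier = carrier R, mult = (\<lambda>x y. y \<otimes>\<^bsub>R\<^esub> x), one = \<one>\<^bsub>R\<^esub>, zero = \<zero>\<^bsub>R\<^esub>, add = add R\<rparr>"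

lemma opp_simps [simp]:
  "carrier (opp R) = carrier R" "x \<otimes>\<^bsub>opp R\<^esub> y = y \<otimes>\<^bsub>R\<^esub> x" "\<one>\<^bsub>opp R\<^esub> = \<one>\<^bsub>R\<^esub>" "\<zero>\<^bsub>opp R\<^esub> = \<zero>\<^bsub>R\<^esub>"
  "x \<oplus>\<^bsub>opp R\<^esub> y = x \<oplus>\<^bsub>R\<^esub> y"
  by (simp_all add: opp_def)

lemma finsum_opp: "finsum (opp R) = finsum R"
  by (rule ext)+ (simp add: finsum_def finprod_def opp_def)

lemma a_minus_opp: "a_minus (opp R) = a_minus R"
  by (rule ext)+ (simp add: a_minus_def a_inv_def m_inv_def opp_def)

lemma a_r_coset_opp: "a_r_coset (opp R) = a_r_coset R"
  by (rule ext)+ (simp add: a_r_coset_def' opp_def)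

lemma ring_opp: "ring R \<Longrightarrow> ring (opp R)"
proof -
  assume "ring R"
  then interpret ring R .
  show ?thesis
  proof (rule ringI)
    show "abelian_group (opp R)"
      by (rule abelian_groupI) (auto simp: a_ac intro: l_neg)
    show "monoid (opp R)" by (rule monoidI) (auto simp: m_assoc)
  qed (auto simp: l_distr r_distr)
qed

lemma rcoset_mult_opp: "rcoset_mult (opp R) I A B = rcoset_mult R I B A"
  unfolding rcoset_mult_def a_r_coset_opp opp_simps by blast

text \<open>An equality of records rather than an isomorphism, so R/I-modules can be moved to the
  opposite side by rewriting.\<close>

lemma Quot_opp: "opp R Quot I = opp (R Quot I)"
proof -
  have "a_rcosets\<^bsub>opp R\<^esub> I = a_rcosets\<^bsub>R\<^esub> I"
    by (simp add: A_RCOSETS_def' a_r_coset_opp)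
  moreover have "set_add (opp R) = set_add R"
    by (rule ext)+ (simp add: set_add_def')
  moreover have "rcoset_mult (opp R) I = (\<lambda>A B. rcoset_mult R I B A)"
    by (rule ext)+ (rule rcoset_mult_opp)
  ultimately show ?thesis
    by (simp add: FactRing_def a_r_coset_opp) (simp add: opp_def)
qed

lemma submodule_opp: "submodule N (opp R) M \<longleftrightarrow> submodule N R M"
  by (simp add: submodule_def submodule_axioms_def)

lemma mod_hom_opp: "mod_hom (opp R) M N = mod_hom R M N"
  by (simp add: mod_hom_def)

lemma mod_iso_opp: "mod_iso (opp R) M N \<longleftrightarrow> mod_iso R M N"
  by (simp add: mod_iso_def mod_hom_opp)

lemma mod_span_opp: "mod_span (opp R) M S = mod_span R M S"
  by (simp add: mod_span_def submodule_opp)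

lemma fin_gen_opp: "fin_gen (opp R) M \<longleftrightarrow> fin_gen R M"
  by (simp add: fin_gen_def mod_span_opp)

lemma countably_gen_opp: "countably_gen (opp R) M \<longleftrightarrow> countably_gen R M"
  by (simp add: countably_gen_def mod_span_opp)

lemma pure_submodule_opp: "pure_submodule (opp R) M N \<longleftrightarrow> pure_submodule R M N"
  by (simp add: pure_submodule_def submodule_opp)

lemma ideal_mult_opp: "ideal_mult (opp R) I M = ideal_mult R I M"
  by (simp add: ideal_mult_def mod_span_opp)

lemma mod_reduction_opp: "mod_reduction (opp R) I M = mod_reduction R I M"
  by (simp add: mod_reduction_def ideal_mult_opp)

lemma right_module_opp: "ring R \<Longrightarrow> right_module (opp R) M \<longleftrightarrow> left_module R M"
  by (auto simp: right_module_def left_module_def right_module_axioms_def left_module_axioms_def ring_opp)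

lemma copower_opp: "copower (right_regular (opp R)) B = copower (left_regular R) B"
  by (simp add: copower_def right_regular_def left_regular_def opp_def)

lemma projective_right_opp: "ring R \<Longrightarrow> projective_right (opp R) M \<longleftrightarrow> projective_left R M"
  by (simp add: projective_right_def projective_left_def right_module_opp direct_summand_def
      submodule_opp mod_iso_opp copower_opp)

lemma right_lift_opp: "ring R \<Longrightarrow> right_lift (opp R) I X Q \<longleftrightarrow> left_lift R I X Q"
  by (simp add: right_lift_def left_lift_def projective_right_opp mod_reduction_opp Quot_opp mod_iso_opp)

lemma ideal_opp: "ideal I R \<Longrightarrow> ideal I (opp R)"
proof -
  assume "ideal I R"
  then interpret ideal I R .
  show ?thesis
  proof (rule idealI)
    show "ring (opp R)" by (rule ring_opp) (rule ring_axioms)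
    have "subgroup I (add_monoid R)" by (rule a_subgroup)
    then show "subgroup I (add_monoid (opp R))"
      by (simp add: subgroup_def m_inv_def)
  qed (auto simp: I_l_closed I_r_closed)
qed

text \<open>Being a unit is a two-sided notion, so \<open>R\<close> and \<open>opp R\<close> have
  the same units.\<close>

lemma radical_ideal_opp: "radical_ideal R I \<Longrightarrow> radical_ideal (opp R) I"
proof -
  assume "radical_ideal R I"
  then interpret radical_ideal R I .
  show ?thesis
  proof (intro radical_ideal.intro ring_ideal.intro radical_ideal_axioms.intro)
    show "ring (opp R)" by (rule ring_opp) (rule R.ring_axioms)
    show "ideal I (opp R)" by (rule ideal_opp) (rule I.ideal_axioms)
    have "Units (opp R) = Units R" by (auto simp: Units_def)
    then show "\<one>\<^bsub>opp R\<^esub> \<ominus>\<^bsub>opp R\<^esub> a \<in> Units (opp R)" if "a \<in> I" for a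
      using one_minus_unit[OF that] by (simp add: a_minus_opp)
  qed
qed


section \<open>Duality\<close>

lemma right_dual_simps:
  "carrier (right_dual R M) = mod_hom R M (right_regular R) \<inter> extensional (carrier M)"
  "\<zero>\<^bsub>right_dual R M\<^esub> = (\<lambda>x\<in>carrier M. \<zero>\<^bsub>R\<^esub>)"
  "h \<oplus>\<^bsub>right_dual R M\<^esub> k = (\<lambda>x\<in>carrier M. h x \<oplus>\<^bsub>R\<^esub> k x)"
  "a \<odot>\<^bsub>right_dual R M\<^esub> h = (\<lambda>x\<in>carrier M. a \<otimes>\<^bsub>R\<^esub> h x)"
  by (simp_all add: right_dual_def)

lemma right_dual_ext:
  "\<lbrakk>h \<in> carrier (right_dual R M); k \<in> carrier (right_dual R M);
    \<And>x. x \<in> carrier M \<Longrightarrow> h x = k x\<rbrakk> \<Longrightarrow> h = k"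
  by (auto simp: right_dual_simps intro: extensionalityI)

lemma right_dual_closed: "\<lbrakk>h \<in> carrier (right_dual R M); x \<in> carrier M\<rbrakk> \<Longrightarrow> h x \<in> carrier R"
  using mod_homD(1)[of h R M "right_regular R"] by (simp add: right_dual_simps)

lemma restrict_in_right_dual:
  assumes "right_module R M" "h \<in> mod_hom R M (right_regular R)"
  shows "restrict h (carrier M) \<in> carrier (right_dual R M)"
  using mod_hom_cong[OF assms(2) _ assms(1), of "restrict h (carrier M)"] by (simp add: right_dual_simps)

lemma right_module_right_dual:
  assumes M: "right_module R M" shows "right_module (opp R) (right_dual R M)"
proof -
  interpret M: right_module R M by fact
  let ?D = "right_dual R M"
  have RR: "right_module R (right_regular R)"
    by (rule right_module_right_regular) (rule M.R.ring_axioms)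
  have hom: "h \<in> mod_hom R M (right_regular R)" if "h \<in> carrier ?D" for h
    using that by (simp add: right_dual_simps)
  show ?thesis
  proof (rule right_module_pointwise[OF right_module_right_regular[OF ring_opp[OF M.R.ring_axioms]]])
    show "carrier ?D \<subseteq> carrier M \<rightarrow>\<^sub>E carrier (right_regular (opp R))"
      using mod_homD(1)[OF hom] by (auto simp: PiE_def right_dual_simps(1))
    show "h \<oplus>\<^bsub>?D\<^esub> k \<in> carrier ?D" if "h \<in> carrier ?D" "k \<in> carrier ?D" for h k
      using restrict_in_right_dual[OF M mod_hom_add[OF M RR hom[OF that(1)] hom[OF that(2)]]]
      by (simp add: right_dual_simps(3))
    show "a \<odot>\<^bsub>?D\<^esub> h \<in> carrier ?D" if "a \<in> carrier (opp R)" "h \<in> carrier ?D" for a h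
    proof -
      have "(\<lambda>x. a \<otimes>\<^bsub>R\<^esub> h x) \<in> mod_hom R M (right_regular R)"
        by (rule mod_homI)
          (use that mod_homD[OF hom[OF that(2)]] in \<open>auto simp: M.R.r_distr M.R.m_assoc\<close>)
      then show ?thesis using restrict_in_right_dual[OF M] by (simp add: right_dual_simps(4))
    qed
    have "(\<lambda>x. \<zero>\<^bsub>R\<^esub>) \<in> mod_hom R M (right_regular R)" by (rule mod_homI) auto
    then show "\<zero>\<^bsub>?D\<^esub> \<in> carrier ?D"
      using restrict_in_right_dual[OF M] by (simp add: right_dual_simps(2))
  qed (auto simp: right_dual_simps(2-))
qed

text \<open>The additive inverse in the dual is given only by a description; the pointwise value is
  found by cancelling in (h - k) + k = h.\<close>

lemma right_dual_minus:
  assumes M: "right_module R M" and "h \<in> carrier (right_dual R M)" "k \<in> carrier (right_dual R M)" "x \<in> carrier M"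
  shows "(h \<ominus>\<^bsub>right_dual R M\<^esub> k) x = h x \<ominus>\<^bsub>R\<^esub> k x"
proof -
  interpret D: right_module "opp R" "right_dual R M" by (rule right_module_right_dual[OF M])
  interpret M: right_module R M by (rule M)
  have c: "h x \<in> carrier R" "k x \<in> carrier R" "(h \<ominus>\<^bsub>right_dual R M\<^esub> k) x \<in> carrier R"
    using assms(2-) right_dual_closed[of _ R M x] D.M.minus_closed by auto
  have "(h \<ominus>\<^bsub>right_dual R M\<^esub> k) \<oplus>\<^bsub>right_dual R M\<^esub> k = h"
    using assms(2,3) by (rule D.M.minus_add_cancel)
  moreover have "((h \<ominus>\<^bsub>right_dual R M\<^esub> k) \<oplus>\<^bsub>right_dual R M\<^esub> k) x = (h \<ominus>\<^bsub>right_dual R M\<^esub> k) x \<oplus>\<^bsub>R\<^esub> k x"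
    using assms(4) by (simp add: right_dual_simps(3))
  ultimately have "h x = (h \<ominus>\<^bsub>right_dual R M\<^esub> k) x \<oplus>\<^bsub>R\<^esub> k x" by simp
  then show ?thesis using c by (simp add: a_minus_def M.R.a_assoc M.R.r_neg)
qed

lemma right_dual_eval_hom:
  "x \<in> carrier M \<Longrightarrow> (\<lambda>\<psi>. \<psi> x) \<in> mod_hom (opp R) (right_dual R M) (right_regular (opp R))"
  by (rule mod_homI) (auto simp: right_dual_simps(3,4) right_dual_closed)

text \<open>The transpose of \<open>\<theta>\<close>, restricted to the carrier because elements of
  \<open>right_dual\<close> are extensional.\<close>

definition dual_map :: "('a, 'm, 'd) module_scheme \<Rightarrow> ('m \<Rightarrow> 'm) \<Rightarrow> ('m \<Rightarrow> 'a) \<Rightarrow> 'm \<Rightarrow> 'a"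
  where "dual_map P \<theta> \<psi> = (\<lambda>x\<in>carrier P. \<psi> (\<theta> x))"

lemma dual_map_apply [simp]: "x \<in> carrier P \<Longrightarrow> dual_map P \<theta> \<psi> x = \<psi> (\<theta> x)"
  by (simp add: dual_map_def)

lemma dual_map_closed:
  assumes P: "right_module R P" and \<theta>: "\<theta> \<in> mod_hom R P P" and \<psi>: "\<psi> \<in> carrier (right_dual R P)"
  shows "dual_map P \<theta> \<psi> \<in> carrier (right_dual R P)"
  using restrict_in_right_dual[OF P mod_hom_comp[OF \<theta>]] \<psi>
  by (simp add: right_dual_simps(1) dual_map_def)

lemma dual_map_hom:
  assumes P: "right_module R P" and \<theta>: "\<theta> \<in> mod_hom R P P"
  shows "dual_map P \<theta> \<in> mod_hom (opp R) (right_dual R P) (right_dual R P)"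
  using dual_map_closed[OF P \<theta>] mod_homD(1)[OF \<theta>]
  by (intro mod_homI) (auto simp: right_dual_simps(3,4) dual_map_def)

context mod_idempotent
begin

abbreviation "D \<equiv> right_dual R P"
abbreviation "\<phi>' \<equiv> \<lambda>i. restrict (\<phi> i) (carrier P)"

lemmas D_mod = right_module_right_dual[OF P_mod]

lemma functional: "\<psi> \<in> carrier D \<Longrightarrow> module_hom R P (right_regular R) \<psi>"
  using P_mod right_module_right_regular[OF R.ring_axioms]
  by (rule module_homI) (simp add: right_dual_simps)

lemmas functional_minus = module_hom.minus[OF functional, unfolded a_minus_right_regular]
lemmas functional_add = module_hom.add[OF functional, simplified]
lemmas functional_smult = module_hom.smult[OF functional, simplified]

lemma \<phi>'_D: "i \<in> K \<Longrightarrow> \<phi>' i \<in> carrier D"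
  using fin_familyD(1)[OF db_D(1)] by (intro restrict_in_right_dual[OF P_mod])

lemma functional_eq_sum:
  assumes "\<psi> \<in> carrier D" "x \<in> carrier P"
  shows "\<psi> x = (\<Oplus>i\<in>K. \<psi> (p i) \<otimes> \<phi> i x)"
proof -
  interpret \<psi>: module_hom R P "right_regular R" \<psi> using assms(1) by (rule functional)
  have "\<psi> (family_comb R P K \<phi> p x) = family_comb R (right_regular R) K \<phi> (\<lambda>i. \<psi> (p i)) x"
    by (rule hom_family_comb[OF \<psi>.module_hom_axioms db_D(1) db_D(2) assms(2)])
  also have "\<dots> = (\<Oplus>\<^bsub>right_regular R\<^esub>i\<in>K. \<phi> i x \<odot>\<^bsub>right_regular R\<^esub> \<psi> (p i))"
    by (rule family_comb_superset[OF \<psi>.N.right_module_axioms fin subset_refl])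
      (use fin_familyD(3)[OF db_D(1) _ assms(2)] \<psi>.closed db_D(2) in auto)
  finally show ?thesis using db_D(3)[OF assms(2)] by (simp add: finsum_right_regular)
qed

text \<open>Vectors and functionals exchange roles: the functionals \<open>\<phi>' i\<close> are the
  vectors, evaluations at \<open>p i\<close> are the functionals. Finiteness of \<open>K\<close>
  makes the evaluations a finitely supported family.\<close>

lemma dual_basis_dual: "dual_basis (opp R) D K \<phi>' (\<lambda>i \<psi>. \<psi> (p i))"
proof -
  have fam: "fin_family (opp R) D K (\<lambda>i \<psi>. \<psi> (p i))"
    by (rule fin_family_finite[OF fin]) (rule right_dual_eval_hom, rule db_D(2))
  have "family_comb (opp R) D K (\<lambda>i \<psi>. \<psi> (p i)) \<phi>' \<psi> = \<psi>" (is "?c = \<psi>") if \<psi>: "\<psi> \<in> carrier D" for \<psi>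
  proof (rule right_dual_ext[OF _ \<psi>])
    show "?c \<in> carrier D"
      using mod_homD(1)[OF family_comb_hom[OF D_mod D_mod fam \<phi>'_D] \<psi>] .
    fix x assume x: "x \<in> carrier P"
    have RR: "right_module (opp R) (right_regular (opp R))"
      by (intro right_module_right_regular ring_opp R.ring_axioms)
    have ev: "module_hom (opp R) D (right_regular (opp R)) (\<lambda>\<psi>. \<psi> x)"
      by (rule module_homI[OF D_mod RR right_dual_eval_hom[OF x]])
    have "?c x = family_comb (opp R) (right_regular (opp R)) K (\<lambda>i \<psi>. \<psi> (p i)) (\<lambda>i. \<phi>' i x) \<psi>"
      by (rule hom_family_comb[OF ev fam \<phi>'_D \<psi>])
    also have "\<dots> = (\<Oplus>\<^bsub>right_regular (opp R)\<^esub>i\<in>K. \<psi> (p i) \<odot>\<^bsub>right_regular (opp R)\<^esub> \<phi>' i x)"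
      by (rule family_comb_superset[OF RR fin subset_refl])
        (use \<psi> x db_D(2) right_dual_closed[OF \<phi>'_D x] right_dual_closed[OF \<psi>] in auto)
    also have "\<dots> = \<psi> x" using functional_eq_sum[OF \<psi> x] x by (simp add: finsum_right_regular finsum_opp)
    finally show "?c x = \<psi> x" .
  qed
  then show ?thesis using fam \<phi>'_D by (simp add: dual_basis_def)
qed

lemma functional_mcong:
  assumes "\<psi> \<in> carrier D" "mcong R I P x y" shows "\<psi> x \<ominus> \<psi> y \<in> I"
proof -
  have "\<psi> (x \<ominus>\<^bsub>P\<^esub> y) \<in> I"
    using assms by (intro functional_ideal_mult[OF P_mod]) (auto simp: right_dual_simps mcong_def)
  then show ?thesis using functional_minus[OF assms(1)] assms(2) by (simp add: mcong_def)
qed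

lemma mcong_iff_functional:
  assumes "x \<in> carrier P" "y \<in> carrier P"
  shows "mcong R I P x y \<longleftrightarrow> (\<forall>i\<in>K. \<phi>' i x \<ominus> \<phi>' i y \<in> I)"
  using ideal_mult_iff_dual_basis[OF P_mod db, of "x \<ominus>\<^bsub>P\<^esub> y"] assms functional_minus[OF \<phi>'_D]
  by (simp add: mcong_def)

text \<open>Evaluation at a point is a functional on the dual, and evaluations at the
  \<open>p i\<close> already detect membership.\<close>

lemma ideal_mult_dual_iff:
  assumes \<psi>: "\<psi> \<in> carrier D"
  shows "\<psi> \<in> ideal_mult (opp R) I D \<longleftrightarrow> (\<forall>x\<in>carrier P. \<psi> x \<in> I)"
proof -
  interpret O: radical_ideal "opp R" I by (rule radical_ideal_opp) (rule radical_ideal_axioms)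
  show ?thesis
    using O.functional_ideal_mult[OF D_mod right_dual_eval_hom]
      O.ideal_mult_iff_dual_basis[OF D_mod dual_basis_dual \<psi>] db_D(2) by blast
qed

lemma mcong_dual_iff:
  assumes "\<psi> \<in> carrier D" "\<psi>' \<in> carrier D"
  shows "mcong (opp R) I D \<psi> \<psi>' \<longleftrightarrow> (\<forall>x\<in>carrier P. \<psi> x \<ominus> \<psi>' x \<in> I)"
proof -
  interpret D: right_module "opp R" D by (rule D_mod)
  show ?thesis using assms right_dual_minus[OF P_mod assms]
    by (simp add: mcong_def ideal_mult_dual_iff)
qed

lemma dual: "mod_idempotent (opp R) I D K \<phi>' (\<lambda>i \<psi>. \<psi> (p i)) (dual_map P e)"
proof -
  interpret O: radical_ideal "opp R" I by (rule radical_ideal_opp) (rule radical_ideal_axioms)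
  note cl = dual_map_closed[OF P_mod e]
  have "mcong (opp R) I D (dual_map P e (dual_map P e \<psi>)) (dual_map P e \<psi>)" if "\<psi> \<in> carrier D" for \<psi>
    using that cl e.closed e_idem functional_mcong by (subst mcong_dual_iff) auto
  then show ?thesis
    by (intro mod_idempotent.intro mod_idempotent_axioms.intro O.radical_ideal_axioms D_mod fin
        dual_basis_dual dual_map_hom[OF P_mod e])
qed

text \<open>Inverse of transposition: x is sent to the sum of p_i \<theta>(\<phi>_i)(x). It exists
  because \<open>P\<close> has a finite dual basis, and it shows that every endomorphism of the dual
  is a transpose.\<close>

definition predual :: "(('m \<Rightarrow> 'a) \<Rightarrow> 'm \<Rightarrow> 'a) \<Rightarrow> 'm \<Rightarrow> 'm"
  where "predual \<theta> = family_comb R P K (\<lambda>i. \<theta> (\<phi>' i)) p"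

lemma predual:
  assumes \<theta>: "\<theta> \<in> mod_hom (opp R) D D"
  shows "predual \<theta> \<in> mod_hom R P P"
    and "\<And>\<psi> x. \<psi> \<in> carrier D \<Longrightarrow> x \<in> carrier P \<Longrightarrow> \<psi> (predual \<theta> x) = \<theta> \<psi> x"
proof -
  interpret \<theta>: module_hom "opp R" D D \<theta> using D_mod D_mod \<theta> by (rule module_homI)
  have "\<theta> (\<phi>' i) \<in> mod_hom R P (right_regular R)" if "i \<in> K" for i
    using \<theta>.closed[OF \<phi>'_D[OF that]] by (simp add: right_dual_simps(1))
  then have fam: "fin_family R P K (\<lambda>i. \<theta> (\<phi>' i))" using fin by (intro fin_family_finite)
  show "predual \<theta> \<in> mod_hom R P P"
    unfolding predual_def by (rule family_comb_hom[OF P_mod P_mod fam db_D(2)])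
  fix \<psi> x assume \<psi>: "\<psi> \<in> carrier D" and x: "x \<in> carrier P"
  interpret \<psi>: module_hom R P "right_regular R" \<psi> using \<psi> by (rule functional)
  note dbd = dual_basisD[OF dual_basis_dual]
  have RR: "right_module (opp R) (right_regular (opp R))"
    by (intro right_module_right_regular ring_opp R.ring_axioms)
  have ev: "module_hom (opp R) D (right_regular (opp R)) (\<lambda>\<psi>. \<theta> \<psi> x)"
    by (rule module_homI[OF D_mod RR mod_hom_comp[OF \<theta> right_dual_eval_hom[OF x]]])
  have "\<psi> (predual \<theta> x) = family_comb R (right_regular R) K (\<lambda>i. \<theta> (\<phi>' i)) (\<lambda>i. \<psi> (p i)) x"
    unfolding predual_def by (rule hom_family_comb[OF \<psi>.module_hom_axioms fam db_D(2) x])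
  also have "\<dots> = (\<Oplus>\<^bsub>right_regular R\<^esub>i\<in>K. \<theta> (\<phi>' i) x \<odot>\<^bsub>right_regular R\<^esub> \<psi> (p i))"
    by (rule family_comb_superset[OF \<psi>.N.right_module_axioms fin subset_refl])
      (use fin_familyD(3)[OF fam _ x] \<psi>.closed db_D(2) in auto)
  also have "\<dots> = (\<Oplus>\<^bsub>right_regular (opp R)\<^esub>i\<in>K. \<psi> (p i) \<odot>\<^bsub>right_regular (opp R)\<^esub> \<theta> (\<phi>' i) x)"
    by (simp add: finsum_right_regular finsum_opp)
  also have "\<dots> = family_comb (opp R) (right_regular (opp R)) K (\<lambda>i \<psi>. \<psi> (p i)) (\<lambda>i. \<theta> (\<phi>' i) x) \<psi>"
    by (rule family_comb_superset[OF RR fin subset_refl, symmetric])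
      (use fin_familyD(3)[OF fam _ x] \<psi>.closed db_D(2) in auto)
  also have "\<dots> = \<theta> (family_comb (opp R) D K (\<lambda>i \<psi>. \<psi> (p i)) \<phi>' \<psi>) x"
    by (rule hom_family_comb[OF ev dbd(1) dbd(2) \<psi>, symmetric])
  finally show "\<psi> (predual \<theta> x) = \<theta> \<psi> x" using dbd(3)[OF \<psi>] by simp
qed

lemma functional_separation:
  assumes "x \<in> carrier P" "y \<in> carrier P" "\<And>i. i \<in> K \<Longrightarrow> \<phi>' i x = \<phi>' i y" shows "x = y"
proof -
  have "\<phi> i x = \<phi> i y" if "i \<in> K" for i using assms(3)[OF that] assms(1,2) by simp
  then have "family_comb R P K \<phi> p x = family_comb R P K \<phi> p y"
    unfolding family_comb_def
    using assms(1,2) fin_familyD(3)[OF db_D(1)] db_D(2)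
    by (intro P.M.finsum_cong') (auto intro!: P.smult_closed)
  then show ?thesis using db_D(3) assms(1,2) by simp
qed

lemma idem_lifts_dual_iff: "idem_lifts (opp R) I D (dual_map P e) \<longleftrightarrow> idem_lifts R I P e"
proof
  assume "idem_lifts R I P e"
  then obtain d where d: "d \<in> mod_hom R P P" "\<And>x. x \<in> carrier P \<Longrightarrow> d (d x) = d x"
    "\<And>x. x \<in> carrier P \<Longrightarrow> mcong R I P (d x) (e x)" by (auto simp: idem_lifts_def)
  note cl = dual_map_closed[OF P_mod]
  show "idem_lifts (opp R) I D (dual_map P e)"
    unfolding idem_lifts_def
  proof (intro bexI ballI conjI)
    show "dual_map P d \<in> mod_hom (opp R) D D" by (rule dual_map_hom[OF P_mod d(1)])
    fix \<psi> assume \<psi>: "\<psi> \<in> carrier D"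
    show "dual_map P d (dual_map P d \<psi>) = dual_map P d \<psi>"
      by (rule right_dual_ext[OF cl[OF d(1) cl[OF d(1) \<psi>]] cl[OF d(1) \<psi>]])
        (use d(2) mod_homD(1)[OF d(1)] in simp)
    show "mcong (opp R) I D (dual_map P d \<psi>) (dual_map P e \<psi>)"
      using mcong_dual_iff[OF cl[OF d(1) \<psi>] cl[OF e \<psi>]] functional_mcong[OF \<psi> d(3)] by simp
  qed
next
  assume "idem_lifts (opp R) I D (dual_map P e)"
  then obtain d where d: "d \<in> mod_hom (opp R) D D" "\<And>\<psi>. \<psi> \<in> carrier D \<Longrightarrow> d (d \<psi>) = d \<psi>"
    "\<And>\<psi>. \<psi> \<in> carrier D \<Longrightarrow> mcong (opp R) I D (d \<psi>) (dual_map P e \<psi>)" by (auto simp: idem_lifts_def)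
  note pd = predual[OF d(1)]
  note pc = mod_homD(1)[OF pd(1)] and dc = mod_homD(1)[OF d(1)]
  show "idem_lifts R I P e"
    unfolding idem_lifts_def
  proof (intro bexI ballI conjI)
    show "predual d \<in> mod_hom R P P" by (rule pd(1))
    fix x assume x: "x \<in> carrier P"
    \<comment> \<open>Elements of \<open>P\<close> are separated by the functionals
      \<open>\<phi>' i\<close>, on which \<open>predual d\<close> acts as \<open>d\<close>.\<close>
    show "predual d (predual d x) = predual d x"
      by (rule functional_separation) (simp_all only: pd(2) \<phi>'_D x pc dc d(2))
    have "\<phi>' i (predual d x) \<ominus> \<phi>' i (e x) \<in> I" if i: "i \<in> K" for i
      using mcong_dual_iff[OF dc[OF \<phi>'_D[OF i]] dual_map_closed[OF P_mod e \<phi>'_D[OF i]]]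
        d(3)[OF \<phi>'_D[OF i]] x pd(2)[OF \<phi>'_D[OF i] x]
      by (metis dual_map_apply)
    then show "mcong R I P (predual d x) (e x)"
      using mcong_iff_functional[OF pc[OF x] e.closed[OF x]] by blast
  qed
qed

lemma half_lifts_dual_iff:
  "half_lifts (opp R) I D (dual_map P (\<lambda>x. x \<ominus>\<^bsub>P\<^esub> e x)) \<longleftrightarrow> half_lifts R I P e"
proof
  interpret D: right_module "opp R" D by (rule D_mod)
  interpret C: mod_idempotent R I P K p \<phi> "\<lambda>x. x \<ominus>\<^bsub>P\<^esub> e x" by (rule complement)
  let ?e' = "dual_map P (\<lambda>x. x \<ominus>\<^bsub>P\<^esub> e x)"
  note cl = dual_map_closed[OF P_mod]
  \<comment> \<open>The complement of the transpose of 1 - e is the transpose of e.\<close>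
  have e'c: "(\<psi> \<ominus>\<^bsub>D\<^esub> ?e' \<psi>) x = \<psi> (e x)" if "\<psi> \<in> carrier D" "x \<in> carrier P" for \<psi> x
    using that e.closed right_dual_minus[OF P_mod that(1) cl[OF C.e that(1)] that(2)]
      functional_minus[OF that(1)] right_dual_closed[OF that(1)]
    by (simp add: R.minus_minus_cancel)
  {
    assume "half_lifts R I P e"
    then obtain a c where a: "a \<in> mod_hom R P P" and c: "c \<in> mod_hom R P P"
      and ca: "\<And>x. x \<in> carrier P \<Longrightarrow> c (a x) = \<zero>\<^bsub>P\<^esub>"
      and ae: "\<And>x. x \<in> carrier P \<Longrightarrow> mcong R I P (a x) (e x)"
      and ce: "\<And>x. x \<in> carrier P \<Longrightarrow> mcong R I P (c x) (x \<ominus>\<^bsub>P\<^esub> e x)"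
      unfolding half_lifts_def by blast
    show "half_lifts (opp R) I D ?e'"
    proof (rule half_liftsI)
      show "dual_map P c \<in> mod_hom (opp R) D D" "dual_map P a \<in> mod_hom (opp R) D D"
        by (rule dual_map_hom[OF P_mod c], rule dual_map_hom[OF P_mod a])
      fix \<psi> assume \<psi>: "\<psi> \<in> carrier D"
      show "dual_map P a (dual_map P c \<psi>) = \<zero>\<^bsub>D\<^esub>"
      proof (rule right_dual_ext[OF cl[OF a cl[OF c \<psi>]] D.M.zero_closed])
        fix x assume "x \<in> carrier P"
        then show "dual_map P a (dual_map P c \<psi>) x = \<zero>\<^bsub>D\<^esub> x"
          using ca mod_homD(1)[OF a] module_hom.zero[OF functional[OF \<psi>]]
          by (simp add: right_dual_simps(2))
      qed
      show "mcong (opp R) I D (dual_map P c \<psi>) (?e' \<psi>)"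
        using mcong_dual_iff[OF cl[OF c \<psi>] cl[OF C.e \<psi>]] functional_mcong[OF \<psi> ce] by simp
      have "\<psi> \<ominus>\<^bsub>D\<^esub> ?e' \<psi> \<in> carrier D" using \<psi> cl[OF C.e \<psi>] by simp
      from mcong_dual_iff[OF cl[OF a \<psi>] this]
      show "mcong (opp R) I D (dual_map P a \<psi>) (\<psi> \<ominus>\<^bsub>D\<^esub> ?e' \<psi>)"
        using functional_mcong[OF \<psi> ae] e'c[OF \<psi>] by simp
    qed
  next
    assume "half_lifts (opp R) I D ?e'"
    then obtain a c where a: "a \<in> mod_hom (opp R) D D" and c: "c \<in> mod_hom (opp R) D D"
      and ca: "\<And>\<psi>. \<psi> \<in> carrier D \<Longrightarrow> c (a \<psi>) = \<zero>\<^bsub>D\<^esub>"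
      and ae: "\<And>\<psi>. \<psi> \<in> carrier D \<Longrightarrow> mcong (opp R) I D (a \<psi>) (?e' \<psi>)"
      and ce: "\<And>\<psi>. \<psi> \<in> carrier D \<Longrightarrow> mcong (opp R) I D (c \<psi>) (\<psi> \<ominus>\<^bsub>D\<^esub> ?e' \<psi>)"
      unfolding half_lifts_def by blast
    note pa = predual[OF a] and pc = predual[OF c]
    note pac = mod_homD(1)[OF pa(1)] and pcc = mod_homD(1)[OF pc(1)]
    note ac = mod_homD(1)[OF a] and cc = mod_homD(1)[OF c]
    show "half_lifts R I P e"
    proof (rule half_liftsI)
      show "predual c \<in> mod_hom R P P" "predual a \<in> mod_hom R P P" by (rule pc(1), rule pa(1))
      fix x assume x: "x \<in> carrier P"
      have "\<phi>' i (predual a (predual c x)) = \<phi>' i \<zero>\<^bsub>P\<^esub>" if i: "i \<in> K" for i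
      proof -
        \<comment> \<open>Transposition reverses products, so c after a on the dual corresponds to
          predual a after predual c; the two witnesses change places.\<close>
        have "\<phi>' i (predual a (predual c x)) = c (a (\<phi>' i)) x"
          by (simp only: pa(2) pc(2) \<phi>'_D i x pcc ac)
        also have "\<dots> = \<zero>" using ca[OF \<phi>'_D[OF i]] x by (simp add: right_dual_simps(2))
        finally show ?thesis using module_hom.zero[OF functional[OF \<phi>'_D[OF i]]]
          by (simp only: right_regular_simps)
      qed
      then show "predual a (predual c x) = \<zero>\<^bsub>P\<^esub>"
        by (intro functional_separation pac pcc x P.M.zero_closed)
      have "\<phi>' i (predual c x) \<ominus> \<phi>' i (e x) \<in> I" if i: "i \<in> K" for i
      proof -
        note \<psi> = \<phi>'_D[OF i]
        have "\<phi>' i \<ominus>\<^bsub>D\<^esub> ?e' (\<phi>' i) \<in> carrier D" using \<psi> cl[OF C.e \<psi>] by simp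
        from mcong_dual_iff[OF cc[OF \<psi>] this]
        show ?thesis using ce[OF \<psi>] e'c[OF \<psi> x] pc(2)[OF \<psi> x] x by metis
      qed
      then show "mcong R I P (predual c x) (e x)"
        using mcong_iff_functional[OF pcc[OF x] e.closed[OF x]] by blast
      have "\<phi>' i (predual a x) \<ominus> \<phi>' i (x \<ominus>\<^bsub>P\<^esub> e x) \<in> I" if i: "i \<in> K" for i
      proof -
        note \<psi> = \<phi>'_D[OF i]
        from mcong_dual_iff[OF ac[OF \<psi>] cl[OF C.e \<psi>]]
        show ?thesis using ae[OF \<psi>] pa(2)[OF \<psi> x] x by (metis dual_map_apply)
      qed
      then show "mcong R I P (predual a x) (x \<ominus>\<^bsub>P\<^esub> e x)"
        using mcong_iff_functional[OF pac[OF x] C.e.closed[OF x]] by blast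
    qed
  }
qed

end

section \<open>The quotient ring and the dual of a summand of P/PI\<close>

context ring_ideal
begin

lemma coset_in_Quot: "a \<in> carrier R \<Longrightarrow> I +> a \<in> carrier (R Quot I)"
  by (auto simp: FactRing_simps)

lemma Quot_cases:
  assumes "A \<in> carrier (R Quot I)" obtains a where "a \<in> carrier R" "A = I +> a"
  using assms by (auto simp: FactRing_simps)

lemma coset_eq_iff: "\<lbrakk>a \<in> carrier R; b \<in> carrier R\<rbrakk> \<Longrightarrow> I +> a = I +> b \<longleftrightarrow> a \<ominus> b \<in> I"
  using R.quotient_eq_iff_same_a_r_cos[OF I.ideal_axioms] by blast

lemma coset_eq_ideal_iff: "a \<in> carrier R \<Longrightarrow> I +> a = I \<longleftrightarrow> a \<in> I"
  using coset_eq_iff[of a "\<zero>"] by (simp add: I.a_subset a_minus_def R.uminus_zero)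

lemma Quot_coset_simps:
  "\<zero>\<^bsub>R Quot I\<^esub> = I"
  "\<lbrakk>a \<in> carrier R; b \<in> carrier R\<rbrakk> \<Longrightarrow> (I +> a) \<oplus>\<^bsub>R Quot I\<^esub> (I +> b) = I +> (a \<oplus> b)"
  "\<lbrakk>a \<in> carrier R; b \<in> carrier R\<rbrakk> \<Longrightarrow> (I +> a) \<otimes>\<^bsub>R Quot I\<^esub> (I +> b) = I +> (a \<otimes> b)"
  by (simp_all add: FactRing_def I.a_rcos_sum I.rcoset_mult_add)

lemma mod_hom_res: "h \<in> mod_hom (R Quot I) X Y \<Longrightarrow> h \<in> mod_hom R (res R I X) (res R I Y)"
  by (rule mod_homI) (auto simp: mod_homD coset_in_Quot)

end

context mod_idempotent
begin

text \<open>Hom_(R/I)(X, R/I) is the summand of the reduced dual of \<open>P\<close> cut out by the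
  transpose of \<open>e\<close>: every functional on \<open>X\<close> comes from some \<psi> on
  \<open>P\<close> by restricting to the image of \<open>e\<close>.\<close>

lemma represents_dual:
  assumes X: "right_module (R Quot I) X" and \<pi>: "represents R I P e X \<pi>"
  shows "\<exists>\<tau>. represents (opp R) I D (dual_map P e) (right_dual (R Quot I) X) \<tau>"
proof -
  let ?S = "R Quot I" and ?DX = "right_dual (R Quot I) X"
  \<comment> \<open>Sends \<pi>(x) to \<psi>(e x) + I. The choice of preimage is harmless because
    equal values of \<pi> mean congruent values of \<open>e\<close>.\<close>
  define \<tau> where "\<tau> \<psi> = (\<lambda>z\<in>carrier X. I +> \<psi> (e (inv_into (carrier P) \<pi> z)))" for \<psi>
  have \<pi>h: "\<pi> \<in> mod_hom R P (res R I X)" and \<pi>s: "\<pi> ` carrier P = carrier X"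
    using \<pi> by (auto simp: represents_def)
  interpret \<pi>: module_hom R P "res R I X" \<pi> using P_mod right_module_res[OF X] \<pi>h by (rule module_homI)
  note eq = represents_eq_iff[OF P_mod X e.module_hom_axioms \<pi>]
  have zE: "\<exists>x\<in>carrier P. z = \<pi> x" if "z \<in> carrier X" for z using that \<pi>s by auto
  have \<pi>c: "\<pi> x \<in> carrier X" if "x \<in> carrier P" for x using that \<pi>s by auto
  note cl = right_dual_closed[of _ R P]
  have \<tau>: "\<tau> \<psi> (\<pi> x) = I +> \<psi> (e x)" if \<psi>: "\<psi> \<in> carrier D" and x: "x \<in> carrier P" for \<psi> x
  proof -
    let ?y = "inv_into (carrier P) \<pi> (\<pi> x)"
    have y: "?y \<in> carrier P" "\<pi> ?y = \<pi> x" using x by (auto intro: inv_into_into f_inv_into_f)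
    then have "\<psi> (e ?y) \<ominus> \<psi> (e x) \<in> I" using functional_mcong[OF \<psi>] eq x by blast
    then show ?thesis
      using coset_eq_iff[of "\<psi> (e ?y)" "\<psi> (e x)"] cl[OF \<psi>] y(1) x e.closed \<pi>c by (simp add: \<tau>_def)
  qed
  have \<tau>D: "\<tau> \<psi> \<in> carrier ?DX" if \<psi>: "\<psi> \<in> carrier D" for \<psi>
  proof -
    have c: "\<psi> (e x) \<in> carrier R" if "x \<in> carrier P" for x using that cl[OF \<psi>] e.closed by simp
    have "\<tau> \<psi> \<in> mod_hom ?S X (right_regular ?S)"
    proof (rule mod_homI)
      fix z assume "z \<in> carrier X"
      then obtain x where x: "x \<in> carrier P" "z = \<pi> x" using zE by blast
      then show "\<tau> \<psi> z \<in> carrier (right_regular ?S)" using \<tau>[OF \<psi>] coset_in_Quot c by simp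
      {
        fix z' assume "z' \<in> carrier X"
        then obtain y where y: "y \<in> carrier P" "z' = \<pi> y" using zE by blast
        have "z \<oplus>\<^bsub>X\<^esub> z' = \<pi> (x \<oplus>\<^bsub>P\<^esub> y)" using x y \<pi>.add by simp
        then show "\<tau> \<psi> (z \<oplus>\<^bsub>X\<^esub> z') = \<tau> \<psi> z \<oplus>\<^bsub>right_regular ?S\<^esub> \<tau> \<psi> z'"
          using x y c \<tau>[OF \<psi>] functional_add[OF \<psi>] e.closed by (simp add: e.add Quot_coset_simps)
      }
      fix A assume "A \<in> carrier ?S"
      then obtain a where a: "a \<in> carrier R" "A = I +> a" by (rule Quot_cases)
      have "A \<odot>\<^bsub>X\<^esub> z = \<pi> (a \<odot>\<^bsub>P\<^esub> x)" using a x \<pi>.smult by simp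
      then show "\<tau> \<psi> (A \<odot>\<^bsub>X\<^esub> z) = A \<odot>\<^bsub>right_regular ?S\<^esub> \<tau> \<psi> z"
        using x a c \<tau>[OF \<psi>] functional_smult[OF \<psi>] e.closed P.smult_closed by (simp add: e.smult Quot_coset_simps)
    qed
    then show ?thesis by (simp add: right_dual_simps(1) \<tau>_def)
  qed
  have ext: "h = k" if "h \<in> carrier ?DX" "k \<in> carrier ?DX" "\<And>x. x \<in> carrier P \<Longrightarrow> h (\<pi> x) = k (\<pi> x)" for h k
    by (rule right_dual_ext[OF that(1,2)]) (use that(3) zE in blast)
  interpret DX: right_module "opp ?S" ?DX by (rule right_module_right_dual[OF X])
  interpret D: right_module "opp R" D by (rule D_mod)
  have "\<tau> \<in> mod_hom (opp R) D (res (opp R) I ?DX)"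
  proof (rule mod_homI)
    show "\<tau> \<psi> \<in> carrier (res (opp R) I ?DX)" if "\<psi> \<in> carrier D" for \<psi> using \<tau>D[OF that] by simp
    fix \<psi> \<psi>' assume \<psi>: "\<psi> \<in> carrier D" and \<psi>': "\<psi>' \<in> carrier D"
    show "\<tau> (\<psi> \<oplus>\<^bsub>D\<^esub> \<psi>') = \<tau> \<psi> \<oplus>\<^bsub>res (opp R) I ?DX\<^esub> \<tau> \<psi>'"
      unfolding res_simps
    proof (rule ext)
      fix x assume x: "x \<in> carrier P"
      have "\<psi> \<oplus>\<^bsub>D\<^esub> \<psi>' \<in> carrier D" using \<psi> \<psi>' by simp
      then show "\<tau> (\<psi> \<oplus>\<^bsub>D\<^esub> \<psi>') (\<pi> x) = (\<tau> \<psi> \<oplus>\<^bsub>?DX\<^esub> \<tau> \<psi>') (\<pi> x)"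
        using \<psi> \<psi>' x e.closed \<pi>c cl by (simp add: \<tau> right_dual_simps(3) Quot_coset_simps)
    qed (use \<tau>D \<psi> \<psi>' in auto)
  next
    fix a \<psi> assume "a \<in> carrier (opp R)" and \<psi>: "\<psi> \<in> carrier D"
    then have a: "a \<in> carrier R" by simp
    have a\<psi>: "a \<odot>\<^bsub>D\<^esub> \<psi> \<in> carrier D" using a \<psi> D.smult_closed by simp
    show "\<tau> (a \<odot>\<^bsub>D\<^esub> \<psi>) = a \<odot>\<^bsub>res (opp R) I ?DX\<^esub> \<tau> \<psi>"
      unfolding res_simps a_r_coset_opp
    proof (rule ext)
      show "(I +> a) \<odot>\<^bsub>?DX\<^esub> \<tau> \<psi> \<in> carrier ?DX"
        using DX.smult_closed[of "I +> a"] \<tau>D[OF \<psi>] coset_in_Quot[OF a] by simp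
      fix x assume x: "x \<in> carrier P"
      show "\<tau> (a \<odot>\<^bsub>D\<^esub> \<psi>) (\<pi> x) = ((I +> a) \<odot>\<^bsub>?DX\<^esub> \<tau> \<psi>) (\<pi> x)"
        using \<psi> a a\<psi> x e.closed \<pi>c cl by (simp add: \<tau> right_dual_simps(4) Quot_coset_simps)
    qed (use \<tau>D a\<psi> in auto)
  qed
  moreover have "\<tau> ` carrier D = carrier ?DX"
  proof
    show "carrier ?DX \<subseteq> \<tau> ` carrier D"
    proof
      fix h assume h: "h \<in> carrier ?DX"
      have hh: "h \<in> mod_hom ?S X (right_regular ?S)" using h by (simp add: right_dual_simps(1))
      let ?Y = "res R I (right_regular ?S)"
      have Y: "right_module R ?Y"
        by (intro right_module_res right_module_right_regular I.quotient_is_ring)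
      have RR: "right_module R (right_regular R)" by (rule right_module_right_regular) (rule R.ring_axioms)
      \<comment> \<open>For surjectivity, the composite of h and \<pi> into R/I is lifted to R by
        projectivity of \<open>P\<close>; since \<pi>(e x) = \<pi>(x), the lift is mapped back to
        \<open>h\<close>.\<close>
      have h\<pi>: "(\<lambda>x. h (\<pi> x)) \<in> mod_hom R P ?Y"
        by (rule mod_hom_comp[OF \<pi>h mod_hom_res[OF hh]])
      have q: "(\<lambda>a. I +> a) \<in> mod_hom R (right_regular R) ?Y"
        by (rule mod_homI) (auto simp: coset_in_Quot Quot_coset_simps)
      have qs: "(\<lambda>a. I +> a) ` carrier (right_regular R) = carrier ?Y"
        by (auto simp: FactRing_simps)
      obtain \<psi> where \<psi>: "\<psi> \<in> mod_hom R P (right_regular R)" "\<And>x. x \<in> carrier P \<Longrightarrow> I +> \<psi> x = h (\<pi> x)"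
        by (rule projective_lifting[OF P_mod RR Y db h\<pi> q qs]) (rule that)
      let ?\<psi> = "restrict \<psi> (carrier P)"
      have \<psi>D: "?\<psi> \<in> carrier D" by (rule restrict_in_right_dual[OF P_mod \<psi>(1)])
      have "h = \<tau> ?\<psi>"
      proof (rule ext[OF h \<tau>D[OF \<psi>D]])
        fix x assume x: "x \<in> carrier P"
        have "\<pi> (e x) = \<pi> x" using eq[of "e x" x] e_idem[OF x] x e.closed by simp
        then show "h (\<pi> x) = \<tau> ?\<psi> (\<pi> x)" using \<tau>[OF \<psi>D x] \<psi>(2) x e.closed by simp
      qed
      then show "h \<in> \<tau> ` carrier D" using \<psi>D by blast
    qed
  qed (use \<tau>D in auto)
  moreover have "\<tau> \<psi> = \<zero>\<^bsub>?DX\<^esub> \<longleftrightarrow> dual_map P e \<psi> \<in> ideal_mult (opp R) I D" if \<psi>: "\<psi> \<in> carrier D" for \<psi>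
  proof -
    have "\<tau> \<psi> = \<zero>\<^bsub>?DX\<^esub> \<longleftrightarrow> (\<forall>x\<in>carrier P. \<tau> \<psi> (\<pi> x) = I)"
    proof
      assume "\<tau> \<psi> = \<zero>\<^bsub>?DX\<^esub>"
      then show "\<forall>x\<in>carrier P. \<tau> \<psi> (\<pi> x) = I"
        using \<pi>c by (simp add: right_dual_simps(2) Quot_coset_simps)
    next
      assume "\<forall>x\<in>carrier P. \<tau> \<psi> (\<pi> x) = I"
      then show "\<tau> \<psi> = \<zero>\<^bsub>?DX\<^esub>"
        using \<pi>c by (intro ext[OF \<tau>D[OF \<psi>] DX.M.zero_closed]) (simp add: right_dual_simps(2) Quot_coset_simps)
    qed
    also have "\<dots> \<longleftrightarrow> (\<forall>x\<in>carrier P. \<psi> (e x) \<in> I)"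
      using \<tau>[OF \<psi>] coset_eq_ideal_iff cl[OF \<psi>] e.closed by simp
    also have "\<dots> \<longleftrightarrow> dual_map P e \<psi> \<in> ideal_mult (opp R) I D"
      using ideal_mult_dual_iff[OF dual_map_closed[OF P_mod e \<psi>]] by simp
    finally show ?thesis .
  qed
  ultimately show ?thesis unfolding represents_def by blast
qed

lemma half_lifts_of_lift:
  assumes "right_module (R Quot I) X" "represents R I P e X \<pi>" "right_lift R I X Q"
  shows "half_lifts R I P e"
  by (rule lift_pair_of_lift[OF assms]) (rule lift_pair.half_lifts)

lemma pure_image_of_lift:
  assumes "right_module (R Quot I) X" "represents R I P e X \<pi>" "right_lift R I X Q"
  shows "\<exists>N. pure_submodule R P N \<and> mod_iso R Q (P\<lparr>carrier := N\<rparr>)"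
proof -
  obtain f g where L: "lift_pair R I P K p \<phi> e Q f g" by (rule lift_pair_of_lift[OF assms])
  show ?thesis using lift_pair.pure_image[OF L] by blast
qed

lemma fin_gen_lift_iff:
  assumes "right_module (R Quot I) X" "represents R I P e X \<pi>" "right_lift R I X Q"
  shows "fin_gen R Q \<longleftrightarrow> idem_lifts R I P e"
  by (rule lift_pair_of_lift[OF assms]) (rule lift_pair.fin_gen_iff)

lemma idem_lifts_complement_iff: "idem_lifts R I P (\<lambda>x. x \<ominus>\<^bsub>P\<^esub> e x) \<longleftrightarrow> idem_lifts R I P e"
proof
  interpret C: mod_idempotent R I P K p \<phi> "\<lambda>x. x \<ominus>\<^bsub>P\<^esub> e x" by (rule complement)
  assume "idem_lifts R I P (\<lambda>x. x \<ominus>\<^bsub>P\<^esub> e x)"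
  then have "idem_lifts R I P (\<lambda>x. x \<ominus>\<^bsub>P\<^esub> (x \<ominus>\<^bsub>P\<^esub> e x))" by (rule C.idem_lifts_complement)
  then show "idem_lifts R I P e"
    using e.closed by (simp add: idem_lifts_def P.M.minus_minus_cancel)
qed (rule idem_lifts_complement)

end

text \<open>With a section s of g, the map 1 - sg is an idempotent of P/PI with image X and
  complement X'. Projectivity lifts it to \<open>P\<close> as an endomorphism, idempotent modulo PI
  only.\<close>

lemma (in radical_ideal) split_exact_idempotent:
  assumes P: "right_module R P" and fin: "finite K" and db: "dual_basis R P K p \<phi>"
    and X: "right_module (R Quot I) X" and X': "right_module (R Quot I) X'"
    and sx: "split_exact (R Quot I) X f (mod_reduction R I P) g X'"
  obtains e \<pi> \<pi>' where "mod_idempotent R I P K p \<phi> e" "represents R I P e X \<pi>"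
    "represents R I P (\<lambda>x. x \<ominus>\<^bsub>P\<^esub> e x) X' \<pi>'"
proof -
  interpret P: right_module R P by (rule P)
  let ?Y = "mod_reduction R I P" and ?c = "\<lambda>x. ideal_mult R I P +>\<^bsub>P\<^esub> x"
  have rX: "right_module R (res R I X)" and rX': "right_module R (res R I X')" and rY: "right_module R (res R I ?Y)"
    using X X' right_module_mod_reduction[OF P] by (simp_all add: right_module_res)
  from sx obtain s where f: "f \<in> mod_hom (R Quot I) X ?Y" and g: "g \<in> mod_hom (R Quot I) ?Y X'"
    and inj: "inj_on f (carrier X)" and ker: "f ` carrier X = {y \<in> carrier ?Y. g y = \<zero>\<^bsub>X'\<^esub>}"
    and surj: "g ` carrier ?Y = carrier X'"
    and s: "s \<in> mod_hom (R Quot I) X' ?Y" and gs: "\<And>z. z \<in> carrier X' \<Longrightarrow> g (s z) = z"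
    by (auto simp: split_exact_def)
  note c = coset_hom[OF P]
  have f': "f \<in> mod_hom R (res R I X) (res R I ?Y)" and g': "g \<in> mod_hom R (res R I ?Y) (res R I X')"
    and s': "s \<in> mod_hom R (res R I X') (res R I ?Y)"
    using f g s by (simp_all add: mod_hom_res)
  interpret f: module_hom R "res R I X" "res R I ?Y" f using rX rY f' by (rule module_homI)
  interpret g: module_hom R "res R I ?Y" "res R I X'" g using rY rX' g' by (rule module_homI)
  interpret s: module_hom R "res R I X'" "res R I ?Y" s using rX' rY s' by (rule module_homI)
  interpret c: module_hom R P "res R I ?Y" ?c using P rY c by (rule module_homI)
  have fc: "f x \<in> carrier ?Y" if "x \<in> carrier X" for x using f.closed that by simp
  have gc: "g y \<in> carrier X'" if "y \<in> carrier ?Y" for y using g.closed that by simp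
  have sc: "s z \<in> carrier ?Y" if "z \<in> carrier X'" for z using s.closed that by simp
  have cc: "?c x \<in> carrier ?Y" if "x \<in> carrier P" for x using c.closed that by simp
  have cs: "?c ` carrier P = carrier (res R I ?Y)" by (simp add: mod_reduction_simps[OF P])
  \<comment> \<open>Reduction modulo PI followed by the projection 1 - sg onto the kernel of
    \<open>g\<close>.\<close>
  define \<sigma> where "\<sigma> x = ?c x \<ominus>\<^bsub>res R I ?Y\<^esub> s (g (?c x))" for x
  have \<sigma>: "\<sigma> \<in> mod_hom R P (res R I ?Y)"
    unfolding \<sigma>_def[abs_def]
    by (rule mod_hom_minus[OF P rY c mod_hom_comp[OF mod_hom_comp[OF c g'] s']])
  interpret \<sigma>: module_hom R P "res R I ?Y" \<sigma> using P rY \<sigma> by (rule module_homI)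
  have \<sigma>c: "\<sigma> x \<in> carrier ?Y" if "x \<in> carrier P" for x using \<sigma>.closed that by simp
  have g\<sigma>: "g (\<sigma> x) = \<zero>\<^bsub>X'\<^esub>" if x: "x \<in> carrier P" for x
  proof -
    have "g (\<sigma> x) = g (?c x) \<ominus>\<^bsub>res R I X'\<^esub> g (s (g (?c x)))"
      unfolding \<sigma>_def using cc gc sc x by (intro g.minus) simp_all
    also have "\<dots> = \<zero>\<^bsub>X'\<^esub>" using gs gc[OF cc[OF x]] g.N.M.minus_eq_zero_iff[of "g (?c x)" "g (?c x)"] by simp
    finally show ?thesis .
  qed
  define \<pi> where "\<pi> x = inv_into (carrier X) f (\<sigma> x)" for x
  have \<sigma>f: "\<sigma> x \<in> f ` carrier X" if "x \<in> carrier P" for x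
    unfolding ker using \<sigma>c g\<sigma> that by simp
  have \<pi>c: "\<pi> x \<in> carrier X" and f\<pi>: "f (\<pi> x) = \<sigma> x" if "x \<in> carrier P" for x
    unfolding \<pi>_def by (rule inv_into_into[OF \<sigma>f[OF that]], rule f_inv_into_f[OF \<sigma>f[OF that]])
  have finj: "x = y" if "x \<in> carrier X" "y \<in> carrier X" "f x = f y" for x y
    by (rule inj_onD[OF inj that(3,1,2)])
  have \<pi>: "\<pi> \<in> mod_hom R P (res R I X)"
  proof (rule mod_homI)
    show "\<pi> x \<in> carrier (res R I X)" if "x \<in> carrier P" for x using \<pi>c[OF that] by simp
    show "\<pi> (x \<oplus>\<^bsub>P\<^esub> y) = \<pi> x \<oplus>\<^bsub>res R I X\<^esub> \<pi> y" if x: "x \<in> carrier P" and y: "y \<in> carrier P" for x y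
    proof (rule finj)
      show "\<pi> x \<oplus>\<^bsub>res R I X\<^esub> \<pi> y \<in> carrier X"
        using f.M.M.a_closed[of "\<pi> x" "\<pi> y"] \<pi>c x y by simp
      have "f (\<pi> x \<oplus>\<^bsub>res R I X\<^esub> \<pi> y) = f (\<pi> x) \<oplus>\<^bsub>res R I ?Y\<^esub> f (\<pi> y)"
        using \<pi>c x y by (intro f.add) simp_all
      then show "f (\<pi> (x \<oplus>\<^bsub>P\<^esub> y)) = f (\<pi> x \<oplus>\<^bsub>res R I X\<^esub> \<pi> y)"
        using x y \<sigma>.add[OF x y] by (simp add: f\<pi>)
    qed (use x y \<pi>c in simp)
    show "\<pi> (a \<odot>\<^bsub>P\<^esub> x) = a \<odot>\<^bsub>res R I X\<^esub> \<pi> x" if a: "a \<in> carrier R" and x: "x \<in> carrier P" for a x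
    proof (rule finj)
      show "a \<odot>\<^bsub>res R I X\<^esub> \<pi> x \<in> carrier X"
        using f.M.smult_closed[of a "\<pi> x"] \<pi>c a x by simp
      have "f (a \<odot>\<^bsub>res R I X\<^esub> \<pi> x) = a \<odot>\<^bsub>res R I ?Y\<^esub> f (\<pi> x)"
        using \<pi>c a x by (intro f.smult) simp_all
      then show "f (\<pi> (a \<odot>\<^bsub>P\<^esub> x)) = f (a \<odot>\<^bsub>res R I X\<^esub> \<pi> x)"
        using a x \<sigma>.smult[OF a x] P.smult_closed by (simp add: f\<pi>)
    qed (use a x \<pi>c P.smult_closed in simp)
  qed
  obtain e where e: "e \<in> mod_hom R P P" "\<And>x. x \<in> carrier P \<Longrightarrow> ?c (e x) = \<sigma> x"
    by (rule projective_lifting[OF P P rY db \<sigma> c cs]) (rule that)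
  interpret e: module_hom R P P e using P P e(1) by (rule module_homI)
  \<comment> \<open>The projection is the identity on the kernel of \<open>g\<close>. Applied to
    e(x) this gives idempotency modulo PI, and below it also yields surjectivity onto
    \<open>X\<close>.\<close>
  have \<sigma>0: "\<sigma> x = ?c x" if x: "x \<in> carrier P" "g (?c x) = \<zero>\<^bsub>X'\<^esub>" for x
  proof -
    have "s (g (?c x)) = \<zero>\<^bsub>res R I ?Y\<^esub>" using x s.zero by simp
    moreover have "?c x \<ominus>\<^bsub>res R I ?Y\<^esub> \<zero>\<^bsub>res R I ?Y\<^esub> = ?c x"
      using c.closed[OF x(1)] by (simp only: a_minus_def f.N.M.uminus_zero f.N.M.r_zero)
    ultimately show ?thesis by (simp only: \<sigma>_def)
  qed
  have "mcong R I P (e (e x)) (e x)" if x: "x \<in> carrier P" for x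
  proof -
    have "?c (e (e x)) = ?c (e x)"
      using \<sigma>0[of "e x"] g\<sigma>[OF x] e x e.closed by simp
    then show ?thesis using coset_eq_iff_mcong[OF P] e.closed x by simp
  qed
  then have idem: "mod_idempotent R I P K p \<phi> e"
    by (intro mod_idempotent.intro mod_idempotent_axioms.intro radical_ideal_axioms P fin db e(1))
  have rep: "represents R I P e X \<pi>"
    unfolding represents_def
  proof (intro conjI ballI)
    show "\<pi> \<in> mod_hom R P (res R I X)" by (rule \<pi>)
    show "\<pi> ` carrier P = carrier X"
    proof
      show "carrier X \<subseteq> \<pi> ` carrier P"
      proof
        fix \<xi> assume \<xi>: "\<xi> \<in> carrier X"
        then obtain x where x: "x \<in> carrier P" "f \<xi> = ?c x"
          using fc cs by (metis (no_types, lifting) imageE res_simps(1))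
        have "g (?c x) = \<zero>\<^bsub>X'\<^esub>" using ker \<xi> x by auto
        then have "f (\<pi> x) = f \<xi>" using f\<pi> \<sigma>0 x by simp
        then have "\<xi> = \<pi> x" using finj \<xi> \<pi>c x by metis
        then show "\<xi> \<in> \<pi> ` carrier P" using x by blast
      qed
    qed (use \<pi>c in auto)
    fix x assume x: "x \<in> carrier P"
    have "\<pi> x = \<zero>\<^bsub>X\<^esub> \<longleftrightarrow> f (\<pi> x) = f \<zero>\<^bsub>X\<^esub>"
      using finj[of "\<pi> x" "\<zero>\<^bsub>X\<^esub>"] \<pi>c[OF x] f.M.M.zero_closed by auto
    also have "\<dots> \<longleftrightarrow> ?c (e x) = \<zero>\<^bsub>?Y\<^esub>" using f\<pi>[OF x] e(2)[OF x] f.zero by simp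
    also have "\<dots> \<longleftrightarrow> e x \<in> ideal_mult R I P" using coset_zero_iff[OF P] e.closed x by simp
    finally show "\<pi> x = \<zero>\<^bsub>X\<^esub> \<longleftrightarrow> e x \<in> ideal_mult R I P" .
  qed
  have rep': "represents R I P (\<lambda>x. x \<ominus>\<^bsub>P\<^esub> e x) X' (\<lambda>x. g (?c x))"
    unfolding represents_def
  proof (intro conjI ballI)
    show "(\<lambda>x. g (?c x)) \<in> mod_hom R P (res R I X')" by (rule mod_hom_comp[OF c g'])
    have "(\<lambda>x. g (?c x)) ` carrier P = g ` (?c ` carrier P)" by (simp add: image_image)
    then show "(\<lambda>x. g (?c x)) ` carrier P = carrier X'" using surj cs by simp
    fix x assume x: "x \<in> carrier P"
    have "?c (x \<ominus>\<^bsub>P\<^esub> e x) = ?c x \<ominus>\<^bsub>res R I ?Y\<^esub> \<sigma> x"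
      using c.minus[OF x e.closed[OF x]] e(2)[OF x] by simp
    also have "\<dots> = s (g (?c x))"
      unfolding \<sigma>_def using cc gc sc x by (intro f.N.M.minus_minus_cancel) simp_all
    finally have cs': "?c (x \<ominus>\<^bsub>P\<^esub> e x) = s (g (?c x))" .
    \<comment> \<open>\<open>s\<close> is injective as a section of \<open>g\<close>, so g(c x)
      vanishes exactly when the class of x - e(x) does.\<close>
    have "g (?c x) = \<zero>\<^bsub>X'\<^esub> \<longleftrightarrow> s (g (?c x)) = \<zero>\<^bsub>?Y\<^esub>"
      using gs[OF gc[OF cc[OF x]]] g.zero s.zero by (metis res_simps(2))
    also have "\<dots> \<longleftrightarrow> x \<ominus>\<^bsub>P\<^esub> e x \<in> ideal_mult R I P"
      using coset_zero_iff[OF P, of "x \<ominus>\<^bsub>P\<^esub> e x"] e.closed x cs' by simp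
    finally show "g (?c x) = \<zero>\<^bsub>X'\<^esub> \<longleftrightarrow> x \<ominus>\<^bsub>P\<^esub> e x \<in> ideal_mult R I P" .
  qed
  from idem rep rep' show thesis by (rule that)
qed

theorem theorem2p9:
  fixes R :: "('a, 'r) ring_scheme"
    and I :: "'a set"
    and P :: "('a, 'p) module"
    and X :: "('a set, 'x) module"
    and X' :: "('a set, 'y) module"
    and f :: "'x \<Rightarrow> 'p set"
    and g :: "'p set \<Rightarrow> 'y"
  assumes "ring R"
    and "projective_right R P" and "fin_gen R P"
    and "ideal I R" and "I \<subseteq> jacobson_radical R"
    and "right_module (R Quot I) X" and "right_module (R Quot I) X'"
    and "split_exact (R Quot I) X f (mod_reduction R I P) g X'"
  shows
    \<comment> \<open>(i) and (ii) are equivalent, with or without countable generation\<close>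
    "((\<exists>Q :: ('a, nat \<Rightarrow> 'a) module. right_lift R I X Q) \<longleftrightarrow>
      (\<exists>Q' :: ('a, nat \<Rightarrow> 'a) module. left_lift R I (right_dual (R Quot I) X') Q')) \<and>
     ((\<exists>Q :: ('a, nat \<Rightarrow> 'a) module. right_lift R I X Q) \<longleftrightarrow>
      (\<exists>Q :: ('a, nat \<Rightarrow> 'a) module. right_lift R I X Q \<and> countably_gen R Q)) \<and>
     ((\<exists>Q' :: ('a, nat \<Rightarrow> 'a) module. left_lift R I (right_dual (R Quot I) X') Q') \<longleftrightarrow>
      (\<exists>Q' :: ('a, nat \<Rightarrow> 'a) module.
         left_lift R I (right_dual (R Quot I) X') Q' \<and> countably_gen R Q')) \<and>
     \<comment> \<open>the existence statements do not depend on the chosen type of elements\<close>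
     ((\<exists>Q :: ('a, 'q) module. right_lift R I X Q) \<longrightarrow>
      (\<exists>Q :: ('a, nat \<Rightarrow> 'a) module. right_lift R I X Q)) \<and>
     ((\<exists>Q' :: ('a, 'l) module. left_lift R I (right_dual (R Quot I) X') Q') \<longrightarrow>
      (\<exists>Q' :: ('a, nat \<Rightarrow> 'a) module. left_lift R I (right_dual (R Quot I) X') Q')) \<and>
     ((\<exists>P' :: ('a, 's) module. right_lift R I X' P') \<longrightarrow>
      (\<exists>P' :: ('a, nat \<Rightarrow> 'a) module. right_lift R I X' P')) \<and>
     \<comment> \<open>purity\<close>
     (\<forall>Q :: ('a, 'q) module. right_lift R I X Q \<longrightarrow>
        (\<exists>N. pure_submodule R P N \<and> mod_iso R Q (P\<lparr>carrier := N\<rparr>))) \<and>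
     (\<forall>Q' :: ('a, 'l) module. left_lift R I (right_dual (R Quot I) X') Q' \<longrightarrow>
        (\<exists>N. pure_submodule R (right_dual R P) N \<and>
             mod_iso R Q' ((right_dual R P)\<lparr>carrier := N\<rparr>))) \<and>
     \<comment> \<open>finite generation\<close>
     (\<forall>(Q :: ('a, 'q) module) (Q' :: ('a, 'l) module).
        right_lift R I X Q \<longrightarrow> left_lift R I (right_dual (R Quot I) X') Q' \<longrightarrow>
        (fin_gen R Q \<longleftrightarrow> fin_gen R Q') \<and>
        (fin_gen R Q' \<longleftrightarrow> (\<exists>P' :: ('a, nat \<Rightarrow> 'a) module. right_lift R I X' P')))"
proof -
  interpret radical_ideal R I using assms(1,4,5) by (rule radical_idealI)
  have P: "right_module R P" using assms(2) by (simp add: projective_right_def)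
  obtain B p \<phi> where "dual_basis R P (B :: 'p set) p \<phi>"
    using dual_basis_of_projective_right[OF assms(2)] .
  from finite_dual_basis[OF P this assms(3)]
  obtain K where K: "finite K" "dual_basis R P K p \<phi>" .
  obtain e \<pi> \<pi>' where idem: "mod_idempotent R I P K p \<phi> e" and \<pi>: "represents R I P e X \<pi>"
    and \<pi>': "represents R I P (\<lambda>x. x \<ominus>\<^bsub>P\<^esub> e x) X' \<pi>'"
    by (rule split_exact_idempotent[OF P K assms(6-8)])
  interpret E: mod_idempotent R I P K p \<phi> e by (rule idem)
  interpret C: mod_idempotent R I P K p \<phi> "\<lambda>x. x \<ominus>\<^bsub>P\<^esub> e x" by (rule E.complement)
  let ?D = "right_dual R P" and ?Y = "right_dual (R Quot I) X'" and ?e' = "dual_map P (\<lambda>x. x \<ominus>\<^bsub>P\<^esub> e x)"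
  \<comment> \<open>X' is the image of 1 - e, so its dual belongs to the transpose of 1 - e.\<close>
  interpret O: mod_idempotent "opp R" I ?D K C.\<phi>' "\<lambda>i \<psi>. \<psi> (p i)" ?e' by (rule C.dual)
  obtain \<tau> where \<tau>: "represents (opp R) I ?D ?e' ?Y \<tau>"
    using C.represents_dual[OF assms(7) \<pi>'] by blast
  have Y: "right_module (opp R Quot I) ?Y"
    unfolding Quot_opp by (rule right_module_right_dual[OF assms(7)])
  note opp_lift = right_lift_opp[OF assms(1)]
  note X = assms(6) and X' = assms(7)
  \<comment> \<open>Everything is reduced to these two conditions on \<open>e\<close>: existence of
    either lift to the first, finite generation of either lift to the second. Neither mentions a
    lift, so the element types of lifts cannot matter.\<close>
  let ?half = "half_lifts R I P e" and ?idem = "idem_lifts R I P e"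
  note half_of_right = E.half_lifts_of_lift[OF X \<pi>]
    and half_of_left = O.half_lifts_of_lift[OF Y \<tau>, unfolded opp_lift E.half_lifts_dual_iff]
    and right_of_half = E.lift_of_half_lifts[OF X \<pi>]
    and left_of_half = O.lift_of_half_lifts[OF Y \<tau>, unfolded opp_lift E.half_lifts_dual_iff countably_gen_opp]
    and fin_right = E.fin_gen_lift_iff[OF X \<pi>]
    and fin_left = O.fin_gen_lift_iff[OF Y \<tau>, unfolded opp_lift fin_gen_opp C.idem_lifts_dual_iff
      E.idem_lifts_complement_iff]
    and pure_right = E.pure_image_of_lift[OF X \<pi>]
    and pure_left = O.pure_image_of_lift[OF Y \<tau>, unfolded opp_lift pure_submodule_opp mod_iso_opp]
    and complement = C.lift_of_half_lifts[OF X' \<pi>']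
  have complement_idem: "\<exists>P' :: ('a, nat \<Rightarrow> 'a) module. right_lift R I X' P'" if ?idem
    using complement[OF C.half_lifts_of_idem_lifts] that E.idem_lifts_complement_iff by blast
  \<comment> \<open>A lift of X' gives only the half condition for 1 - e; together with the given
    lift of X it yields a true idempotent.\<close>
  have idem_complement: ?idem if Q: "right_lift R I X Q" and P': "right_lift R I X' P'"
    for Q :: "('a, 'q) module" and P' :: "('a, nat \<Rightarrow> 'a) module"
  proof -
    obtain f g where L: "lift_pair R I P K p \<phi> e Q f g"
      by (rule E.lift_pair_of_lift[OF X \<pi> Q])
    obtain f' g' where L': "lift_pair R I P K p \<phi> (\<lambda>x. x \<ominus>\<^bsub>P\<^esub> e x) P' f' g'"
      by (rule C.lift_pair_of_lift[OF X' \<pi>' P'])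
    show ?thesis by (rule E.idem_lifts_of_two_lifts[OF L L'])
  qed
  show ?thesis
  proof (intro conjI allI impI)
    show "(\<exists>Q :: ('a, nat \<Rightarrow> 'a) module. right_lift R I X Q) \<longleftrightarrow>
        (\<exists>Q' :: ('a, nat \<Rightarrow> 'a) module. left_lift R I ?Y Q')"
      using half_of_right half_of_left right_of_half left_of_half by blast
    show "(\<exists>Q :: ('a, nat \<Rightarrow> 'a) module. right_lift R I X Q) \<longleftrightarrow>
        (\<exists>Q :: ('a, nat \<Rightarrow> 'a) module. right_lift R I X Q \<and> countably_gen R Q)"
      using half_of_right right_of_half by blast
    show "(\<exists>Q' :: ('a, nat \<Rightarrow> 'a) module. left_lift R I ?Y Q') \<longleftrightarrow>
        (\<exists>Q' :: ('a, nat \<Rightarrow> 'a) module. left_lift R I ?Y Q' \<and> countably_gen R Q')"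
      using half_of_left left_of_half by blast
    show "\<exists>Q :: ('a, nat \<Rightarrow> 'a) module. right_lift R I X Q"
      if "\<exists>Q :: ('a, 'q) module. right_lift R I X Q"
      using that half_of_right right_of_half by blast
    show "\<exists>Q' :: ('a, nat \<Rightarrow> 'a) module. left_lift R I ?Y Q'"
      if "\<exists>Q' :: ('a, 'l) module. left_lift R I ?Y Q'"
      using that half_of_left left_of_half by blast
    show "\<exists>P' :: ('a, nat \<Rightarrow> 'a) module. right_lift R I X' P'"
      if "\<exists>P' :: ('a, 's) module. right_lift R I X' P'"
      using that C.half_lifts_of_lift[OF X' \<pi>'] complement by blast
  next
    fix Q :: "('a, 'q) module"
    assume "right_lift R I X Q"
    then show "\<exists>N. pure_submodule R P N \<and> mod_iso R Q (P\<lparr>carrier := N\<rparr>)" by (rule pure_right)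
  next
    fix Q' :: "('a, 'l) module"
    assume "left_lift R I ?Y Q'"
    then show "\<exists>N. pure_submodule R ?D N \<and> mod_iso R Q' (?D\<lparr>carrier := N\<rparr>)" by (rule pure_left)
  next
    fix Q :: "('a, 'q) module" and Q' :: "('a, 'l) module"
    assume Q: "right_lift R I X Q" and Q': "left_lift R I ?Y Q'"
    show "fin_gen R Q \<longleftrightarrow> fin_gen R Q'" using fin_right[OF Q] fin_left[OF Q'] by simp
    show "fin_gen R Q' \<longleftrightarrow> (\<exists>P' :: ('a, nat \<Rightarrow> 'a) module. right_lift R I X' P')"
      using fin_left[OF Q'] complement_idem idem_complement[OF Q] by blast
  qed
qed

end
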